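(* Fix an integer $r\geq 0$. For integers $n\ge 0$ let $$L_n^{\langle r\rangle}(x)=\sum_{j=0}^{n}\binom{n-j+r}{n-j}\frac{x^j}{j!}\in\mathbb{Q}[x].$$ Then for all but finitely many integers $n\geq 0$, the polynomial $L_n^{\langle r\rangle}(x)$ is irreducible over $\mathbb{Q}$ and its Galois group over $\mathbb{Q}$ (as a permutation group on its $n$ roots) contains the alternating group $A_n$.
   Context: $L_n^{\langle r\rangle}(x)$ is the generalized Laguerre polynomial $L_n^{(\alpha)}(x)=(-1)^n\sum_{j=0}^n\binom{n+\alpha}{n-j}\frac{(-x)^j}{j!}$ with parameter $\alpha=-1-n-r$, where $\binom{t}{k}=t(t-1)\cdots(t-k+1)/k!$. *)

theory Defs
  imports
    "HOL-Computational_Algebra.Computational_Algebra"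
    "HOL-Combinatorics.Permutations"
    "HOL-Algebra.Generated_Fields"
    "HOL-Algebra.Sym_Groups"
    "HOL-Algebra.Algebraic_Closure_Type"
begin

definition gen_laguerre :: "nat \<Rightarrow> rat \<Rightarrow> rat poly" where
  "gen_laguerre n \<alpha> =
     Polynomial.smult ((-1) ^ n)
       (\<Sum>j\<le>n. Polynomial.smult (((of_nat n + \<alpha>) gchoose (n - j)) / fact j) ([:0, -1:] ^ j))"

definition laguerre :: "nat \<Rightarrow> nat \<Rightarrow> rat poly" where
  "laguerre r n =
     (\<Sum>j\<le>n. Polynomial.monom (of_nat ((n - j + r) choose (n - j)) / fact j) j)"

lemma laguerre_eq_gen_laguerre:
  "laguerre r n = gen_laguerre n (-1 - of_nat n - of_nat r)"
proof -
  have smult_sum: "Polynomial.smult c (sum f A) = (\<Sum>x\<in>A. Polynomial.smult c (f x))"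
    for c :: rat and f :: "nat \<Rightarrow> rat poly" and A
    by (induction A rule: infinite_finite_induct) (simp_all add: Polynomial.smult_add_right)
  have "Polynomial.monom (of_nat ((n - j + r) choose (n - j)) / fact j) j =
        Polynomial.smult ((-1) ^ n) (Polynomial.smult
          (((of_nat n + (-1 - of_nat n - of_nat r) :: rat) gchoose (n - j)) / fact j) ([:0, -1:] ^ j))"
    if "j \<le> n" for j
  proof -
    have *: "of_nat n + (-1 - of_nat n - of_nat r) = (- (of_nat r + 1) :: rat)"
      by simp
    have bin: "((of_nat n + (-1 - of_nat n - of_nat r) :: rat) gchoose (n - j)) =
               (-1) ^ (n - j) * of_nat ((n - j + r) choose (n - j))"
      unfolding * gbinomial_minus binomial_gbinomial by (simp add: add_ac)
    have neg_x: "[:0, -1 :: rat:] ^ j = Polynomial.monom ((-1) ^ j) j"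
      by (induction j) (simp_all add: Polynomial.monom_0 Polynomial.monom_Suc one_pCons Polynomial.minus_monom)
    have "(-1 :: rat) ^ n * (-1) ^ (n - j) * (-1) ^ j = 1"
      using that by (simp add: mult.assoc flip: power_add power_mult_distrib)
    then show ?thesis
      unfolding bin neg_x by (simp add: smult_monom mult_ac)
  qed
  then show ?thesis
    unfolding laguerre_def gen_laguerre_def smult_sum by (intro sum.cong) auto
qed

lemma coeff_laguerre:
  "Polynomial.coeff (laguerre r n) j =
     (if j \<le> n then of_nat ((n - j + r) choose (n - j)) / fact j else 0)"
  by (simp add: laguerre_def Polynomial.coeff_sum)

lemma degree_laguerre [simp]: "Polynomial.degree (laguerre r n) = n"
  by (rule antisym, rule Polynomial.degree_le) (auto simp: coeff_laguerre intro!: Polynomial.le_degree)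

abbreviation complex_ring :: "complex ring" where
  "complex_ring \<equiv> ring_of_type_algebra"

definition complex_roots :: "rat poly \<Rightarrow> complex set" where
  "complex_roots f = {z. poly (map_poly of_rat f) z = 0}"

definition splitting_field :: "rat poly \<Rightarrow> complex ring" where
  "splitting_field f =
     complex_ring \<lparr>carrier := generate_field complex_ring (\<rat> \<union> complex_roots f)\<rparr>"

definition field_automorphisms :: "rat poly \<Rightarrow> (complex \<Rightarrow> complex) set" where
  "field_automorphisms f =
     {\<sigma> \<in> ring_iso (splitting_field f) (splitting_field f). \<forall>q \<in> \<rat>. \<sigma> q = q}"

text \<open>
  Elements of \<^const>\<open>ring_iso\<close> are arbitrary off the carrier. This is harmless here: only their
  action on the roots is retained, extended by the identity so that it can be compared with
  \<^const>\<open>Permutations.permutes\<close>.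
\<close>

definition galois_perms :: "rat poly \<Rightarrow> (complex \<Rightarrow> complex) set" where
  "galois_perms f =
     {\<pi>. \<exists>\<sigma> \<in> field_automorphisms f. \<pi> = (\<lambda>z. if z \<in> complex_roots f then \<sigma> z else z)}"

definition alternating_perms :: "'a set \<Rightarrow> ('a \<Rightarrow> 'a) set" where
  "alternating_perms S = {\<pi>. \<pi> permutes S \<and> evenperm \<pi>}"

lemma alternating_perms_alt_group: "alternating_perms {1..n} = carrier (alt_group n)"
  by (simp add: alternating_perms_def alt_group_def)

end

theory Submission
  imports Defs "HOL-Algebra.Sylow" "HOL-Number_Theory.Number_Theory" "HOL-Real_Asymp.Real_Asymp"
begin

text \<open>
  Write \<open>L n\<close> for \<open>laguerre r n\<close>. A valuation ring of the complex numbers above a prime \<open>p\<close> turns the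
  \<open>p\<close>-adic Newton polygon of \<open>L n\<close> into valuations of its roots.

  \<^emph>\<open>Irreducibility\<close> (following Coleman and Hajir). If \<open>p ^ a\<close> divides \<open>n\<close> and \<open>p ^ a > r\<close>, the slopes of \<open>L n\<close> are
  those of the truncated exponential series; their denominators are divisible by \<open>p ^ a\<close>, hence so is the degree
  of every rational factor. Therefore a factor of degree \<open>d\<close> satisfies \<open>n \<le> d r!\<close>, and \<open>binomial n d\<close> is
  exponentially large for a proper factor. On the other hand, for \<open>p\<^sup>2 > n + r\<close> the only slopes are \<open>0\<close> and \<open>1 / p\<close> unless \<open>p\<close>
  divides \<open>(n + 1) \<dots> (n + r)\<close>, and then the degree \<open>d\<close> of a factor satisfies \<open>d mod p \<le> n mod p\<close>, which means that \<open>p\<close>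
  does not divide \<open>binomial n d\<close>. So \<open>binomial n d\<close> is at most about \<open>n powr (sqrt n)\<close>, a contradiction for large \<open>n\<close>.

  \<^emph>\<open>Galois group\<close>. For large \<open>n\<close> there is a prime \<open>p\<close> with \<open>n / 2 < p < n - 2\<close>, and \<open>2 p \<ge> n + r + 3\<close>. Exactly \<open>p\<close> of the
  roots have valuation \<open>1 / p\<close>, the others are units. A product of \<open>n - p + 1\<close> roots, and each of its conjugates,
  therefore has a valuation \<open>k / p\<close> with \<open>0 < k < p\<close>; the conjugates are the roots of a rational polynomial whose degree
  is the order of the Galois group, and so \<open>p\<close> divides this order. By Jordan's theorem a
  transitive group of degree \<open>n\<close> whose order is divisible by such a prime contains the alternating group.
\<close>

text \<open>All valuations live in one ring of complex numbers, so roots, splitting field and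
  resolvents are handled without completions or extensions of valuations. Slopes act through one
  principle: for a rational polynomial, \<mu> times the number of roots of valuation \<mu> is an
  integer. It controls the degrees of factors, and also the group order, being applied to a
  resolvent whose roots are indexed by the group itself. What separates the polynomials from the
  exponential series is the factor \<open>n - j + r choose r\<close> of the coefficients. For
  \<open>p ^ a > r\<close> it is a unit at the decisive indices, the multiples of
  \<open>p ^ a\<close>; smaller prime powers in \<open>n\<close> cost only the bounded factor
  \<open>fact r\<close>; and the large primes that escape the slope argument have a product of at
  most \<open>(n + r) ^ r\<close>. Among sets of roots, \<open>n - p + 1\<close> is the least size
  that forces a common element with the \<open>p\<close> roots of valuation \<open>1 / p\<close>.
  The prime itself comes from Erdos's proof of Bertrand's postulate, with slack at both ends of the
  interval.\<close>

unbundle no m_inv_syntax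

subsection \<open>Fixed points of maps of prime order\<close>

lemma funpow_order_mod:
  fixes f :: "'a \<Rightarrow> 'a"
  assumes "f ^^ p = id"
  shows "f ^^ (i mod p) = f ^^ i"
proof -
  have "f ^^ i = f ^^ (p * (i div p) + i mod p)" by simp
  also have "\<dots> = (f ^^ p) ^^ (i div p) \<circ> f ^^ (i mod p)"
    by (simp only: funpow_add funpow_mult mult.commute)
  finally show ?thesis by (simp add: assms)
qed

lemma prime_mod_inverse_exists:
  assumes "prime (p :: nat)" "\<not> p dvd j"
  shows "\<exists>k. (j * k) mod p = 1"
proof -
  have "coprime j p" using assms prime_imp_coprime coprime_commute by blast
  then obtain k where k: "[j * k = 1] (mod p)" using cong_solve_coprime_nat by auto
  then show ?thesis using prime_gt_1_nat[OF assms(1)]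
    unfolding unique_euclidean_semiring_class.cong_def by (intro exI[of _ k]) auto
qed

text \<open>\<open>j\<close> is invertible modulo \<open>p\<close>, so \<open>f\<close> is itself a
  power of \<open>f ^^ j\<close>.\<close>

lemma funpow_prime_order_fixed:
  fixes f :: "'a \<Rightarrow> 'a"
  assumes "prime p" "f ^^ p = id" "(f ^^ j) x = x" "\<not> p dvd j"
  shows "f x = x"
proof -
  obtain k where k: "(j * k) mod p = 1" using prime_mod_inverse_exists assms by blast
  have "(f ^^ (j * k)) x = x"
    by (induction k) (simp_all add: funpow_add assms(3))
  moreover have "f ^^ (j * k) = f ^^ ((j * k) mod p)" using funpow_order_mod[OF assms(2)] by metis
  ultimately show ?thesis using k by simp
qed

lemma card_prime_orbit:
  fixes f :: "'a \<Rightarrow> 'a"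
  assumes "prime p" "f ^^ p = id" "f x \<noteq> x"
  shows "inj_on (\<lambda>i. (f ^^ i) x) {..<p}" and "range (\<lambda>i. (f ^^ i) x) = (\<lambda>i. (f ^^ i) x) ` {..<p}"
    and "card (range (\<lambda>i. (f ^^ i) x)) = p"
proof -
  have p0: "p > 0" using assms(1) prime_gt_0_nat by blast
  have *: "(f ^^ i) x \<noteq> (f ^^ j) x" if "i < j" "j < p" for i j
  proof
    assume eq: "(f ^^ i) x = (f ^^ j) x"
    have 1: "f ^^ (p - i) \<circ> f ^^ i = f ^^ p" using that by (simp flip: funpow_add)
    have 2: "f ^^ (p - i) \<circ> f ^^ j = f ^^ (j - i) \<circ> f ^^ p"
      using that by (simp add: add.commute flip: funpow_add)
    have "(f ^^ (j - i)) x = x"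
      using fun_cong[OF 1, of x] fun_cong[OF 2, of x] eq assms(2) by simp
    moreover have "\<not> p dvd (j - i)" using that by (auto dest!: dvd_imp_le)
    ultimately show False using funpow_prime_order_fixed[OF assms(1,2)] assms(3) by blast
  qed
  show inj: "inj_on (\<lambda>i. (f ^^ i) x) {..<p}"
    by (rule inj_onI) (metis * lessThan_iff linorder_neqE_nat)
  show im: "range (\<lambda>i. (f ^^ i) x) = (\<lambda>i. (f ^^ i) x) ` {..<p}"
  proof (rule equalityI, rule subsetI)
    fix y assume "y \<in> range (\<lambda>i. (f ^^ i) x)"
    then obtain i where "y = (f ^^ i) x" by blast
    then have "y = (f ^^ (i mod p)) x" by (simp add: funpow_order_mod[OF assms(2)])
    then show "y \<in> (\<lambda>i. (f ^^ i) x) ` {..<p}" using p0 by auto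
  qed auto
  show "card (range (\<lambda>i. (f ^^ i) x)) = p" unfolding im by (simp add: card_image[OF inj])
qed

text \<open>The moved points form disjoint orbits of exactly \<open>p\<close> elements. The lemma
  serves for permutations of points and, in \<open>prime_cycle_conjugate\<close>, for conjugation
  acting on a set of cyclic groups.\<close>

lemma prime_dvd_card_moved:
  fixes f :: "'a \<Rightarrow> 'a"
  assumes "prime p" "f ^^ p = id" "finite M" "f ` M \<subseteq> M"
  shows "p dvd card {x \<in> M. f x \<noteq> x}"
proof -
  define Orb where "Orb x = range (\<lambda>i. (f ^^ i) x)" for x
  define Y where "Y = {x \<in> M. f x \<noteq> x}"
  have p0: "p > 0" using assms(1) prime_gt_0_nat by blast
  have fX: "(f ^^ i) x \<in> M" if "x \<in> M" for x i using that assms(4) by (induction i) auto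
  have sym: "Orb x = Orb y" if y: "y \<in> Orb x" for x y
  proof -
    obtain i' where "y = (f ^^ i') x" using y unfolding Orb_def by blast
    then have "y = (f ^^ (i' mod p)) x" by (simp add: funpow_order_mod[OF assms(2)])
    then obtain i where i: "y = (f ^^ i) x" "i < p" using mod_less_divisor[OF p0, of i'] by blast
    have "(f ^^ (p - i)) y = (f ^^ p) x" using i
      by (metis comp_apply funpow_add le_add_diff_inverse2 less_imp_le)
    then have x: "x = (f ^^ (p - i)) y" by (simp add: assms(2))
    have "(f ^^ k) y \<in> Orb x" for k
      using i by (auto simp: Orb_def funpow_add[symmetric, unfolded o_def, THEN fun_cong])
    moreover have "(f ^^ k) x \<in> Orb y" for k
      unfolding Orb_def by (subst x, rule range_eqI[of _ _ "k + (p - i)"]) (simp add: funpow_add)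
    ultimately show ?thesis unfolding Orb_def by blast
  qed
  have moved: "f y \<noteq> y" if "y \<in> Orb x" "f x \<noteq> x" for x y
  proof
    assume "f y = y"
    then have "(f ^^ k) y = y" for k by (induction k) auto
    then have "Orb y = {y}" by (auto simp: Orb_def)
    moreover have "f x \<in> Orb x" "x \<in> Orb x" unfolding Orb_def
      by (rule range_eqI[of _ _ 1], simp, rule range_eqI[of _ _ 0], simp)
    ultimately show False using sym[OF that(1)] that(2) by auto
  qed
  have un: "\<Union> (Orb ` Y) = Y"
  proof
    show "\<Union> (Orb ` Y) \<subseteq> Y" using moved fX by (auto simp: Y_def Orb_def)
    show "Y \<subseteq> \<Union> (Orb ` Y)"
    proof
      fix x assume "x \<in> Y"
      moreover have "x \<in> Orb x" unfolding Orb_def by (rule range_eqI[of _ _ 0]) simp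
      ultimately show "x \<in> \<Union> (Orb ` Y)" by blast
    qed
  qed
  have "p dvd card (\<Union> (Orb ` Y))"
  proof (rule dvd_partition)
    show "finite (\<Union> (Orb ` Y))" unfolding un using assms(3) by (simp add: Y_def)
    show "\<forall>c\<in>Orb ` Y. p dvd card c"
      using card_prime_orbit(3)[OF assms(1,2)] by (auto simp: Orb_def Y_def)
    show "\<forall>c1\<in>Orb ` Y. \<forall>c2\<in>Orb ` Y. c1 \<noteq> c2 \<longrightarrow> c1 \<inter> c2 = {}" using sym by blast
  qed
  then show ?thesis by (simp add: un) (simp add: Y_def)
qed

subsection \<open>Three-cycles and the alternating group\<close>

definition three_cycle :: "'a \<Rightarrow> 'a \<Rightarrow> 'a \<Rightarrow> 'a \<Rightarrow> 'a" where
  "three_cycle a b c = Transposition.transpose a b \<circ> Transposition.transpose b c"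

lemma three_cycle_conj:
  assumes "bij g"
  shows "g \<circ> three_cycle a b c \<circ> inv g = three_cycle (g a) (g b) (g c)"
proof -
  have "g \<circ> Transposition.transpose x y = Transposition.transpose (g x) (g y) \<circ> g" for x y
    using assms by (auto simp: fun_eq_iff Transposition.transpose_def inj_eq bij_is_inj)
  then have "g \<circ> three_cycle a b c = three_cycle (g a) (g b) (g c) \<circ> g"
    unfolding three_cycle_def by (metis comp_assoc)
  then show ?thesis using assms by (metis bij_is_surj comp_assoc comp_id surj_iff)
qed

locale perm_group =
  fixes S :: "'a set" and G :: "('a \<Rightarrow> 'a) set"
  assumes fin: "finite S" and perm: "g \<in> G \<Longrightarrow> g permutes S"
    and one: "id \<in> G" and comp: "g \<in> G \<Longrightarrow> h \<in> G \<Longrightarrow> g \<circ> h \<in> G"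
    and inv: "g \<in> G \<Longrightarrow> inv g \<in> G"
begin

lemma bijG: "g \<in> G \<Longrightarrow> bij g" using perm permutes_bij by blast
lemma injG: "g \<in> G \<Longrightarrow> inj g" using bijG bij_is_inj by blast
lemma inv_right [simp]: "g \<in> G \<Longrightarrow> g (inv g x) = x" using perm permutes_inverses(1) by metis
lemma inv_left [simp]: "g \<in> G \<Longrightarrow> inv g (g x) = x" using perm permutes_inverses(2) by metis

lemma finG: "finite G"
  using finite_subset[OF _ finite_permutations[OF fin]] perm by (metis mem_Collect_eq subsetI)

lemma funpow: "g \<in> G \<Longrightarrow> g ^^ i \<in> G"
  by (induction i) (auto simp: one comp)

text \<open>A pair of transpositions is a product of at most two three-cycles. The induction
  multiplies by one transposition at a time and so alternates parity; its invariant therefore speaks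
  of odd permutations too, which enter \<open>G\<close> after one more transposition.\<close>

lemma alternating_subset:
  assumes three: "\<And>a b c. a \<in> S \<Longrightarrow> b \<in> S \<Longrightarrow> c \<in> S \<Longrightarrow> a \<noteq> b \<Longrightarrow> b \<noteq> c \<Longrightarrow> a \<noteq> c \<Longrightarrow> three_cycle a b c \<in> G"
  shows "alternating_perms S \<subseteq> G"
proof -
  let ?t = Transposition.transpose
  have pair: "?t a b \<circ> ?t c d \<in> G" if abcd: "a \<in> S" "b \<in> S" "c \<in> S" "d \<in> S" "a \<noteq> b" "c \<noteq> d" for a b c d
  proof -
    have adj: "?t a b \<circ> ?t b d \<in> G" if "a \<in> S" "b \<in> S" "d \<in> S" "a \<noteq> b" "b \<noteq> d" for a b d
      using three[of a b d] that one
      by (cases "a = d") (auto simp: three_cycle_def transpose_commute)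
    show ?thesis
    proof (cases "b = c")
      case True then show ?thesis using adj abcd by blast
    next
      case False
      have "(?t a b \<circ> ?t b c) \<circ> (?t b c \<circ> ?t c d) = ?t a b \<circ> ?t c d"
        by (auto simp: fun_eq_iff)
      then show ?thesis using comp[OF adj[of a b c] adj[of b c d]] abcd False by simp
    qed
  qed
  have main: "(evenperm \<pi> \<longrightarrow> \<pi> \<in> G) \<and> (\<not> evenperm \<pi> \<longrightarrow> (\<forall>c\<in>S. \<forall>d\<in>S. c \<noteq> d \<longrightarrow> ?t c d \<circ> \<pi> \<in> G))"
    if "\<pi> permutes S" for \<pi>
    using that fin
  proof (induction rule: permutes_induct)
    case id then show ?case by (simp add: one[unfolded id_def])
  next
    case (swap a b q)
    have pq: "permutation q" using swap fin permutation_permutes by blast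
    show ?case
    proof (cases "a = b")
      case True then show ?thesis using swap by simp
    next
      case False
      have e: "evenperm (?t a b \<circ> q) \<longleftrightarrow> \<not> evenperm q"
        using False by (simp add: evenperm_comp[OF permutation_swap_id pq] evenperm_swap)
      show ?thesis
      proof (cases "evenperm q")
        case True
        then have q: "q \<in> G" using swap by blast
        have "?t c d \<circ> (?t a b \<circ> q) \<in> G" if "c \<in> S" "d \<in> S" "c \<noteq> d" for c d
          using comp[OF pair[of c d a b] q] that swap False by (simp add: comp_assoc)
        then show ?thesis using e True by blast
      next
        case nt: False
        then show ?thesis using e swap False by blast
      qed
    qed
  qed
  then show ?thesis by (auto simp: alternating_perms_def)
qed

subsection \<open>Jordan's theorem on permutation groups\<close>

text \<open>As \<open>g permutes T\<close> forces \<open>g\<close> to fix every point outside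
  \<open>T\<close>, this is transitivity of the pointwise stabiliser of the complement of
  \<open>T\<close>.\<close>

definition transitive_on :: "'a set \<Rightarrow> bool" where
  "transitive_on T \<longleftrightarrow> (\<forall>a\<in>T. \<forall>b\<in>T. \<exists>g\<in>G. g permutes T \<and> g a = b)"

text \<open>Primitivity of the same pointwise stabiliser, expressed through blocks: a proper subset
  with at least two points always has a translate that overlaps it without being equal to
  it.\<close>

definition primitive_on :: "'a set \<Rightarrow> bool" where
  "primitive_on T \<longleftrightarrow> T \<subseteq> S \<and> transitive_on T \<and>
     (\<forall>E. E \<subset> T \<and> 2 \<le> card E \<longrightarrow> (\<exists>h\<in>G. h permutes T \<and> h ` E \<noteq> E \<and> h ` E \<inter> E \<noteq> {}))"

text \<open>Move \<open>E\<close> so that it contains \<open>x\<close>; the result \<open>E1\<close>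
  meets \<open>T\<close> in some \<open>e'\<close> and misses some \<open>y\<close> in
  \<open>T\<close>. An element of the stabiliser sending \<open>e'\<close> to \<open>y\<close> fixes
  \<open>x\<close>, so it moves \<open>E1\<close> to a different set that still contains
  \<open>x\<close>.\<close>

lemma primitive_on_insert:
  assumes T: "primitive_on T" and trans: "transitive_on (insert x T)" and x: "x \<in> S" "x \<notin> T"
  shows "primitive_on (insert x T)"
  unfolding primitive_on_def
proof (intro conjI allI impI)
  show "insert x T \<subseteq> S" using T x by (auto simp: primitive_on_def)
  fix E assume E: "E \<subset> insert x T \<and> 2 \<le> card E"
  have "E \<noteq> {}" using E by auto
  then obtain e where e: "e \<in> E" by blast
  then obtain k where k: "k \<in> G" "k permutes insert x T" "k e = x"
    using trans E unfolding transitive_on_def by blast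
  define E1 where "E1 = k ` E"
  have E1: "x \<in> E1" "E1 \<subseteq> insert x T" "card E1 = card E"
    using k e E permutes_in_image[OF k(2)] card_image[OF inj_on_subset[OF injG[OF k(1)] subset_UNIV]]
    unfolding E1_def by auto
  have "E1 \<noteq> insert x T"
  proof
    assume "E1 = insert x T"
    then have "k ` E = k ` (insert x T)" unfolding E1_def using permutes_image[OF k(2)] by simp
    then have "E = insert x T" by (simp only: inj_image_eq_iff[OF injG[OF k(1)]])
    then show False using E by blast
  qed
  then obtain y where y: "y \<in> T" "y \<notin> E1" using E1 by auto
  have "\<not> E1 \<subseteq> {x}" using E1(3) E card_mono[of "{x}" E1] by auto
  then obtain e' where e': "e' \<in> E1" "e' \<in> T" using E1 by auto
  obtain h where h: "h \<in> G" "h permutes T" "h e' = y"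
    using T e' y unfolding primitive_on_def transitive_on_def by blast
  have hx: "h x = x" using h(2) x(2) by (simp add: permutes_not_in)
  define h' where "h' = inv k \<circ> h \<circ> k"
  have "h' \<in> G" using k h comp inv by (simp add: h'_def)
  moreover have "h' permutes insert x T" unfolding h'_def
    using k h by (meson permutes_compose permutes_inv permutes_subset subset_insertI)
  moreover have "h' e = e" using hx k inv_left[OF k(1), of e] by (simp add: h'_def)
  then have "h' ` E \<inter> E \<noteq> {}" using e by (metis disjoint_iff imageI)
  moreover have "h' ` E \<noteq> E"
  proof
    assume eq: "h' ` E = E"
    obtain a where a: "a \<in> E" "e' = k a" using e' E1_def by blast
    have "h' a \<in> E" using eq a by blast
    then have "k (h' a) \<in> E1" by (simp add: E1_def)
    then show False using a h y k by (simp add: h'_def)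
  qed
  ultimately show "\<exists>h\<in>G. h permutes insert x T \<and> h ` E \<noteq> E \<and> h ` E \<inter> E \<noteq> {}" by blast
qed (use trans in auto)

text \<open>Among the translates of \<open>T\<close> other than \<open>T\<close>, take one with the
  largest intersection \<open>D\<close> with \<open>T\<close>. The assumption \<open>big\<close>
  makes \<open>D\<close> nonempty, and primitivity leaves the translate a single point outside
  \<open>T\<close>, since otherwise a larger intersection could be produced. The union of the two
  sets is then \<open>insert x T\<close>, and transitivity passes through a common point.\<close>

lemma primitive_on_grow:
  assumes transS: "transitive_on S" and T: "primitive_on T" and big: "card S < 2 * card T" and ne: "T \<noteq> S"
  shows "\<exists>x\<in>S - T. primitive_on (insert x T)"
proof -
  have TS: "T \<subseteq> S" and trT: "transitive_on T" using T by (auto simp: primitive_on_def)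
  have finT: "finite T" using TS fin finite_subset by blast
  have cim: "card (g ` E) = card E" if "g \<in> G" for g E
    using card_image[OF inj_on_subset[OF injG[OF that] subset_UNIV]] .
  have imS: "g ` T \<subseteq> S" if "g \<in> G" for g using TS perm[OF that] by (auto simp: permutes_in_image)
  define Q where "Q g \<longleftrightarrow> g \<in> G \<and> g ` T \<noteq> T" for g
  obtain a b where "a \<in> T" "b \<in> S - T" using big TS ne by fastforce
  moreover from this obtain g where "g \<in> G" "g a = b" using transS TS unfolding transitive_on_def by blast
  ultimately have "Q g" by (auto simp: Q_def)
  moreover have bound: "card (T \<inter> g ` T) < card S + 1" for g
    using card_mono[OF fin, of "T \<inter> g ` T"] TS by (simp add: le_infI1 less_Suc_eq_le)
  ultimately obtain g where g: "Q g" and max: "\<And>g'. Q g' \<Longrightarrow> card (T \<inter> g' ` T) \<le> card (T \<inter> g ` T)"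
    using ex_has_greatest_nat[of Q g "\<lambda>g. card (T \<inter> g ` T)" "card S + 1"] by (metis Suc_eq_plus1 less_Suc_eq_le less_imp_le)
  have gG: "g \<in> G" using g by (simp add: Q_def)
  define D where "D = T \<inter> g ` T"
  define E where "E = T - g ` T"
  define F where "F = g ` T - T"
  have fins: "finite D" "finite E" "finite F" using finT by (auto simp: D_def E_def F_def)
  have cE: "card E + card D = card T"
    using card_Un_disjoint[OF fins(2,1)] by (simp add: D_def E_def Un_Diff_Int Int_Diff_Un Un_commute) (metis D_def Diff_disjoint E_def Int_Diff_Un Int_commute Int_Diff Un_Diff_Int)
  have cF: "card F + card D = card T"
    using card_Un_disjoint[OF fins(3,1)] cim[OF gG, of T]
    by (metis (no_types, lifting) D_def Diff_disjoint F_def Int_Diff Int_commute Un_Diff_Int inf.idem inf_commute)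
  have "card (T \<union> g ` T) \<le> card S" using TS imS[OF gG] by (simp add: card_mono fin)
  moreover have "card (T \<union> g ` T) + card D = 2 * card T"
    using card_Un_Int[OF finT, of "g ` T"] finT cim[OF gG, of T] by (simp add: D_def)
  ultimately have D0: "D \<noteq> {}" using big by auto
  have "card E \<noteq> 0"
  proof
    assume "card E = 0"
    then have "T \<subseteq> g ` T" using fins by (auto simp: E_def)
    then have "T = g ` T" using card_subset_eq[of "g ` T" T] finT cim[OF gG, of T] by auto
    then show False using g by (simp add: Q_def)
  qed
  moreover have "\<not> 2 \<le> card E"
  proof
    assume c2: "2 \<le> card E"
    have "E \<subset> T" using D0 by (auto simp: E_def D_def)
    then obtain h where h: "h \<in> G" "h permutes T" "h ` E \<noteq> E" "h ` E \<inter> E \<noteq> {}"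
      using T[unfolded primitive_on_def, THEN conjunct2, THEN conjunct2, rule_format, of E] c2 by metis
    have TE: "T - E = D" by (auto simp: E_def D_def)
    have hD: "h ` D = T - h ` E"
      using TE image_set_diff[OF injG[OF h(1)], of T E] permutes_image[OF h(2)] by simp
    have hF: "h y = y" if "y \<in> F" for y using h(2) that by (simp add: F_def permutes_not_in)
    have hgT: "h ` g ` T = h ` D \<union> F"
    proof -
      have "g ` T = D \<union> F" by (auto simp: D_def F_def)
      then show ?thesis using hF by (simp add: image_Un)
    qed
    have ne2: "h ` g ` T \<noteq> g ` T"
    proof
      assume "h ` g ` T = g ` T"
      then have "T \<inter> (h ` D \<union> F) = D" using hgT by (simp add: D_def)
      then have "h ` D = D" using hD by (auto simp: F_def)
      then have "T - h ` E = T - E" using hD TE by simp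
      moreover have "h ` E \<subseteq> T" "E \<subseteq> T" using permutes_image[OF h(2)] by (auto simp: E_def)
      ultimately show False using h(3) by blast
    qed
    \<comment> \<open>\<open>g\<close> carries \<open>T\<close> and its translate under
      \<open>g'\<close> to the translates of \<open>T\<close> under \<open>g\<close> and
      \<open>h \<circ> g\<close>, so the intersection of the last two competes with
      \<open>D\<close>.\<close>
    define g' where "g' = inv g \<circ> h \<circ> g"
    have g'G: "g' \<in> G" using comp inv gG h by (simp add: g'_def)
    have gg': "g ` g' ` T = h ` g ` T" using gG by (simp add: g'_def image_image)
    have "g' ` T \<noteq> T" using gg' ne2 by metis
    then have "Q g'" using g'G by (simp add: Q_def)
    then have "card (T \<inter> g' ` T) \<le> card D" using max by (simp add: D_def)
    moreover have "card (T \<inter> g' ` T) = card (g ` T \<inter> h ` g ` T)"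
      using cim[OF gG, of "T \<inter> g' ` T"] gg' by (simp add: image_Int[OF injG[OF gG]])
    \<comment> \<open>The count is |F| + |T| - |E \<union> hE| = |D| + |E \<inter> hE|, using |F| =
      |E| and |D| = |T| - |E|; it exceeds |D| because \<open>E\<close> and its translate
      overlap.\<close>
    moreover have "F \<union> (D \<inter> h ` D) \<subseteq> g ` T \<inter> h ` g ` T" using hgT by (auto simp: D_def F_def)
    then have "card (F \<union> (D \<inter> h ` D)) \<le> card (g ` T \<inter> h ` g ` T)" using finT by (intro card_mono) auto
    moreover have "card (F \<union> (D \<inter> h ` D)) = card F + card (D \<inter> h ` D)"
      using fins by (intro card_Un_disjoint) (auto simp: D_def F_def)
    moreover have "card (D \<inter> h ` D) + card (E \<union> h ` E) = card T"
    proof -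
      have "D \<inter> h ` D = T - (E \<union> h ` E)" using hD TE by blast
      moreover have "E \<union> h ` E \<subseteq> T" using permutes_image[OF h(2)] by (auto simp: E_def)
      ultimately show ?thesis using finT by (metis card_Diff_subset card_mono finite_subset le_add_diff_inverse2)
    qed
    moreover have "card (E \<union> h ` E) + card (h ` E \<inter> E) = 2 * card E"
      using card_Un_Int[of E "h ` E"] fins cim[OF h(1), of E] by (simp add: Int_commute)
    moreover have "card (h ` E \<inter> E) \<noteq> 0" using h(4) fins by auto
    ultimately show False using cE cF by linarith
  qed
  ultimately have "card F = 1" using cE cF by linarith
  then obtain x where x: "F = {x}" by (auto simp: card_1_singleton_iff)
  have un: "insert x T = T \<union> g ` T" using x by (auto simp: F_def)
  have xS: "x \<in> S" "x \<notin> T" using x imS[OF gG] by (auto simp: F_def)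
  obtain c where c: "c \<in> T" "c \<in> g ` T" using D0 by (auto simp: D_def)
  have conn: "\<exists>k\<in>G. k permutes insert x T \<and> k a = c" if "a \<in> insert x T" for a
  proof (cases "a \<in> T")
    case True
    then obtain k where "k \<in> G" "k permutes T" "k a = c" using trT c unfolding transitive_on_def by blast
    then show ?thesis using permutes_subset[of k T "insert x T"] by blast
  next
    case False
    then have "a \<in> g ` T" using that un by blast
    then obtain a' c' where ac: "a' \<in> T" "a = g a'" "c' \<in> T" "c = g c'" using c by blast
    then obtain k where k: "k \<in> G" "k permutes T" "k a' = c'" using trT unfolding transitive_on_def by blast
    have "g \<circ> k \<circ> inv g permutes g ` T"
    proof -
      have "bij_betw (g \<circ> k \<circ> inv g) (g ` T) (g ` T)"
      proof (rule bij_betw_imageI)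
        show "inj_on (g \<circ> k \<circ> inv g) (g ` T)"
          using injG[OF comp[OF comp[OF gG k(1)] inv[OF gG]]] inj_on_subset by blast
        have "k ` T = T" using k(2) by (rule permutes_image)
        moreover have "(g \<circ> k \<circ> inv g) ` g ` T = g ` k ` T" using gG by (simp add: image_image)
        ultimately show "(g \<circ> k \<circ> inv g) ` g ` T = g ` T" by simp
      qed
      moreover have "(g \<circ> k \<circ> inv g) y = y" if "y \<notin> g ` T" for y
      proof -
        have "inv g y \<notin> T" using that imageI[of "inv g y" T g] inv_right[OF gG, of y] by auto
        then show ?thesis using k(2) gG by (simp add: permutes_not_in)
      qed
      ultimately show ?thesis by (simp add: bij_imp_permutes)
    qed
    then have "g \<circ> k \<circ> inv g permutes insert x T" using un permutes_subset by blast
    moreover have "(g \<circ> k \<circ> inv g) a = c" using ac k gG by simp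
    ultimately show ?thesis using comp inv gG k(1) by blast
  qed
  have "transitive_on (insert x T)"
    unfolding transitive_on_def
  proof (intro ballI)
    fix a b assume "a \<in> insert x T" "b \<in> insert x T"
    then obtain k l where k: "k \<in> G" "k permutes insert x T" "k a = c"
      and l: "l \<in> G" "l permutes insert x T" "l b = c" using conn by meson
    have "(inv l \<circ> k) a = b" using k l by (metis comp_apply inv_left)
    moreover have "inv l \<circ> k \<in> G" "inv l \<circ> k permutes insert x T"
      using k l comp inv permutes_compose permutes_inv by blast+
    ultimately show "\<exists>g\<in>G. g permutes insert x T \<and> g a = b" by blast
  qed
  then show ?thesis using primitive_on_insert[OF T _ xS] xS by blast
qed

text \<open>Points of \<open>S - T\<close> join \<open>T\<close> one at a time by
  \<open>primitive_on_grow\<close>. By induction some \<open>g\<close> is right on the remaining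
  points; it is corrected at \<open>x\<close> by an element that moves only points of
  \<open>insert x T\<close>, so the other values stay.\<close>

lemma primitive_on_multiply_transitive:
  assumes transS: "transitive_on S" and T: "primitive_on T" and big: "card S < 2 * card T"
    and f: "inj_on f (S - T)" "f ` (S - T) \<subseteq> S"
  shows "\<exists>g\<in>G. \<forall>y\<in>S - T. g y = f y"
  using T big f
proof (induction "card (S - T)" arbitrary: T)
  case 0
  then show ?case using one fin by auto
next
  case (Suc m)
  have TS: "T \<subseteq> S" using Suc by (auto simp: primitive_on_def)
  have "T \<noteq> S" using Suc(2) by auto
  then obtain x where x: "x \<in> S - T" "primitive_on (insert x T)"
    using primitive_on_grow[OF transS Suc(3) Suc(4)] by blast
  have finT: "finite T" using TS fin finite_subset by blast
  have eq: "S - T = insert x (S - insert x T)" using x by blast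
  have card: "m = card (S - insert x T)" using Suc(2) fin eq
    by (metis Diff_iff card_insert_disjoint diff_Suc_1 finite_Diff insertI1)
  have "\<exists>g\<in>G. \<forall>y\<in>S - insert x T. g y = f y"
  proof (rule Suc(1)[OF card x(2)])
    show "card S < 2 * card (insert x T)" using Suc(4) x finT by simp
    show "inj_on f (S - insert x T)" "f ` (S - insert x T) \<subseteq> S"
      using Suc(5,6) by (auto intro: inj_on_subset)
  qed
  then obtain g where g: "g \<in> G" "\<And>y. y \<in> S - insert x T \<Longrightarrow> g y = f y" by blast
  have fx: "f x \<in> S" using Suc(6) x by blast
  \<comment> \<open>Otherwise \<open>g\<close> would take the value \<open>f x\<close> at a point
    where it agrees with \<open>f\<close>, against injectivity.\<close>
  have "inv g (f x) \<in> insert x T"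
  proof (rule ccontr)
    assume "inv g (f x) \<notin> insert x T"
    moreover have "inv g (f x) \<in> S" using fx perm[OF inv[OF g(1)]] by (simp add: permutes_in_image)
    ultimately have y: "inv g (f x) \<in> S - insert x T" by blast
    then have "f (inv g (f x)) = f x" using g by (metis inv_right)
    then show False using Suc(5) x y by (auto dest: inj_onD)
  qed
  then obtain h where h: "h \<in> G" "h permutes insert x T" "h x = inv g (f x)"
    using x(2) unfolding primitive_on_def transitive_on_def by blast
  have "(g \<circ> h) y = f y" if "y \<in> S - T" for y
  proof (cases "y = x")
    case True then show ?thesis using h g by simp
  next
    case False
    then show ?thesis using that g h(2) by (simp add: permutes_not_in)
  qed
  then show ?case using comp[OF g(1) h(1)] by blast
qed

end

section \<open>From an element of prime order to three-cycles\<close>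

context perm_group begin

text \<open>Each further transposition puts one more point in place and fixes the images already
  reached.\<close>

lemma ex_permutes_extending_three:
  assumes "distinct [a, b, c]" "distinct [a', b', c']" "{a, b, c, a', b', c'} \<subseteq> A"
  shows "\<exists>\<sigma>. \<sigma> permutes A \<and> \<sigma> a = a' \<and> \<sigma> b = b' \<and> \<sigma> c = c'"
proof -
  let ?t = Transposition.transpose
  define s1 where "s1 = ?t a a'"
  define s2 where "s2 = ?t (s1 b) b' \<circ> s1"
  define s3 where "s3 = ?t (s2 c) c' \<circ> s2"
  have p1: "s1 permutes A" using assms by (auto simp: s1_def intro: permutes_swap_id)
  have p2: "s2 permutes A" unfolding s2_def
    using assms p1 permutes_in_image[OF p1, of b] by (intro permutes_compose permutes_swap_id) auto
  have p3: "s3 permutes A" unfolding s3_def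
    using assms p2 permutes_in_image[OF p2, of c] by (intro permutes_compose permutes_swap_id) auto
  have a1: "s1 a = a'" by (simp add: s1_def)
  have "s1 b \<noteq> a'" using a1 assms(1) permutes_inj[OF p1] by (metis distinct_length_2_or_more injD)
  then have a2: "s2 a = a'" "s2 b = b'" using a1 assms(2) by (auto simp: s2_def Transposition.transpose_def)
  have "s2 c \<noteq> a'" "s2 c \<noteq> b'" using a2 assms(1) permutes_inj[OF p2]
    by (metis distinct_length_2_or_more injD)+
  then have "s3 a = a'" "s3 b = b'" "s3 c = c'" using a2 assms(2) by (auto simp: s3_def Transposition.transpose_def)
  then show ?thesis using p3 by blast
qed

text \<open>
  Two transpositions of the fixed points of a \<open>p\<close>-cycle \<open>z\<close> are induced by elements normalising
  the group generated by \<open>z\<close>; their commutator centralises \<open>z\<close>, so it is a power of \<open>z\<close> on the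
  support of \<open>z\<close>, and removing that power leaves a 3-cycle.
\<close>

lemma commuting_imp_power_on_orbit:
  fixes u g :: "'a \<Rightarrow> 'a"
  assumes "g \<circ> u = u \<circ> g" and tr: "\<And>a b. a \<in> T \<Longrightarrow> b \<in> T \<Longrightarrow> \<exists>i. (u ^^ i) a = b" and "g ` T \<subseteq> T"
  shows "\<exists>j. \<forall>b\<in>T. g b = (u ^^ j) b"
proof (cases "T = {}")
  case False
  then obtain a where a: "a \<in> T" by blast
  then obtain j where j: "(u ^^ j) a = g a" using assms(2)[OF a, of "g a"] assms(3) by blast
  have comm: "g ((u ^^ i) x) = (u ^^ i) (g x)" for i x
    using assms(1) by (induction i) (auto simp: fun_eq_iff)
  have "g b = (u ^^ j) b" if b: "b \<in> T" for b
  proof -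
    obtain i where i: "(u ^^ i) a = b" using tr[OF a b] by blast
    have "g b = (u ^^ i) ((u ^^ j) a)" using comm i j by metis
    also have "\<dots> = (u ^^ (i + j)) a" by (simp add: funpow_add)
    also have "\<dots> = (u ^^ j) ((u ^^ i) a)" by (subst add.commute) (simp add: funpow_add)
    finally show ?thesis using i by simp
  qed
  then show ?thesis by blast
qed auto

lemma conj_funpow:
  assumes "g \<in> G"
  shows "(g \<circ> u \<circ> inv g) ^^ i = g \<circ> u ^^ i \<circ> inv g"
  using assms by (induction i) (auto simp: fun_eq_iff)

text \<open>Sylow conjugacy for \<open>p\<close>-cycles, by counting. \<open>H\<close> acts by
  conjugation on the set \<open>Z\<close> of cyclic groups generated by the conjugates of
  \<open>z'\<close>. If no conjugate is a power of \<open>z\<close>, then \<open>z\<close> fixes no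
  member of \<open>Z\<close>, so \<open>p\<close> divides \<open>card Z\<close>; but
  \<open>z'\<close> fixes exactly one member, its own group, so \<open>p\<close> divides
  \<open>card Z - 1\<close>. Both counts rest on \<open>fixed\<close>: an element \<open>w\<close>
  with \<open>w ^^ p = id\<close> that normalises such a group lies in it.\<close>

lemma prime_cycle_conjugate:
  fixes z z' :: "'a \<Rightarrow> 'a"
  assumes p: "prime p" and H: "H \<subseteq> G" "id \<in> H" "\<And>g h. g \<in> H \<Longrightarrow> h \<in> H \<Longrightarrow> g \<circ> h \<in> H" "\<And>g. g \<in> H \<Longrightarrow> inv g \<in> H"
    and HT: "\<And>g. g \<in> H \<Longrightarrow> g permutes T"
    and z: "z \<in> H" "z ^^ p = id" "z \<noteq> id"
    and z': "z' \<in> H" "z' ^^ p = id" "z' \<noteq> id" "\<And>a b. a \<in> T \<Longrightarrow> b \<in> T \<Longrightarrow> \<exists>i. (z' ^^ i) a = b"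
  shows "\<exists>h\<in>H. \<exists>e. h \<circ> z' \<circ> inv h = z ^^ e"
proof (rule ccontr)
  assume neg: "\<not> ?thesis"
  define gen where "gen y = range (\<lambda>i. y ^^ i)" for y :: "'a \<Rightarrow> 'a"
  define cj where "cj g Q = (\<lambda>y. g \<circ> y \<circ> inv g) ` Q" for g :: "'a \<Rightarrow> 'a" and Q
  define Z where "Z = (\<lambda>h. gen (h \<circ> z' \<circ> inv h)) ` H"
  have HG: "g \<in> G" if "g \<in> H" for g using H(1) that by blast
  have finZ: "finite Z" unfolding Z_def using finite_subset[OF H(1) finG] by blast
  have cjgen: "cj g (gen y) = gen (g \<circ> y \<circ> inv g)" if "g \<in> G" for g y
    unfolding cj_def gen_def using conj_funpow[OF that] by (auto simp: image_image)
  have invc: "inv (g \<circ> h) = inv h \<circ> inv g" if "g \<in> G" "h \<in> G" for g h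
    using o_inv_distrib[OF bijG[OF that(1)] bijG[OF that(2)]] .
  have cjZ: "cj g ` Z \<subseteq> Z" if "g \<in> H" for g
  proof -
    have "cj g (gen (h \<circ> z' \<circ> inv h)) = gen ((g \<circ> h) \<circ> z' \<circ> inv (g \<circ> h))" if "h \<in> H" for h
      using that \<open>g \<in> H\<close> HG by (simp add: cjgen invc comp_assoc)
    then show ?thesis using H(3)[OF that] by (auto simp: Z_def)
  qed
  have cjpow: "cj g ^^ i = cj (g ^^ i)" if "g \<in> G" for g i
  proof (induction i)
    case 0 then show ?case by (rule ext) (simp add: cj_def id_def comp_def)
  next
    case (Suc i)
    have *: "cj (g ^^ Suc i) Q = cj g (cj (g ^^ i) Q)" for Q
      using that funpow[OF that, of i] by (simp add: cj_def image_image invc comp_assoc)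
    show ?case
    proof
      fix Q
      have "(cj g ^^ Suc i) Q = cj g ((cj g ^^ i) Q)" by simp
      also have "\<dots> = cj (g ^^ Suc i) Q" by (simp only: Suc *)
      finally show "(cj g ^^ Suc i) Q = cj (g ^^ Suc i) Q" .
    qed
  qed
  have cjid: "cj id = id" by (rule ext) (simp add: cj_def id_def comp_def)
  \<comment> \<open>a normalising element of order \<open>p\<close> centralises, since \<open>i ^ p \<equiv> i\<close> modulo \<open>p\<close>\<close>
  have fixed: "w \<in> gen y" if w: "w \<in> H" "w ^^ p = id" and y: "y \<in> H" "y ^^ p = id"
    and tr: "\<And>a b. a \<in> T \<Longrightarrow> b \<in> T \<Longrightarrow> \<exists>i. (y ^^ i) a = b" and cjw: "cj w (gen y) = gen y" for w y
  proof -
    have "w \<circ> y \<circ> inv w \<in> gen y"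
    proof -
      have "y \<in> gen y" unfolding gen_def by (rule range_eqI[of _ _ 1]) simp
      then show ?thesis using cjw by (auto simp: cj_def)
    qed
    then obtain i where i: "w \<circ> y \<circ> inv w = y ^^ i" by (auto simp: gen_def)
    have pw: "w ^^ m \<circ> y \<circ> inv (w ^^ m) = y ^^ (i ^ m)" for m
    proof (induction m)
      case 0 then show ?case by auto
    next
      case (Suc m)
      have "w ^^ Suc m \<circ> y \<circ> inv (w ^^ Suc m) = w \<circ> (w ^^ m \<circ> y \<circ> inv (w ^^ m)) \<circ> inv w"
        using HG[OF w(1)] funpow[OF HG[OF w(1)], of m] by (simp add: invc comp_assoc)
      also have "\<dots> = (w \<circ> y \<circ> inv w) ^^ (i ^ m)" by (simp only: Suc conj_funpow[OF HG[OF w(1)]])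
      also have "\<dots> = y ^^ (i ^ Suc m)" using i by (simp add: funpow_mult mult.commute)
      finally show ?case .
    qed
    have "y = y ^^ (i ^ p)" using pw[of p] w by simp
    also have "\<dots> = y ^^ i"
    proof -
      have "[i ^ p = i] (mod p)"
      proof (cases "p dvd i")
        case True
        then show ?thesis using prime_gt_0_nat[OF p]
          by (metis cong_0_iff cong_sym cong_trans dvd_power dvd_trans)
      next
        case False
        then have "[i ^ (p - 1) * i = 1 * i] (mod p)"
          using fermat_theorem[OF p] cong_scalar_right by blast
        then show ?thesis using prime_gt_0_nat[OF p] by (metis mult_1 power_minus_mult)
      qed
      then show ?thesis using funpow_order_mod[OF y(2)]
        unfolding unique_euclidean_semiring_class.cong_def by metis
    qed
    finally have "y = w \<circ> y \<circ> inv w" using i by simp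
    then have "y \<circ> w = w \<circ> y" using HG[OF w(1)] by (metis bijG bij_is_inj comp_assoc comp_id inv_o_cancel)
    moreover have "w ` T \<subseteq> T" using HT[OF w(1)] by (auto simp: permutes_in_image)
    ultimately obtain j where j: "\<forall>b\<in>T. w b = (y ^^ j) b"
      using commuting_imp_power_on_orbit[of w y T] tr by metis
    have "w b = (y ^^ j) b" for b
    proof (cases "b \<in> T")
      case False
      then have "y b = b" "w b = b"
        using permutes_not_in[OF HT[OF y(1)]] permutes_not_in[OF HT[OF w(1)]] by auto
      moreover from this have "(y ^^ j) b = b" by (induction j) auto
      ultimately show ?thesis by simp
    qed (use j in auto)
    then have "w = y ^^ j" by auto
    then show ?thesis by (auto simp: gen_def)
  qed
  \<comment> \<open>A group of prime order is generated by each of its elements other than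
    \<open>id\<close>.\<close>
  have genp: "\<exists>e. y = w ^^ e" if w: "w \<in> gen y" "w \<noteq> id" "y ^^ p = id" for w y
  proof -
    obtain j where j: "w = y ^^ j" using w(1) unfolding gen_def by blast
    have "\<not> p dvd j"
    proof
      assume "p dvd j"
      then have "w = y ^^ 0" using j funpow_order_mod[OF w(3), of j] by (simp add: dvd_eq_mod_eq_0)
      then show False using w(2) by simp
    qed
    then obtain k where k: "(j * k) mod p = 1" using prime_mod_inverse_exists p by blast
    have "w ^^ k = y ^^ (j * k)" using j by (simp add: funpow_mult mult.commute)
    also have "\<dots> = y ^^ 1" using k funpow_order_mod[OF w(3), of "j * k"] by metis
    finally show ?thesis by (intro exI[of _ k]) simp
  qed
  have mem: "h \<circ> z' \<circ> inv h \<in> H \<and> (h \<circ> z' \<circ> inv h) ^^ p = id \<and> h \<circ> z' \<circ> inv h \<noteq> id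
      \<and> (\<forall>a\<in>T. \<forall>b\<in>T. \<exists>i. ((h \<circ> z' \<circ> inv h) ^^ i) a = b)" if "h \<in> H" for h
  proof (intro conjI ballI)
    show "h \<circ> z' \<circ> inv h \<in> H" by (intro H(3) H(4) that z'(1))
    show "(h \<circ> z' \<circ> inv h) ^^ p = id" using HG[OF that] z' by (auto simp: conj_funpow fun_eq_iff)
    show "h \<circ> z' \<circ> inv h \<noteq> id"
    proof
      assume "h \<circ> z' \<circ> inv h = id"
      then have "h (z' (inv h (h x))) = h x" for x by (drule_tac x = "h x" in fun_cong) (simp only: comp_apply id_apply)
      then have "z' x = x" for x using HG[OF that] by (metis inv_left)
      then show False using z'(3) by auto
    qed
    fix a b assume ab: "a \<in> T" "b \<in> T"
    have "inv h permutes T" using HT[OF H(4)[OF that]] .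
    then obtain i where "(z' ^^ i) (inv h a) = inv h b"
      using z'(4) ab by (metis permutes_in_image)
    then show "\<exists>i. ((h \<circ> z' \<circ> inv h) ^^ i) a = b"
      using HG[OF that] by (intro exI[of _ i]) (simp add: conj_funpow)
  qed
  have nofix: "{Q\<in>Z. cj z Q \<noteq> Q} = Z"
  proof -
    have False if "h \<in> H" "cj z (gen (h \<circ> z' \<circ> inv h)) = gen (h \<circ> z' \<circ> inv h)" for h
    proof -
      have "z \<in> gen (h \<circ> z' \<circ> inv h)" using fixed[OF z(1,2)] mem[OF that(1)] that(2) by blast
      then have "\<exists>e. h \<circ> z' \<circ> inv h = z ^^ e" using genp z(3) mem[OF that(1)] by blast
      then show False using neg that by blast
    qed
    then show ?thesis by (auto simp: Z_def)
  qed
  have "p dvd card Z"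
    using prime_dvd_card_moved[OF p, of "cj z" Z] cjpow[OF HG[OF z(1)]] z(2) cjid finZ cjZ[OF z(1)] nofix by simp
  moreover have "p dvd card {Q\<in>Z. cj z' Q \<noteq> Q}"
    using prime_dvd_card_moved[OF p, of "cj z'" Z] cjpow[OF HG[OF z'(1)]] z'(2) cjid finZ cjZ[OF z'(1)] by simp
  moreover have "{Q\<in>Z. cj z' Q \<noteq> Q} = Z - {gen z'}"
  proof -
    have *: "gen (h \<circ> z' \<circ> inv h) = gen z'" if h: "h \<in> H" "cj z' (gen (h \<circ> z' \<circ> inv h)) = gen (h \<circ> z' \<circ> inv h)" for h
    proof -
      let ?y = "h \<circ> z' \<circ> inv h"
      have y: "z' \<in> gen ?y" using fixed[OF z'(1,2)] mem[OF h(1)] h(2) by blast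
      then obtain e where e: "?y = z' ^^ e" using genp z'(3) mem[OF h(1)] by blast
      have sub: "gen a \<subseteq> gen b" if ab: "a \<in> gen b" for a b
        using ab by (auto simp: gen_def funpow_mult)
      show ?thesis using sub[OF y] sub[of ?y z'] e by (auto simp: gen_def)
    qed
    have "z' \<circ> z' \<circ> inv z' = z'" using HG[OF z'(1)] by (auto simp: fun_eq_iff)
    then have own: "cj z' (gen z') = gen z'" using cjgen[OF HG[OF z'(1)], of z'] by (simp only:)
    show ?thesis
    proof (intro equalityI subsetI)
      fix Q assume Q: "Q \<in> Z - {gen z'}"
      then obtain h where h: "h \<in> H" "Q = gen (h \<circ> z' \<circ> inv h)" unfolding Z_def by blast
      then show "Q \<in> {Q\<in>Z. cj z' Q \<noteq> Q}" using *[OF h(1)] Q by blast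
    next
      fix Q assume "Q \<in> {Q\<in>Z. cj z' Q \<noteq> Q}"
      then show "Q \<in> Z - {gen z'}" using own by blast
    qed
  qed
  moreover have "gen z' \<in> Z"
    unfolding Z_def by (rule image_eqI[OF _ H(2)]) simp
  then have "card Z = Suc (card (Z - {gen z'}))" using finZ by (metis card_Suc_Diff1)
  ultimately have "p dvd 1" by (metis One_nat_def dvd_add_right_iff plus_1_eq_Suc Suc_eq_plus1)
  then show False using prime_gt_1_nat[OF p] by simp
qed

lemma funpow_permutes:
  assumes "f permutes T"
  shows "f ^^ i permutes T"
proof (induction i)
  case (Suc i)
  show ?case using permutes_compose[OF Suc assms] by (simp only: funpow.simps)
qed (simp only: funpow.simps permutes_id)

lemma funpow_image_eq:
  assumes "f ` E = E"
  shows "(f ^^ k) ` E = E"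
  by (induction k) (simp_all only: funpow.simps image_comp[symmetric] image_id id_apply image_ident assms)

text \<open>Sylow's theorem with exponent 1 gives a subgroup of order exactly \<open>p\<close>, in
  which the order of every element divides \<open>p\<close>.\<close>

lemma cauchy_element:
  assumes "prime p" "p dvd card G"
  shows "\<exists>z\<in>G. z \<noteq> id \<and> z ^^ p = id"
proof -
  define M :: "('a \<Rightarrow> 'a) monoid" where "M = \<lparr>carrier = G, monoid.mult = (\<circ>), one = id\<rparr>"
  have grp: "group M"
  proof (rule groupI)
    fix x assume "x \<in> carrier M"
    then show "\<exists>y\<in>carrier M. y \<otimes>\<^bsub>M\<^esub> x = \<one>\<^bsub>M\<^esub>"
      using inv inv_o_cancel[OF injG] by (auto simp: M_def intro!: bexI[of _ "inv x"])
  qed (auto simp: M_def comp one)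
  then interpret M: group M .
  obtain m where "Coset.order M = p ^ 1 * m" using assms(2) by (auto simp: M_def Coset.order_def elim: dvdE)
  then obtain H where H: "subgroup H M" "card H = p ^ 1"
    using sylow_thm[OF assms(1) grp, where a = 1 and m = m] finG by (auto simp: M_def)
  then have cH: "card H = p" by simp
  interpret H: subgroup H M by fact
  interpret H': group "M\<lparr>carrier := H\<rparr>" by (rule H.subgroup_is_group[OF grp])
  have "\<not> H \<subseteq> {id}"
    using card_mono[of "{id}" H] cH prime_gt_1_nat[OF assms(1)] by auto
  then obtain z where z: "z \<in> H" "z \<noteq> id" by blast
  have zp: "z [^]\<^bsub>M\<lparr>carrier := H\<rparr>\<^esub> i = z ^^ i" for i :: nat
    by (induction i) (simp_all add: M_def nat_pow_def funpow_swap1 fun_eq_iff)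
  have "z [^]\<^bsub>M\<lparr>carrier := H\<rparr>\<^esub> Coset.order (M\<lparr>carrier := H\<rparr>) = \<one>\<^bsub>M\<lparr>carrier := H\<rparr>\<^esub>"
    by (rule H'.pow_order_eq_1) (use z in simp)
  then have "z ^^ p = id" using cH unfolding zp by (simp add: Coset.order_def M_def)
  moreover have "z \<in> G" using z H.subset by (auto simp: M_def)
  ultimately show ?thesis using z(2) by blast
qed

text \<open>The number of moved points is a positive multiple of \<open>p\<close> below
  \<open>2 * p\<close>, so \<open>z\<close> is a single \<open>p\<close>-cycle. A block with two
  points is invariant under some \<open>z ^^ j\<close> with \<open>p\<close> not dividing
  \<open>j\<close>, hence under \<open>z\<close>, and so fills \<open>T\<close>.\<close>

lemma prime_cycle_support:
  assumes p: "prime p" and big: "card S < 2 * p"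
    and z: "z \<in> G" "z \<noteq> id" "z ^^ p = id"
  defines "T \<equiv> {x\<in>S. z x \<noteq> x}"
  shows "card T = p" and "z permutes T"
    and "\<And>a b. a \<in> T \<Longrightarrow> b \<in> T \<Longrightarrow> \<exists>i. (z ^^ i) a = b" and "primitive_on T"
proof -
  have finT: "finite T" using fin by (simp add: T_def)
  obtain x where x: "z x \<noteq> x" using z(2) by (auto simp: fun_eq_iff)
  then have xT: "x \<in> T" using permutes_not_in[OF perm[OF z(1)]] by (auto simp: T_def)
  have zS: "z ` S \<subseteq> S" using permutes_image[OF perm[OF z(1)]] by simp
  have "p dvd card T" unfolding T_def by (rule prime_dvd_card_moved[OF p z(3) fin zS])
  then obtain m where m: "card T = p * m" by blast
  moreover have "card T \<noteq> 0" using xT finT by auto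
  moreover have "card T \<le> card S" using card_mono[OF fin] by (auto simp: T_def)
  ultimately have "m \<noteq> 0" and "p * m < p * 2" using big by (metis mult_0_right, linarith)
  then have "m = 1" by simp
  then show cT: "card T = p" using m by simp
  show zT: "z permutes T"
    by (rule permutes_superset[OF perm[OF z(1)]]) (auto simp: T_def)
  have ziT: "z ^^ i permutes T" for i
    by (rule funpow_permutes[OF zT])
  have tr: "\<exists>i. (z ^^ i) a = b" if ab: "a \<in> T" "b \<in> T" for a b
  proof -
    have za: "z a \<noteq> a" using ab by (simp add: T_def)
    have "range (\<lambda>i. (z ^^ i) a) \<subseteq> T" using ziT ab by (auto simp: permutes_in_image)
    then have "range (\<lambda>i. (z ^^ i) a) = T"
      using card_subset_eq[OF finT] card_prime_orbit(3)[OF p z(3) za] cT by metis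
    then show ?thesis using ab(2) by (metis (no_types, lifting) imageE)
  qed
  then show "\<And>a b. a \<in> T \<Longrightarrow> b \<in> T \<Longrightarrow> \<exists>i. (z ^^ i) a = b" by blast
  show "primitive_on T"
    unfolding primitive_on_def transitive_on_def
  proof (intro conjI ballI allI impI)
    show "T \<subseteq> S" by (auto simp: T_def)
    show "\<exists>g\<in>G. g permutes T \<and> g a = b" if "a \<in> T" "b \<in> T" for a b
      using tr[OF that] ziT funpow[OF z(1)] by metis
    fix E assume E: "E \<subset> T \<and> 2 \<le> card E"
    show "\<exists>h\<in>G. h permutes T \<and> h ` E \<noteq> E \<and> h ` E \<inter> E \<noteq> {}"
    proof (rule ccontr)
      assume "\<not> ?thesis"
      then have block: "(z ^^ i) ` E = E" if "(z ^^ i) ` E \<inter> E \<noteq> {}" for i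
        using that ziT funpow[OF z(1)] by metis
      have finE: "finite E" using E finT finite_subset by blast
      have "E \<noteq> {}" using E by auto
      then obtain a where a: "a \<in> E" by blast
      have "\<not> E \<subseteq> {a}" using E card_mono[of "{a}" E] by auto
      then obtain b where b: "b \<in> E" "b \<noteq> a" by blast
      obtain j where j: "(z ^^ j) a = b" using tr[of a b] a b E by blast
      have "(z ^^ j) ` E = E" by (rule block) (use a b j in auto)
      then have zjk: "((z ^^ j) ^^ k) ` E = E" for k by (rule funpow_image_eq)
      have "\<not> p dvd j"
      proof
        assume "p dvd j"
        then have "z ^^ j = id" using funpow_order_mod[OF z(3), of j] by (simp add: dvd_eq_mod_eq_0)
        then show False using b j by simp
      qed
      then obtain k where "(j * k) mod p = 1" using prime_mod_inverse_exists[OF p] by blast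
      then have "(z ^^ j) ^^ k = z"
        using funpow_order_mod[OF z(3), of "j * k"] by (simp add: funpow_mult mult.commute)
      then have zE: "z ` E = E" using zjk[of k] by simp
      then have "(z ^^ i) ` E = E" for i by (rule funpow_image_eq)
      then have "T \<subseteq> E" using tr[of a] a E by (metis (no_types, lifting) imageI psubsetD subsetI)
      then show False using E by blast
    qed
  qed
qed

text \<open>The bound \<open>card S < 2 * p\<close> serves twice: it makes \<open>z\<close> a single
  cycle, and it lets \<open>primitive_on_multiply_transitive\<close> realise every permutation of
  the fixed points. \<open>p + 3 \<le> card S\<close> supplies three fixed points for a
  three-cycle.\<close>

theorem jordan_prime_cycle:
  assumes trans: "transitive_on S" and p: "prime p" "p dvd card G" "card S < 2 * p" "p + 3 \<le> card S"
  shows "alternating_perms S \<subseteq> G"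
proof -
  obtain z where z: "z \<in> G" "z \<noteq> id" "z ^^ p = id" using cauchy_element[OF p(1,2)] by blast
  define T where "T = {x\<in>S. z x \<noteq> x}"
  note sup = prime_cycle_support[OF p(1,3) z, folded T_def]
  have TS: "T \<subseteq> S" by (auto simp: T_def)
  have finT: "finite T" using finite_subset[OF TS fin] .
  have big: "card S < 2 * card T" using p(3) sup(1) by simp
  have mt: "\<exists>g\<in>G. \<forall>y\<in>S - T. g y = f y" if "f permutes S" for f
    by (rule primitive_on_multiply_transitive[OF trans sup(4) big])
      (use permutes_inj_on[OF that] permutes_in_image[OF that] in auto)
  define H where "H = {g\<in>G. g permutes T}"
  have stab: "g ` T = T" if "g \<in> G" "g ` (S - T) = S - T" for g
  proof -
    have "g ` T = g ` (S - (S - T))" using TS by (simp add: double_diff)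
    also have "\<dots> = S - (S - T)"
      using image_set_diff[OF injG[OF that(1)]] permutes_image[OF perm[OF that(1)]] that(2) by simp
    finally show ?thesis using TS by (simp add: double_diff)
  qed
  have conjT: "g \<circ> z \<circ> inv g permutes T" if g: "g \<in> G" "g ` T = T" for g
  proof (rule permutes_superset[OF perm])
    show "g \<circ> z \<circ> inv g \<in> G" using g z comp inv by simp
    show "(g \<circ> z \<circ> inv g) x = x" if "x \<in> S - T" for x
    proof -
      have "inv g x \<notin> T" using imageI[of "inv g x" T g] g that by auto
      then show ?thesis using sup(2) g by (simp add: permutes_not_in)
    qed
  qed
  \<comment> \<open>A Frattini argument: an element inducing \<open>\<tau>\<close> turns
    \<open>z\<close> into another \<open>p\<close>-cycle on \<open>T\<close>; this is conjugated
    back to a power of \<open>z\<close> by an element of \<open>H\<close>, which leaves the action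
    on \<open>S - T\<close> unchanged.\<close>
  have normal: "\<exists>g\<in>G. (\<forall>y\<in>S - T. g y = \<tau> y) \<and> (\<exists>e. g \<circ> z \<circ> inv g = z ^^ e)"
    if \<tau>: "\<tau> permutes S - T" for \<tau>
  proof -
    obtain g where g: "g \<in> G" "\<forall>y\<in>S - T. g y = \<tau> y"
      using mt[of \<tau>] permutes_subset[OF \<tau>] by auto
    have "g ` (S - T) = \<tau> ` (S - T)" by (rule image_cong) (use g(2) in auto)
    also have "\<dots> = S - T" by (rule permutes_image[OF \<tau>])
    finally have "g ` (S - T) = S - T" .
    then have gT: "g ` T = T" by (rule stab[OF g(1)])
    define z' where "z' = g \<circ> z \<circ> inv g"
    have z'H: "z' \<in> H" using conjT[OF g(1) gT] g z comp inv by (simp add: H_def z'_def)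
    have z'p: "z' ^^ p = id" using conj_funpow[OF g(1), of p z] z g(1)
      by (auto simp: z'_def fun_eq_iff)
    have z'1: "z' \<noteq> id"
    proof
      assume "z' = id"
      then have "g (z (inv g (g x))) = g x" for x unfolding z'_def by (drule_tac x = "g x" in fun_cong) (simp only: comp_apply id_apply)
      then have "z x = x" for x using injG[OF g(1)] g(1) by (metis inv_left)
      then show False using z(2) by auto
    qed
    have z'tr: "\<exists>i. (z' ^^ i) a = b" if ab: "a \<in> T" "b \<in> T" for a b
    proof -
      have "inv g a \<in> T" "inv g b \<in> T" using ab gT g(1) by (metis imageE inv_left)+
      then obtain i where "(z ^^ i) (inv g a) = inv g b" using sup(3) by blast
      then show ?thesis using g(1) by (intro exI[of _ i]) (simp add: z'_def conj_funpow)
    qed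
    have "\<exists>h\<in>H. \<exists>e. h \<circ> z' \<circ> inv h = z ^^ e"
    proof (rule prime_cycle_conjugate[OF p(1), of H T])
      show "z \<in> H" using z sup(2) by (simp add: H_def)
    qed (use z z'H z'p z'1 z'tr one comp inv in \<open>auto simp: H_def intro: permutes_compose permutes_inv permutes_id\<close>)
    then obtain h e where h: "h \<in> G" "h permutes T" "h \<circ> z' \<circ> inv h = z ^^ e" by (auto simp: H_def)
    have "(h \<circ> g) \<circ> z \<circ> inv (h \<circ> g) = z ^^ e"
      using h(3) o_inv_distrib[OF bijG[OF h(1)] bijG[OF g(1)]] by (simp add: z'_def comp_assoc)
    moreover have "(h \<circ> g) y = \<tau> y" if "y \<in> S - T" for y
    proof -
      have "\<tau> y \<in> S - T" using that \<tau> by (simp only: permutes_in_image)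
      then show ?thesis using that g h(2) by (simp add: permutes_not_in)
    qed
    ultimately show ?thesis using comp[OF h(1) g(1)] by blast
  qed
  have "3 \<le> card (S - T)" using p(4) sup(1) TS finT by (simp add: card_Diff_subset)
  then obtain A where A: "A \<subseteq> S - T" "card A = 3" using obtain_subset_with_card_n by metis
  then obtain a b c where abc: "A = {a, b, c}" "a \<noteq> b" "b \<noteq> c" "a \<noteq> c" by (auto simp: card_3_iff)
  let ?t = Transposition.transpose
  have abcS: "a \<in> S - T" "b \<in> S - T" "c \<in> S - T" using A abc by auto
  obtain g1 e1 where g1: "g1 \<in> G" "\<forall>y\<in>S - T. g1 y = ?t a b y" "g1 \<circ> z \<circ> inv g1 = z ^^ e1"
    using normal[of "?t a b"] abcS permutes_swap_id by metis
  obtain g2 e2 where g2: "g2 \<in> G" "\<forall>y\<in>S - T. g2 y = ?t b c y" "g2 \<circ> z \<circ> inv g2 = z ^^ e2"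
    using normal[of "?t b c"] abcS permutes_swap_id by metis
  \<comment> \<open>The exponents multiply, so \<open>k\<close> and \<open>w\<close> conjugate
    \<open>z\<close> to the same power \<open>u\<close>. Hence \<open>k \<circ> inv w\<close>, the
    commutator of \<open>g1\<close> and \<open>g2\<close>, commutes with \<open>u\<close>.\<close>
  define k where "k = g1 \<circ> g2"
  define w where "w = g2 \<circ> g1"
  define u where "u = w \<circ> z \<circ> inv w"
  have kw: "k \<in> G" "w \<in> G" using g1 g2 comp by (auto simp: k_def w_def)
  have pw: "(x \<circ> y) \<circ> z \<circ> inv (x \<circ> y) = z ^^ (i * j)"
    if "x \<in> G" "y \<in> G" "x \<circ> z \<circ> inv x = z ^^ i" "y \<circ> z \<circ> inv y = z ^^ j" for x y i j
  proof -
    have "(x \<circ> y) \<circ> z \<circ> inv (x \<circ> y) = x \<circ> (y \<circ> z \<circ> inv y) \<circ> inv x"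
      using o_inv_distrib[OF bijG[OF that(1)] bijG[OF that(2)]] by (simp add: comp_assoc)
    also have "\<dots> = (x \<circ> z \<circ> inv x) ^^ j" using that conj_funpow[OF that(1), of j z] by simp
    finally show ?thesis using that(3) by (simp add: funpow_mult mult.commute)
  qed
  have "w \<circ> z \<circ> inv w = z ^^ (e2 * e1)" unfolding w_def by (rule pw[OF g2(1) g1(1) g2(3) g1(3)])
  moreover have "k \<circ> z \<circ> inv k = z ^^ (e1 * e2)" unfolding k_def by (rule pw[OF g1(1) g2(1) g1(3) g2(3)])
  ultimately have ku: "k \<circ> z \<circ> inv k = u" by (simp add: u_def mult.commute)
  define g where "g = k \<circ> inv w"
  have gG: "g \<in> G" using kw comp inv by (simp add: g_def)
  have "g (u x) = k (z (inv w x))" for x using kw by (simp add: g_def u_def)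
  moreover have "u (g x) = k (z (inv w x))" for x using kw ku[symmetric] by (simp add: g_def)
  ultimately have gu: "g \<circ> u = u \<circ> g" by (simp add: fun_eq_iff)
  have stT: "?t a b y \<in> S - T" "?t b c y \<in> S - T" if "y \<in> S - T" for y
    using that abcS by (auto simp: Transposition.transpose_def)
  have w\<Delta>: "w y = ?t b c (?t a b y)" and k\<Delta>: "k y = ?t a b (?t b c y)" if "y \<in> S - T" for y
    using that g1(2) g2(2) stT by (auto simp: w_def k_def)
  have "w ` (S - T) = S - T"
  proof -
    have "w ` (S - T) = (?t b c \<circ> ?t a b) ` (S - T)" by (rule image_cong) (use w\<Delta> in auto)
    also have "\<dots> = S - T" by (rule permutes_image) (use abcS in \<open>auto intro!: permutes_compose permutes_swap_id\<close>)
    finally show ?thesis .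
  qed
  then have wT: "w ` T = T" by (rule stab[OF kw(2)])
  have uT: "u permutes T" unfolding u_def by (rule conjT[OF kw(2) wT])
  have uG: "u \<in> G" using kw z comp inv by (simp add: u_def)
  \<comment> \<open>The commutator of the transpositions (a b) and (b c) is a three-cycle.\<close>
  have g\<Delta>: "g y = three_cycle a c b y" if "y \<in> S - T" for y
  proof -
    define x where "x = ?t a b (?t b c y)"
    have x: "x \<in> S - T" using stT that by (simp add: x_def)
    have "w x = y" using w\<Delta>[OF x] by (simp add: x_def)
    then have "inv w y = x" using kw(2) inv_left by blast
    then have "g y = ?t a b (?t b c x)" using k\<Delta>[OF x] by (simp add: g_def)
    then show ?thesis unfolding x_def three_cycle_def using abc by (auto simp: Transposition.transpose_def)
  qed
  have "g ` (S - T) = S - T"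
  proof -
    have "g ` (S - T) = three_cycle a c b ` (S - T)" by (rule image_cong) (use g\<Delta> in auto)
    also have "\<dots> = S - T" unfolding three_cycle_def
      by (rule permutes_image) (use abcS in \<open>auto intro!: permutes_compose permutes_swap_id\<close>)
    finally show ?thesis .
  qed
  then have gT: "g ` T = T" by (rule stab[OF gG])
  have utr: "\<exists>i. (u ^^ i) x = y" if "x \<in> T" "y \<in> T" for x y
  proof -
    have "inv w x \<in> T" "inv w y \<in> T" using that wT kw(2) by (metis imageE inv_left)+
    then obtain i where "(z ^^ i) (inv w x) = inv w y" using sup(3) by blast
    then show ?thesis using kw(2) by (intro exI[of _ i]) (simp add: u_def conj_funpow)
  qed
  obtain j where j: "\<forall>x\<in>T. g x = (u ^^ j) x"
    using commuting_imp_power_on_orbit[OF gu utr] gT by blast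
  define v where "v = u ^^ j"
  have vG: "v \<in> G" using funpow[OF uG] by (simp add: v_def)
  have vT: "v permutes T" unfolding v_def by (rule funpow_permutes[OF uT])
  \<comment> \<open>On \<open>T\<close> the commutator agrees with \<open>v\<close>, which fixes all
    points outside \<open>T\<close>; removing \<open>v\<close> leaves the three-cycle alone.\<close>
  have "g \<circ> inv v = three_cycle a c b"
  proof
    fix y
    consider "y \<in> T" | "y \<in> S - T" | "y \<notin> S" by blast
    then show "(g \<circ> inv v) y = three_cycle a c b y"
    proof cases
      case 1
      then have "inv v y \<in> T" using permutes_in_image[OF permutes_inv[OF vT]] by simp
      then have "g (inv v y) = y" using j vG by (simp flip: v_def)
      moreover have "y \<noteq> a" "y \<noteq> b" "y \<noteq> c" using 1 abcS by auto
      ultimately show ?thesis by (simp add: three_cycle_def)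
    next
      case 2
      then have "inv v y = y" using permutes_not_in[OF permutes_inv[OF vT]] by simp
      then show ?thesis using g\<Delta>[OF 2] by simp
    next
      case 3
      then have "inv v y = y" "g y = y"
        using permutes_not_in[OF perm] vG gG inv by auto
      moreover have "y \<noteq> a" "y \<noteq> b" "y \<noteq> c" using 3 abcS by auto
      ultimately show ?thesis by (simp add: three_cycle_def)
    qed
  qed
  then have t0: "three_cycle a c b \<in> G" using comp[OF gG inv[OF vG]] by simp
  show ?thesis
  proof (rule alternating_subset)
    fix a' c' b' assume S': "a' \<in> S" "c' \<in> S" "b' \<in> S" "a' \<noteq> c'" "c' \<noteq> b'" "a' \<noteq> b'"
    \<comment> \<open>An element of \<open>G\<close> agreeing with such a permutation on
      \<open>S - T\<close> conjugates the one three-cycle to any other.\<close>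
    obtain \<sigma> where \<sigma>: "\<sigma> permutes S" "\<sigma> a = a'" "\<sigma> c = c'" "\<sigma> b = b'"
      using ex_permutes_extending_three[of a c b a' c' b' S] abc abcS S' by auto
    then obtain h where h: "h \<in> G" "\<forall>y\<in>S - T. h y = \<sigma> y" using mt by blast
    have "three_cycle a' c' b' = h \<circ> three_cycle a c b \<circ> inv h"
      using three_cycle_conj[OF bijG[OF h(1)]] h(2) \<sigma> abcS by simp
    then show "three_cycle a' c' b' \<in> G" using comp inv h(1) t0 by simp
  qed
qed

end

subsection \<open>Prime factors of binomial coefficients\<close>

lemma multiplicity_fact_legendre:
  assumes p: "prime (p :: nat)" and "n < p ^ Suc N"
  shows "multiplicity p (fact n :: nat) = (\<Sum>i=1..N. n div p ^ i)"
  using assms(2)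
proof (induction n)
  case 0 then show ?case by simp
next
  case (Suc n)
  have pe: "prime_elem p" using p by simp
  have step: "Suc n div p ^ i = n div p ^ i + (if p ^ i dvd Suc n then 1 else 0)" for i
    by (simp add: div_Suc dvd_eq_mod_eq_0)
  have le: "p ^ i dvd Suc n \<longleftrightarrow> i \<le> multiplicity p (Suc n)" for i
    using power_dvd_iff_le_multiplicity[of "Suc n" p i] prime_gt_1_nat[OF p] by simp
  have "multiplicity p (Suc n) \<le> N"
  proof (rule ccontr)
    assume "\<not> ?thesis"
    then have "p ^ Suc N dvd Suc n" unfolding le by simp
    then show False using Suc.prems by (auto dest!: dvd_imp_le)
  qed
  then have eq: "{i\<in>{1..N}. p ^ i dvd Suc n} = {1..multiplicity p (Suc n)}" unfolding le by auto
  have "multiplicity p (fact (Suc n) :: nat) = multiplicity p (Suc n) + multiplicity p (fact n :: nat)"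
    by (simp only: fact_Suc of_nat_id) (rule prime_elem_multiplicity_mult_distrib[OF pe]; simp)
  also have "multiplicity p (fact n :: nat) = (\<Sum>i=1..N. n div p ^ i)" using Suc by simp
  also have "multiplicity p (Suc n) = (\<Sum>i=1..N. if p ^ i dvd Suc n then 1 else 0)"
    using eq by (simp add: sum.If_cases Int_def)
  finally show ?case unfolding step by (simp add: sum.distrib)
qed

lemma multiplicity_binomial:
  assumes p: "prime (p :: nat)" and "n < p ^ Suc N" "k \<le> n"
  shows "multiplicity p (n choose k) = (\<Sum>i=1..N. n div p ^ i - k div p ^ i - (n - k) div p ^ i)"
proof -
  have pe: "prime_elem p" using p by simp
  have lt: "k < p ^ Suc N" "n - k < p ^ Suc N" using assms by auto
  have "fact k * fact (n - k) * (n choose k) = (fact n :: nat)"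
    using binomial_fact_lemma[OF assms(3)] by simp
  then have "multiplicity p (fact n :: nat) = multiplicity p (fact k * fact (n - k) * (n choose k))" by simp
  also have "\<dots> = multiplicity p (fact k :: nat) + multiplicity p (fact (n - k) :: nat) + multiplicity p (n choose k)"
    using assms(3) by (simp add: prime_elem_multiplicity_mult_distrib[OF pe])
  finally have eq: "(\<Sum>i=1..N. n div p ^ i) = (\<Sum>i=1..N. k div p ^ i) + (\<Sum>i=1..N. (n - k) div p ^ i) + multiplicity p (n choose k)"
    by (simp only: multiplicity_fact_legendre[OF p assms(2)] multiplicity_fact_legendre[OF p lt(1)] multiplicity_fact_legendre[OF p lt(2)])
  have le: "k div q + (n - k) div q \<le> n div q" for q
    using assms(3) div_add1_eq[of k "n - k" q] by simp
  have "(\<Sum>i=1..N. n div p ^ i - k div p ^ i - (n - k) div p ^ i) =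
     (\<Sum>i=1..N. n div p ^ i) - (\<Sum>i=1..N. k div p ^ i + (n - k) div p ^ i)"
    by (subst sum_subtractf_nat[symmetric]) (use le in auto)
  then show ?thesis using eq by (simp add: sum.distrib)
qed

text \<open>This is the carry in Kummer's theorem: adding \<open>k\<close> and \<open>n - k\<close>
  overflows modulo \<open>q\<close> exactly when the remainder of the sum drops below that of
  \<open>k\<close>.\<close>

lemma div_carry:
  fixes n k q :: nat
  assumes "k \<le> n" "q > 0"
  shows "n div q - k div q - (n - k) div q = (if n mod q < k mod q then 1 else 0)"
proof -
  define r where "r = k mod q + (n - k) mod q"
  have n: "n = k + (n - k)" using assms by simp
  have d: "n div q = k div q + (n - k) div q + r div q"
    unfolding r_def by (subst n) (rule div_add1_eq)
  have m: "n mod q = r mod q" unfolding r_def using n by (metis mod_add_eq)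
  have r: "r < 2 * q" using mod_less_divisor[OF assms(2), of k] mod_less_divisor[OF assms(2), of "n - k"]
    unfolding r_def by linarith
  show ?thesis
  proof (cases "r < q")
    case True
    then show ?thesis using d m by (simp add: r_def)
  next
    case False
    then have "r div q = 1" "r mod q = r - q" using r by (simp_all add: div_if mod_if)
    moreover have "r - q < k mod q"
      using mod_less_divisor[OF assms(2), of "n - k"] False unfolding r_def by linarith
    ultimately show ?thesis using d m by simp
  qed
qed

text \<open>There is at most one carry at each of the positions 1 to \<open>N\<close>, where
  \<open>p ^ N \<le> n\<close>.\<close>

lemma prime_power_multiplicity_binomial_le:
  assumes p: "prime (p :: nat)" and "k \<le> n" "n > 0"
  shows "p ^ multiplicity p (n choose k) \<le> n"
proof -
  have p2: "p > 1" using prime_gt_1_nat[OF p] .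
  obtain N where N: "p ^ N \<le> n" "n < p ^ Suc N"
    using ex_power_ivl1[of p n] p2 assms(3) by auto
  have "multiplicity p (n choose k) = (\<Sum>i=1..N. if n mod p ^ i < k mod p ^ i then 1 else 0)"
    unfolding multiplicity_binomial[OF p N(2) assms(2)] using div_carry[OF assms(2)] p2 by simp
  also have "\<dots> \<le> (\<Sum>i=1..N. 1)" by (rule sum_mono) auto
  finally have "multiplicity p (n choose k) \<le> N" by simp
  then have "p ^ multiplicity p (n choose k) \<le> p ^ N" using p2 by (intro power_increasing) auto
  then show ?thesis using N(1) by simp
qed

lemma multiplicity_binomial_large_prime:
  assumes p: "prime (p :: nat)" and "k \<le> n" "n < p ^ 2"
  shows "multiplicity p (n choose k) = (if n mod p < k mod p then 1 else 0)"
proof -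
  have "n < p ^ Suc 1" using assms(3) by (simp add: power2_eq_square)
  from multiplicity_binomial[OF p this assms(2)] show ?thesis
    using div_carry[OF assms(2), of p] prime_gt_0_nat[OF p] by simp
qed

text \<open>Here \<open>s\<close> plays the integer part of the square root of \<open>n\<close>.
  Primes above \<open>s\<close> divide the binomial coefficient at most once; the at most
  \<open>s\<close> others contribute a prime power of at most \<open>n\<close> each.\<close>

lemma binomial_le_prod_large_primes:
  assumes "k \<le> n" "n > 0" and s: "n < (Suc s) ^ 2"
  shows "n choose k \<le> n ^ s * \<Prod>{p. prime p \<and> s < p \<and> p dvd (n choose k)}"
proof -
  let ?C = "n choose k"
  have C0: "?C \<noteq> 0" using assms(1) by simp
  have "?C = (\<Prod>p\<in>prime_factors ?C. p ^ multiplicity p ?C)"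
    using prime_factorization_nat[of ?C] C0 by simp
  also have "prime_factors ?C = {p\<in>prime_factors ?C. p \<le> s} \<union> {p. prime p \<and> s < p \<and> p dvd ?C}"
    using C0 by (auto simp: prime_factors_dvd)
  also have "(\<Prod>p\<in>\<dots>. p ^ multiplicity p ?C) =
     (\<Prod>p\<in>{p\<in>prime_factors ?C. p \<le> s}. p ^ multiplicity p ?C) * (\<Prod>p\<in>{p. prime p \<and> s < p \<and> p dvd ?C}. p ^ multiplicity p ?C)"
  proof (rule prod.union_disjoint)
    have "{p. prime p \<and> s < p \<and> p dvd ?C} \<subseteq> prime_factors ?C" using C0 by (auto simp: prime_factors_dvd)
    then show "finite {p. prime p \<and> s < p \<and> p dvd ?C}" by (rule finite_subset) simp
  qed auto
  also have "(\<Prod>p\<in>{p. prime p \<and> s < p \<and> p dvd ?C}. p ^ multiplicity p ?C) = \<Prod>{p. prime p \<and> s < p \<and> p dvd ?C}"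
  proof (rule prod.cong[OF refl], clarify)
    fix p assume p: "prime p" "s < p" "p dvd ?C"
    have "(Suc s) ^ 2 \<le> p ^ 2" using p(2) by (intro power_mono) auto
    then have n: "n < p ^ 2" using s by linarith
    have "multiplicity p ?C \<noteq> 0" using p(3) C0 multiplicity_eq_zero_iff[of ?C p] prime_gt_1_nat[OF p(1)] by auto
    then have "multiplicity p ?C = 1" using multiplicity_binomial_large_prime[OF p(1) assms(1) n] by (simp split: if_splits)
    then show "p ^ multiplicity p ?C = p" by simp
  qed
  also have "(\<Prod>p\<in>{p\<in>prime_factors ?C. p \<le> s}. p ^ multiplicity p ?C) \<le> (\<Prod>p\<in>{p\<in>prime_factors ?C. p \<le> s}. n)"
    using prime_power_multiplicity_binomial_le[OF _ assms(1,2)] by (intro prod_mono) (auto simp: prime_factors_dvd)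
  also have "\<dots> \<le> n ^ s"
  proof -
    have "{p\<in>prime_factors ?C. p \<le> s} \<subseteq> {1..s}" using prime_ge_1_nat[OF in_prime_factors_imp_prime[of _ ?C]] by auto
    then have "card {p\<in>prime_factors ?C. p \<le> s} \<le> s" using card_mono[of "{1..s}"] by fastforce
    then show ?thesis using assms(2) by (simp add: power_increasing)
  qed
  finally show ?thesis by simp
qed

subsection \<open>Primes in the upper half of an interval\<close>

lemma prod_primes_dvd:
  fixes x :: nat
  assumes "finite A" "\<And>p. p \<in> A \<Longrightarrow> prime p" "\<And>p. p \<in> A \<Longrightarrow> p dvd x"
  shows "\<Prod>A dvd x"
  using assms
proof (induction A rule: finite_induct)
  case (insert p A)
  have "coprime p (\<Prod>A)"
    by (rule prod_coprime_right) (use insert in \<open>auto intro!: primes_coprime\<close>)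
  then have "p * \<Prod>A dvd x" using insert by (intro divides_mult) auto
  then show ?case using insert by simp
qed simp

text \<open>Erdos's induction. For \<open>n = 2 * m + 1\<close> the primes above
  \<open>m + 1\<close> all divide \<open>n choose m\<close>, which is at most \<open>4 ^ m\<close>
  because it occurs twice in a row with sum \<open>2 ^ n\<close>.\<close>

lemma primorial_le:
  "\<Prod>{p::nat. prime p \<and> p \<le> n} \<le> 4 ^ n"
proof (induction n rule: less_induct)
  case (less n)
  have fin: "finite {p::nat. prime p \<and> p \<le> n}" for n by (rule finite_subset[of _ "{..n}"]) auto
  consider "n < 2" | "n = 2" | "n > 2" "even n" | m where "n = 2 * m + 1" "m \<ge> 1"
  proof (cases "n \<le> 2")
    case True
    then show ?thesis using that(1,2) le_neq_implies_less by blast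
  next
    case False
    show ?thesis
    proof (cases "even n")
      case True
      then show ?thesis using that(3) False by simp
    next
      case odd: False
      then obtain m where "n = 2 * m + 1" by (rule oddE)
      then show ?thesis using that(4)[of m] False by simp
    qed
  qed
  then show ?case
  proof cases
    case 1
    then have "\<not> (prime p \<and> p \<le> n)" for p using prime_ge_2_nat[of p] by linarith
    then have "{p::nat. prime p \<and> p \<le> n} = {}" by blast
    then show ?thesis by (simp only: prod.empty) simp
  next
    case 2
    have "prime p \<and> p \<le> 2 \<longleftrightarrow> p = 2" for p :: nat using prime_ge_2_nat[of p] two_is_prime_nat by auto
    then have "{p::nat. prime p \<and> p \<le> 2} = {2}" by blast
    then show ?thesis using 2 by simp
  next
    case 3
    then have "\<not> prime n" using primes_dvd_imp_eq two_is_prime_nat by blast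
    have "p \<le> n \<longleftrightarrow> p \<le> n - 1" if "prime p" for p
    proof -
      have "p \<noteq> n" using that \<open>\<not> prime n\<close> by blast
      then show ?thesis using 3 by linarith
    qed
    then have "{p::nat. prime p \<and> p \<le> n} = {p. prime p \<and> p \<le> n - 1}" by blast
    then have "\<Prod>{p::nat. prime p \<and> p \<le> n} \<le> 4 ^ (n - 1)" using less[of "n - 1"] 3 by simp
    also have "\<dots> \<le> 4 ^ n" by (intro power_increasing) auto
    finally show ?thesis .
  next
    case (4 m)
    define A where "A = {p::nat. prime p \<and> m + 1 < p \<and> p \<le> n}"
    have finA: "finite A" unfolding A_def by (rule finite_subset[OF _ fin[of n]]) auto
    have "\<Prod>A dvd (n choose m)"
    proof (rule prod_primes_dvd[OF finA])
      fix p assume "p \<in> A"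
      then have p: "prime p" "m + 1 < p" "p \<le> n" by (auto simp: A_def)
      have "p dvd fact n" using p by (simp add: prime_dvd_fact_iff)
      also have "fact n = fact m * fact (n - m) * (n choose m)" using binomial_fact_lemma[of m n] 4 by simp
      finally show "p dvd (n choose m)"
        using p 4 by (simp add: prime_dvd_mult_iff prime_dvd_fact_iff del: fact_Suc)
    qed (simp add: A_def)
    then have "\<Prod>A \<le> n choose m" using 4 by (intro dvd_imp_le) auto
    also have "\<dots> \<le> 4 ^ m"
    proof -
      have "2 * (n choose m) = (n choose m) + (n choose (m + 1))" using central_binomial_odd[of n] 4
        by (metis (no_types, lifting) add_diff_cancel_right' binomial_symmetric diff_add_inverse le_add1 mult_2 add.assoc mult.commute one_add_one)
      also have "\<dots> = (\<Sum>k\<in>{m, m + 1}. n choose k)" by simp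
      also have "\<dots> \<le> (\<Sum>k\<le>n. n choose k)" using 4 by (intro sum_mono2) auto
      also have "\<dots> = 2 ^ n" by (rule choose_row_sum)
      finally show ?thesis using 4 by (simp add: power_mult)
    qed
    finally have A: "\<Prod>A \<le> 4 ^ m" .
    have "{p::nat. prime p \<and> p \<le> n} = {p. prime p \<and> p \<le> m + 1} \<union> A" using 4 by (auto simp: A_def)
    then have "\<Prod>{p::nat. prime p \<and> p \<le> n} = \<Prod>{p. prime p \<and> p \<le> m + 1} * \<Prod>A"
      using finA fin[of "m + 1"] by (simp add: prod.union_disjoint A_def disjoint_iff)
    also have "\<dots> \<le> 4 ^ (m + 1) * 4 ^ m" using less[of "m + 1"] 4 A by (intro mult_mono) auto
    also have "\<dots> = 4 ^ n" using 4 by (simp flip: power_add)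
    finally show ?thesis .
  qed
qed

text \<open>With \<open>m = n div 2\<close>, the central binomial coefficient
  \<open>2 * m choose m\<close> is at least \<open>4 ^ m / (2 * m)\<close>. Without a prime in the
  window its large prime factors are at most \<open>2 * m div 3\<close>, with a product of at most
  \<open>4 powr (2 * m / 3)\<close>, apart from at most \<open>r + 5\<close> exceptions; this is too
  small for large \<open>m\<close>.\<close>

lemma ex_prime_upper_half:
  fixes r :: nat
  shows "eventually (\<lambda>n. \<exists>p. prime p \<and> n + r + 3 \<le> 2 * p \<and> p + 3 \<le> n) at_top"
proof -
  \<comment> \<open>The exponent collects \<open>s\<close> small primes, \<open>r + 5\<close>
    exceptions and one factor from the lower bound of the central binomial coefficient.\<close>
  have ev: "eventually (\<lambda>m::nat. (2 * real m + real r) powr (sqrt (2 * real m) + real r + 6) * 4 powr (2 * real m / 3) < 4 powr real m) at_top"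
    by real_asymp
  have "eventually (\<lambda>n::nat. (2 * real (n div 2) + real r) powr (sqrt (2 * real (n div 2)) + real r + 6) * 4 powr (2 * real (n div 2) / 3) < 4 powr real (n div 2)) at_top"
    by (rule eventually_compose_filterlim[OF ev]) (rule filterlim_at_top_div_const_nat, simp)
  then show ?thesis using eventually_ge_at_top[of 20]
  proof eventually_elim
    case (elim n)
    define m where "m = n div 2"
    have m: "m \<ge> 10" "n \<le> 2 * m + 1" "2 * m \<le> n" using elim(2) by (auto simp: m_def)
    define s where "s = nat \<lfloor>sqrt (2 * real m)\<rfloor>"
    have s: "real s \<le> sqrt (2 * real m)" "sqrt (2 * real m) < real (Suc s)" unfolding s_def by (auto simp: of_nat_nat) linarith
    have s2: "2 * m < (Suc s) ^ 2"
    proof -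
      have "(sqrt (2 * real m)) ^ 2 < (real (Suc s)) ^ 2" using s(2) by (intro power_strict_mono) auto
      then have "real (2 * m) < real ((Suc s) ^ 2)" by simp
      then show ?thesis by (simp only: of_nat_less_iff)
    qed
    show ?case
    proof (rule ccontr)
      assume neg: "\<not> (\<exists>p. prime p \<and> n + r + 3 \<le> 2 * p \<and> p + 3 \<le> n)"
      let ?C = "2 * m choose m"
      define P where "P = {p. prime p \<and> s < p \<and> p dvd ?C}"
      \<comment> \<open>These cover the numbers above \<open>m\<close> and up to
        \<open>2 * m\<close> that violate \<open>n + r + 3 \<le> 2 * p\<close> or
        \<open>p + 3 \<le> n\<close>.\<close>
      define B where "B = {m + 1..m + r + 2} \<union> {2 * m - 2..2 * m}"
      have P: "P \<subseteq> {p. prime p \<and> p \<le> 2 * m div 3} \<union> B"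
      proof
        fix p assume "p \<in> P"
        then have p: "prime p" "s < p" "p dvd ?C" by (auto simp: P_def)
        have "(Suc s) ^ 2 \<le> p ^ 2" using p(2) by (intro power_mono) auto
        then have "2 * m < p ^ 2" using s2 by linarith
        then have "multiplicity p ?C = (if (2 * m) mod p < m mod p then 1 else 0)"
          by (intro multiplicity_binomial_large_prime[OF p(1)]) auto
        moreover have "multiplicity p ?C \<noteq> 0" using p(3) multiplicity_eq_zero_iff[of ?C p] prime_gt_1_nat[OF p(1)] by auto
        ultimately have mod: "(2 * m) mod p < m mod p" by (simp split: if_splits)
        show "p \<in> {p. prime p \<and> p \<le> 2 * m div 3} \<union> B"
        proof (cases "p \<le> m")
          case True
          \<comment> \<open>Between \<open>2 * m / 3\<close> and \<open>m\<close> the two remainders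
            are \<open>m - p\<close> and twice that, so no carry occurs.\<close>
          have "\<not> 2 * m < 3 * p"
          proof
            assume "2 * m < 3 * p"
            then have "m div p = 1" using True m by (intro div_nat_eqI) auto
            then have "m mod p = m - p" by (simp add: modulo_nat_def)
            moreover have "(2 * m) div p = 2" using True \<open>2 * m < 3 * p\<close> by (intro div_nat_eqI) auto
            then have "(2 * m) mod p = 2 * m - 2 * p" by (simp add: modulo_nat_def)
            ultimately show False using mod True by simp
          qed
          then have "p \<le> 2 * m div 3" by linarith
          then show ?thesis using p(1) by blast
        next
          case False
          have "p \<le> 2 * m"
          proof (rule ccontr)
            assume "\<not> ?thesis" then show False using mod by simp
          qed
          moreover have "\<not> (n + r + 3 \<le> 2 * p \<and> p + 3 \<le> n)" using neg p(1) by blast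
          ultimately show ?thesis using False m unfolding B_def by auto
        qed
      qed
      have finB: "finite B" by (simp add: B_def)
      have finQ: "finite {p::nat. prime p \<and> p \<le> k}" for k by (rule finite_subset[of _ "{..k}"]) auto
      have "\<Prod>P \<le> \<Prod>({p. prime p \<and> p \<le> 2 * m div 3} \<union> B)"
      proof (rule dvd_imp_le)
        show "\<Prod>P dvd \<Prod>({p. prime p \<and> p \<le> 2 * m div 3} \<union> B)"
          by (rule prod_dvd_prod_subset[OF _ P]) (use finQ finB in auto)
        show "0 < \<Prod>({p. prime p \<and> p \<le> 2 * m div 3} \<union> B)"
          by (rule prod_pos) (use m in \<open>auto simp: B_def prime_gt_0_nat\<close>)
      qed
      also have "\<dots> \<le> \<Prod>{p. prime p \<and> p \<le> 2 * m div 3} * \<Prod>(B - {p. prime p \<and> p \<le> 2 * m div 3})"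
        by (subst Un_Diff_cancel[symmetric], subst prod.union_disjoint) (use finQ finB in auto)
      also have "\<dots> \<le> 4 ^ (2 * m div 3) * (2 * m + r) ^ (r + 5)"
      proof (intro mult_mono primorial_le)
        let ?B = "B - {p. prime p \<and> p \<le> 2 * m div 3}"
        have "\<Prod>?B \<le> (\<Prod>p\<in>?B. 2 * m + r)" by (rule prod_mono) (use m in \<open>auto simp: B_def\<close>)
        also have "\<dots> = (2 * m + r) ^ card ?B" by simp
        also have "\<dots> \<le> (2 * m + r) ^ (r + 5)"
        proof (intro power_increasing)
          have "card ?B \<le> card B" by (rule card_mono[OF finB]) auto
          also have "\<dots> \<le> card {m + 1..m + r + 2} + card {2 * m - 2..2 * m}" unfolding B_def by (rule card_Un_le)
          also have "\<dots> = r + 5" using m by simp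
          finally show "card ?B \<le> r + 5" .
        qed (use m in simp)
        finally show "\<Prod>?B \<le> (2 * m + r) ^ (r + 5)" .
      qed auto
      finally have "\<Prod>P \<le> 4 ^ (2 * m div 3) * (2 * m + r) ^ (r + 5)" .
      then have "(2 * m) ^ s * \<Prod>P \<le> (2 * m) ^ s * (4 ^ (2 * m div 3) * (2 * m + r) ^ (r + 5))"
        by (rule mult_le_mono2)
      moreover have "?C \<le> (2 * m) ^ s * \<Prod>P"
        unfolding P_def by (rule binomial_le_prod_large_primes) (use s2 m in auto)
      ultimately have "?C \<le> (2 * m) ^ s * (4 ^ (2 * m div 3) * (2 * m + r) ^ (r + 5))" by (rule le_trans[rotated])
      then have "real ?C \<le> real ((2 * m) ^ s * (4 ^ (2 * m div 3) * (2 * m + r) ^ (r + 5)))" by (simp only: of_nat_le_iff)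
      also have "\<dots> = (2 * real m) ^ s * (4 ^ (2 * m div 3) * (2 * real m + real r) ^ (r + 5))" by simp
      also have "\<dots> \<le> (2 * real m + real r) ^ s * (4 powr (2 * real m / 3) * (2 * real m + real r) ^ (r + 5))"
      proof -
        have "(4 :: real) ^ (2 * m div 3) = 4 powr real (2 * m div 3)" by (simp add: powr_realpow)
        also have "\<dots> \<le> 4 powr (2 * real m / 3)" using of_nat_div_le_of_nat[of "2 * m" 3, where ?'a = real] by (intro powr_mono) simp_all
        finally show ?thesis by (intro mult_mono power_mono) auto
      qed
      finally have C: "real ?C \<le> (2 * real m + real r) ^ s * (4 powr (2 * real m / 3) * (2 * real m + real r) ^ (r + 5))" .
      have "4 ^ m \<le> (2 * real m) * real ?C"
        using central_binomial_lower_bound[of m] m by (simp add: field_simps)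
      also have "\<dots> \<le> (2 * real m + real r) * ((2 * real m + real r) ^ s * (4 powr (2 * real m / 3) * (2 * real m + real r) ^ (r + 5)))"
        using C by (intro mult_mono) auto
      also have "\<dots> = (2 * real m + real r) ^ (s + (r + 6)) * 4 powr (2 * real m / 3)"
      proof -
        have "s + (r + 6) = Suc (s + (r + 5))" by simp
        then show ?thesis by (simp only: power_Suc power_add mult_ac)
      qed
      also have "\<dots> = (2 * real m + real r) powr (real s + real r + 6) * 4 powr (2 * real m / 3)"
        using m by (subst powr_realpow[symmetric]) (auto simp: add_ac)
      also have "\<dots> \<le> (2 * real m + real r) powr (sqrt (2 * real m) + real r + 6) * 4 powr (2 * real m / 3)"
        using m s(1) by (intro mult_right_mono powr_mono) auto
      also have "\<dots> < 4 powr real m" using elim(1) by (simp add: m_def)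
      finally show False by (simp add: powr_realpow)
    qed
  qed
qed

subsection \<open>A valuation ring of the complex numbers above a prime\<close>

definition subring_set :: "complex set \<Rightarrow> bool" where
  "subring_set A \<longleftrightarrow> 1 \<in> A \<and> (\<forall>x\<in>A. \<forall>y\<in>A. x + y \<in> A \<and> x - y \<in> A \<and> x * y \<in> A)"

lemma subring_set_poly_values:
  assumes "subring_set A"
  shows "subring_set {poly q x |q. \<forall>i. coeff q i \<in> A}"
proof -
  have z: "0 \<in> A" using assms unfolding subring_set_def by (metis diff_self)
  have sm: "sum f I \<in> A" if "\<And>i. i \<in> I \<Longrightarrow> f i \<in> A" for f :: "nat \<Rightarrow> complex" and I
    using that by (induction I rule: infinite_finite_induct) (use assms z in \<open>auto simp: subring_set_def\<close>)
  show ?thesis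
    unfolding subring_set_def
  proof (intro conjI ballI)
    show "1 \<in> {poly q x |q. \<forall>i. coeff q i \<in> A}"
      using assms z by (auto intro!: exI[of _ 1] simp: subring_set_def)
    fix a b assume "a \<in> {poly q x |q. \<forall>i. coeff q i \<in> A}" "b \<in> {poly q x |q. \<forall>i. coeff q i \<in> A}"
    then obtain p q where pq: "a = poly p x" "b = poly q x" "\<And>i. coeff p i \<in> A" "\<And>i. coeff q i \<in> A" by blast
    show "a + b \<in> {poly q x |q. \<forall>i. coeff q i \<in> A}"
      using pq assms by (auto intro!: exI[of _ "p + q"] simp: subring_set_def)
    show "a - b \<in> {poly q x |q. \<forall>i. coeff q i \<in> A}"
      using pq assms by (auto intro!: exI[of _ "p - q"] simp: subring_set_def)
    show "a * b \<in> {poly q x |q. \<forall>i. coeff q i \<in> A}"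
      using pq assms by (auto intro!: exI[of _ "p * q"] sm simp: subring_set_def coeff_mult)
  qed
qed

text \<open>
  Chevalley's argument. If neither \<open>x\<close> nor \<open>1 / x\<close> is in a subring \<open>A\<close> that is maximal among those
  missing \<open>1 / p\<close>, then \<open>1\<close> is both in \<open>p A[x]\<close> and in \<open>p A[1 / x]\<close>; of two such expressions of minimal
  degree, the longer one can be shortened with the help of the other.
\<close>

lemma shorten_relation:
  assumes A: "subring_set A" "c \<in> A" and x: "x \<noteq> 0"
    and p: "\<And>i. coeff p i \<in> A" "1 = c * poly p x" "degree p = n"
    and q: "\<And>i. coeff q i \<in> A" "1 = c * poly q (1 / x)" "degree q = m" and "m \<le> n" "n > 0"
  shows "\<exists>p'. (\<forall>i. coeff p' i \<in> A) \<and> 1 = c * poly p' x \<and> degree p' < n"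
proof -
  have A0: "0 \<in> A" using A unfolding subring_set_def by (metis diff_self)
  define b0 where "b0 = coeff q 0"
  define a where "a = coeff p n"
  \<comment> \<open>\<open>x ^ n (1 - c b0) = c (\<Sum>j=1..m. b j x ^ (n - j))\<close>\<close>
  define s where "s = (\<Sum>j=1..m. monom (coeff q j) (n - j))"
  have "x ^ n * poly q (1 / x) = (\<Sum>j\<le>m. coeff q j * x ^ (n - j))"
    unfolding poly_altdef q(3) sum_distrib_left using x \<open>m \<le> n\<close>
    by (intro sum.cong) (auto simp: power_one_over field_simps power_diff)
  also have "{..m} = insert 0 {1..m}" by auto
  also have "(\<Sum>j\<in>\<dots>. coeff q j * x ^ (n - j)) = b0 * x ^ n + poly s x"
    by (subst sum.insert) (auto simp: s_def b0_def poly_sum poly_monom)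
  finally have s: "x ^ n * (1 - c * b0) = c * poly s x"
    using q(2) by (simp add: algebra_simps) (metis mult.assoc mult.commute mult.right_neutral distrib_left)
  have ds: "degree s < n"
    unfolding s_def by (rule degree_sum_less[OF _ \<open>n > 0\<close>]) (use \<open>n > 0\<close> in \<open>auto intro!: le_less_trans[OF degree_monom_le]\<close>)
  define p0 where "p0 = p - monom a n"
  have dp0: "degree p0 < n"
  proof (rule degree_lessI)
    show "\<forall>k\<ge>n. coeff p0 k = 0" using p(3) by (auto simp: p0_def a_def coeff_eq_0 le_less)
  qed (use \<open>n > 0\<close> in auto)
  \<comment> \<open>Write 1 as \<open>c * b0 + (1 - c * b0) * (c * poly p x)\<close> and replace the
    leading part \<open>(1 - c * b0) * a * x ^ n\<close> by \<open>c * a * poly s x\<close>.\<close>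
  define p' where "p' = [:b0:] + Polynomial.smult (1 - c * b0) p0 + Polynomial.smult (c * a) s"
  have px: "poly p x = poly p0 x + a * x ^ n" by (simp add: p0_def poly_monom)
  have "c * poly p' x = c * b0 + (1 - c * b0) * (c * poly p0 x) + c * a * (c * poly s x)"
    by (simp add: p'_def algebra_simps)
  also have "\<dots> = c * b0 + (1 - c * b0) * (c * (poly p0 x + a * x ^ n))"
    unfolding s[symmetric] by (simp add: algebra_simps)
  also have "\<dots> = 1" using p(2) px by simp
  finally have "1 = c * poly p' x" by simp
  moreover have "degree p' < n"
    unfolding p'_def using dp0 ds \<open>n > 0\<close>
    by (intro degree_add_less) (auto intro: le_less_trans[OF degree_smult_le])
  moreover have "coeff p' i \<in> A" for i
  proof -
    have smA: "(\<Sum>j\<in>I. f j) \<in> A" if "\<And>j. j \<in> I \<Longrightarrow> f j \<in> A" for f :: "nat \<Rightarrow> complex" and I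
      using that by (induction I rule: infinite_finite_induct) (use A A0 in \<open>auto simp: subring_set_def\<close>)
    have "coeff s i \<in> A" unfolding s_def coeff_sum by (rule smA) (use q(1) A0 in auto)
    moreover have "coeff p0 i \<in> A" using p(1) A0 by (auto simp: p0_def a_def)
    moreover have "coeff [:b0:] i \<in> A" using q(1) A0 by (cases i) (auto simp: b0_def)
    ultimately show ?thesis using A p(1)[of n] q(1)[of 0]
      by (auto simp: p'_def subring_set_def a_def b0_def)
  qed
  ultimately show ?thesis by blast
qed

lemma ex_valuation_ring:
  assumes p: "prime (p :: nat)"
  shows "\<exists>A. subring_set A \<and> 1 / of_nat p \<notin> A \<and> (\<forall>x. x \<in> A \<or> 1 / x \<in> A)"
proof -
  let ?c = "of_nat p :: complex"
  have p0: "?c \<noteq> 0" using prime_gt_0_nat[OF p] by simp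
  define F where "F = {A. subring_set A \<and> 1 / ?c \<notin> A}"
  have Zin: "\<int> \<in> F"
  proof -
    have "1 / ?c \<notin> \<int>"
    proof
      assume "1 / ?c \<in> \<int>"
      then obtain k where k: "1 / ?c = of_int k" by (auto elim: Ints_cases)
      then have "of_int (k * int p) = (1 :: complex)" using p0 by (simp add: field_simps)
      then have "k * int p = 1" by (simp only: of_int_eq_1_iff)
      then have "p dvd 1" by (metis dvd_triv_right int_dvd_int_iff of_nat_1)
      then show False using p by simp
    qed
    then show ?thesis by (auto simp: F_def subring_set_def)
  qed
  have "\<exists>M\<in>F. \<forall>B\<in>F. M \<subseteq> B \<longrightarrow> B = M"
  proof (rule subset_Zorn_nonempty)
    show "F \<noteq> {}" using Zin by blast
    fix C assume C: "C \<noteq> {}" "subset.chain F C"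
    have "subring_set (\<Union>C)"
      unfolding subring_set_def
    proof (intro conjI ballI)
      show "1 \<in> \<Union>C" using C unfolding subset_chain_def F_def subring_set_def by blast
      fix x y assume "x \<in> \<Union>C" "y \<in> \<Union>C"
      then obtain B1 B2 where B12: "B1 \<in> C" "x \<in> B1" "B2 \<in> C" "y \<in> B2" by blast
      have "B1 \<subseteq> B2 \<or> B2 \<subseteq> B1" using C(2) B12(1,3) unfolding subset_chain_def by blast
      then obtain B where B: "B \<in> C" "x \<in> B" "y \<in> B" using B12 by blast
      then have "subring_set B" using C(2) unfolding subset_chain_def F_def by blast
      then have "x + y \<in> B" "x - y \<in> B" "x * y \<in> B" using B unfolding subring_set_def by blast+
      then show "x + y \<in> \<Union>C" "x - y \<in> \<Union>C" "x * y \<in> \<Union>C" using B(1) by blast+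
    qed
    then show "\<Union>C \<in> F" using C(2) unfolding F_def subset_chain_def by blast
  qed
  then obtain A where A: "A \<in> F" "\<And>B. B \<in> F \<Longrightarrow> A \<subseteq> B \<Longrightarrow> B = A" by blast
  have sA: "subring_set A" and nA: "1 / ?c \<notin> A" using A by (auto simp: F_def)
  have A0: "0 \<in> A" "1 \<in> A" using sA unfolding subring_set_def by (metis diff_self, blast)
  have cA: "?c \<in> A"
  proof -
    have "of_nat k \<in> A" for k
    proof (induction k)
      case (Suc k)
      then have "1 + of_nat k \<in> A" using sA A0(2) unfolding subring_set_def by blast
      then show ?case by simp
    qed (use A0 in simp)
    then show ?thesis .
  qed
  \<comment> \<open>Maximality of \<open>A\<close> puts \<open>1 / p\<close> into the ring generated
    by \<open>A\<close> and \<open>x\<close>, and this is such a relation.\<close>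
  have rel: "\<exists>q. (\<forall>i. coeff q i \<in> A) \<and> 1 = ?c * poly q x" if "x \<notin> A" for x
  proof -
    let ?B = "{poly q x |q. \<forall>i. coeff q i \<in> A}"
    have "A \<subseteq> ?B"
    proof
      fix a assume "a \<in> A"
      then have "\<forall>i. coeff [:a:] i \<in> A" using A0 by (simp add: coeff_pCons split: nat.splits)
      then show "a \<in> ?B" by (auto intro!: exI[of _ "[:a:]"])
    qed
    moreover have "x \<in> ?B"
    proof -
      have "\<forall>i. coeff [:0, 1:] i \<in> A" using A0 by (simp add: coeff_pCons split: nat.splits)
      then show ?thesis by (auto intro!: exI[of _ "[:0, 1:]"])
    qed
    ultimately have "?B \<notin> F" using A(2)[of ?B] that by blast
    then have "1 / ?c \<in> ?B" using subring_set_poly_values[OF sA] unfolding F_def by blast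
    then obtain q where q: "\<forall>i. coeff q i \<in> A" "1 / ?c = poly q x" by blast
    have "1 = ?c * poly q x" unfolding q(2)[symmetric] using p0 by simp
    then show ?thesis using q(1) by blast
  qed
  have "x \<in> A \<or> 1 / x \<in> A" for x
  proof (rule ccontr)
    assume neg: "\<not> (x \<in> A \<or> 1 / x \<in> A)"
    then have x0: "x \<noteq> 0" using A0 by auto
    define P where "P y q \<longleftrightarrow> (\<forall>i. coeff q i \<in> A) \<and> 1 = ?c * poly q y" for y q
    have ex: "\<exists>q. P y q \<and> (\<forall>q'. P y q' \<longrightarrow> degree q \<le> degree q')" if "y \<notin> A" for y
      using rel[OF that] ex_has_least_nat[of "P y" _ degree] unfolding P_def by metis
    have deg0: "degree q > 0" if "P y q" for y q
    proof (rule ccontr)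
      assume "\<not> degree q > 0"
      then obtain a where "q = [:a:]" using degree_eq_zeroE by auto
      then have "a \<in> A" "1 = ?c * a" using that unfolding P_def by (auto dest: spec[of _ 0])
      then show False using nA p0 by (metis nonzero_mult_div_cancel_left)
    qed
    obtain q1 where q1: "P x q1" "\<And>q'. P x q' \<Longrightarrow> degree q1 \<le> degree q'" using ex[of x] neg by blast
    obtain q2 where q2: "P (1 / x) q2" "\<And>q'. P (1 / x) q' \<Longrightarrow> degree q2 \<le> degree q'" using ex[of "1 / x"] neg by blast
    show False
    proof (cases "degree q2 \<le> degree q1")
      case True
      then obtain p' where "P x p'" "degree p' < degree q1"
        using shorten_relation[OF sA cA x0, of q1 "degree q1" q2 "degree q2"] q1(1) q2(1) deg0[OF q1(1)]
        unfolding P_def by blast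
      then show False using q1(2)[of p'] by simp
    next
      case False
      then obtain p' where "P (1 / x) p'" "degree p' < degree q2"
        using shorten_relation[OF sA cA, of "1 / x" q2 "degree q2" q1 "degree q1"] q1(1) q2(1) deg0[OF q2(1)] x0
        unfolding P_def by fastforce
      then show False using q2(2)[of p'] by simp
    qed
  qed
  then show ?thesis using sA nA by blast
qed

text \<open>No value group is given: rational valuations are introduced by \<open>has_val\<close>,
  and other complex numbers are compared by membership of quotients in \<open>A\<close>.\<close>

locale valuation_ring =
  fixes p :: nat and A :: "complex set"
  assumes p: "prime p" and A: "subring_set A" and pA: "1 / of_nat p \<notin> A"
    and total: "x \<in> A \<or> 1 / x \<in> A"
begin

text \<open>Zero is treated explicitly here and in \<open>maxid\<close>, because
  \<open>1 / 0 = 0\<close> lies in \<open>A\<close>.\<close>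

definition units :: "complex set" where "units = {x. x \<noteq> 0 \<and> x \<in> A \<and> 1 / x \<in> A}"
definition maxid :: "complex set" where "maxid = {x \<in> A. x = 0 \<or> 1 / x \<notin> A}"

lemma A_1 [simp]: "1 \<in> A" and A_add: "x \<in> A \<Longrightarrow> y \<in> A \<Longrightarrow> x + y \<in> A"
  and A_diff: "x \<in> A \<Longrightarrow> y \<in> A \<Longrightarrow> x - y \<in> A" and A_mult: "x \<in> A \<Longrightarrow> y \<in> A \<Longrightarrow> x * y \<in> A"
  using A by (auto simp: subring_set_def)
lemma A_0 [simp]: "0 \<in> A" using A_diff[OF A_1 A_1] by simp
lemma A_minus: "x \<in> A \<Longrightarrow> - x \<in> A" using A_diff[OF A_0] by simp
lemma A_minus_iff [simp]: "- x \<in> A \<longleftrightarrow> x \<in> A" using A_minus[of x] A_minus[of "- x"] by auto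
lemma A_power: "x \<in> A \<Longrightarrow> x ^ k \<in> A" by (induction k) (auto simp: A_mult)
lemma A_of_nat [simp]: "of_nat k \<in> A" by (induction k) (auto simp: A_add)
lemma A_of_int [simp]: "of_int k \<in> A" by (cases k) (simp_all add: A_minus A_add flip: of_nat_Suc)

lemma units_A: "x \<in> units \<Longrightarrow> x \<in> A" and maxid_A: "x \<in> maxid \<Longrightarrow> x \<in> A"
  by (auto simp: units_def maxid_def)
lemma A_cases: "x \<in> A \<Longrightarrow> x \<in> units \<or> x \<in> maxid" by (auto simp: units_def maxid_def)
lemma units_maxid: "x \<in> units \<Longrightarrow> x \<in> maxid \<Longrightarrow> False" by (auto simp: units_def maxid_def)
lemma units_1 [simp]: "1 \<in> units" by (simp add: units_def)
lemma units_mult: "x \<in> units \<Longrightarrow> y \<in> units \<Longrightarrow> x * y \<in> units"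
  using A_mult[of "1 / x" "1 / y"] by (auto simp: units_def A_mult)
lemma units_inverse: "x \<in> units \<Longrightarrow> 1 / x \<in> units" by (auto simp: units_def)
lemma units_minus: "x \<in> units \<Longrightarrow> - x \<in> units" by (auto simp: units_def)
lemma units_power: "x \<in> units \<Longrightarrow> x ^ k \<in> units" by (induction k) (auto simp: units_mult)
lemma maxid_0 [simp]: "0 \<in> maxid" by (simp add: maxid_def)
lemma maxid_mult: "a \<in> A \<Longrightarrow> x \<in> maxid \<Longrightarrow> a * x \<in> maxid"
proof -
  assume a: "a \<in> A" "x \<in> maxid"
  show ?thesis
  proof (rule ccontr)
    assume "a * x \<notin> maxid"
    then have "a * x \<noteq> 0" "1 / (a * x) \<in> A" using a by (auto simp: maxid_def A_mult)
    then have "a * (1 / (a * x)) \<in> A" "x \<noteq> 0" using a by (auto simp only: A_mult mult_zero_right)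
    then have "1 / x \<in> A" using \<open>a * x \<noteq> 0\<close> by (simp add: field_simps)
    then show False using a \<open>x \<noteq> 0\<close> by (simp add: maxid_def)
  qed
qed

lemma maxid_add: "x \<in> maxid \<Longrightarrow> y \<in> maxid \<Longrightarrow> x + y \<in> maxid"
proof -
  have *: "x + y \<in> maxid" if "x \<in> maxid" "y \<in> maxid" "y \<noteq> 0" "x / y \<in> A" for x y
  proof -
    have "(x / y + 1) * y \<in> maxid" using that by (intro maxid_mult A_add) auto
    moreover have "(x / y + 1) * y = x + y" using that(3) by (simp add: field_simps)
    ultimately show ?thesis by simp
  qed
  assume xy: "x \<in> maxid" "y \<in> maxid"
  show ?thesis
  proof (cases "x = 0 \<or> y = 0")
    case False
    then show ?thesis using *[of x y] *[of y x] xy total[of "x / y"] by (auto simp: add.commute)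
  qed (use xy in auto)
qed

lemma maxid_minus: "x \<in> maxid \<Longrightarrow> - x \<in> maxid" using maxid_mult[of "- 1" x] by simp
lemma maxid_sum: "(\<And>i. i \<in> I \<Longrightarrow> f i \<in> maxid) \<Longrightarrow> sum f I \<in> maxid"
  by (induction I rule: infinite_finite_induct) (auto simp: maxid_add)
lemma one_not_maxid: "1 \<notin> maxid" using units_maxid units_1 by blast
lemma one_plus_maxid: "x \<in> maxid \<Longrightarrow> 1 + x \<in> units"
  using A_cases[of "1 + x"] maxid_add[of "1 + x" "- x"] maxid_minus[of x] one_not_maxid
  by (auto simp: maxid_A A_add)
lemma not_A: "x \<notin> A \<Longrightarrow> 1 / x \<in> maxid" using total[of x] by (auto simp: maxid_def)

lemma p_maxid: "of_nat p \<in> maxid" using pA by (simp add: maxid_def)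

text \<open>Otherwise Bezout's identity would put 1 into the maximal ideal.\<close>

lemma of_int_units:
  assumes "\<not> int p dvd k"
  shows "of_int k \<in> units"
proof (rule ccontr)
  assume "of_int k \<notin> units"
  then have k: "of_int k \<in> maxid" using A_cases A_of_int by blast
  have "coprime (int p) k" using assms p by (simp add: prime_imp_coprime)
  then obtain u v where "u * int p + v * k = 1" using bezout_int[of "int p" k] by auto
  then have "of_int u * of_nat p + of_int v * of_int k = (1 :: complex)"
    by (metis of_int_1 of_int_add of_int_mult of_int_of_nat_eq)
  moreover have "of_int u * of_nat p + of_int v * (of_int k :: complex) \<in> maxid"
    using k p_maxid by (intro maxid_add maxid_mult) auto
  ultimately show False using one_not_maxid by simp
qed

lemma power_units: "x ^ k \<in> units \<Longrightarrow> k > 0 \<Longrightarrow> x \<in> units"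
proof -
  assume x: "x ^ k \<in> units" and k: "k > 0"
  have mpow: "y ^ k \<in> maxid" if "y \<in> maxid" for y
    using maxid_mult[of "y ^ (k - 1)" y] that power_minus_mult[OF k, of y] by (metis A_power maxid_A)
  show ?thesis
  proof (cases "x \<in> A")
    case True
    then show ?thesis using A_cases mpow[of x] x units_maxid by blast
  next
    case False
    then have "(1 / x) ^ k \<in> maxid" using mpow not_A by blast
    moreover have "(1 / x) ^ k \<in> units" using units_inverse[OF x] by (simp add: power_one_over)
    ultimately show ?thesis using units_maxid by blast
  qed
qed

text \<open>Real powers of \<open>p\<close> form a multiplicative system of elements, one for each
  rational valuation; they serve as scaling factors.\<close>

definition ppow :: "real \<Rightarrow> complex" where "ppow q = complex_of_real (real p powr q)"

lemma p_pos: "real p > 0" using prime_gt_0_nat[OF p] by simp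
lemma ppow_nonzero [simp]: "ppow q \<noteq> 0" using p_pos by (simp add: ppow_def)
lemma ppow_add: "ppow (q + r) = ppow q * ppow r" by (simp add: ppow_def powr_add)
lemma ppow_diff: "ppow (q - r) = ppow q / ppow r" using p_pos by (simp add: ppow_def powr_diff)
lemma ppow_0 [simp]: "ppow 0 = 1" using p_pos by (simp add: ppow_def)
lemma ppow_power: "ppow q ^ k = ppow (q * real k)"
  using p_pos by (simp add: ppow_def powr_power flip: of_real_power) (simp add: mult.commute)
lemma ppow_of_nat: "ppow (real k) = of_nat p ^ k" using p_pos by (simp add: ppow_def powr_realpow)

text \<open>A suitable power of \<open>ppow q\<close> is a positive power of
  \<open>p\<close>.\<close>

lemma ppow_maxid: "q \<in> \<rat> \<Longrightarrow> q > 0 \<Longrightarrow> ppow q \<in> maxid"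
proof -
  assume q: "q \<in> \<rat>" "q > 0"
  then obtain m n :: nat where mn: "n \<noteq> 0" "\<bar>q\<bar> = real m / real n" by (metis Rats_abs_nat_div_natE)
  then have m: "m > 0" using q by (cases "m = 0") auto
  have "ppow q ^ n = of_nat p ^ m" unfolding ppow_power using mn q by (simp flip: ppow_of_nat)
  also have "\<dots> \<in> maxid" using maxid_mult[of "of_nat p ^ (m - 1)" "of_nat p"] p_maxid
      power_minus_mult[OF m, of "of_nat p"] by (metis A_power A_of_nat)
  finally have pn: "ppow q ^ n \<in> maxid" .
  show ?thesis
  proof (cases "ppow q \<in> A")
    case True
    then show ?thesis using A_cases[OF True] units_power[of "ppow q" n] pn units_maxid by blast
  next
    case False
    then have "(1 / ppow q) \<in> A" using total by blast
    then have "(1 / ppow q) ^ n * ppow q ^ n \<in> maxid" using pn by (intro maxid_mult A_power)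
    then show ?thesis using one_not_maxid by (simp flip: power_mult_distrib)
  qed
qed

text \<open>The valuation is normalised to 1 at \<open>p\<close>. It is a relation since 0, and
  possibly other numbers, have no rational valuation.\<close>

definition has_val :: "complex \<Rightarrow> real \<Rightarrow> bool" where
  "has_val x q \<longleftrightarrow> q \<in> \<rat> \<and> x / ppow q \<in> units"

lemma has_val_nonzero: "has_val x q \<Longrightarrow> x \<noteq> 0" by (auto simp: has_val_def units_def)
lemma has_val_Rats: "has_val x q \<Longrightarrow> q \<in> \<rat>" by (simp add: has_val_def)
lemma has_val_mult: "has_val x q \<Longrightarrow> has_val y r \<Longrightarrow> has_val (x * y) (q + r)"
  using units_mult[of "x / ppow q" "y / ppow r"] by (simp add: has_val_def ppow_add)
lemma has_val_divide: "has_val x q \<Longrightarrow> has_val y r \<Longrightarrow> has_val (x / y) (q - r)"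
  using units_mult[OF _ units_inverse, of "x / ppow q" "y / ppow r"] by (simp add: has_val_def ppow_diff field_simps)
lemma has_val_unit: "u \<in> units \<Longrightarrow> has_val u 0" by (simp add: has_val_def)
lemma has_val_ppow: "q \<in> \<rat> \<Longrightarrow> has_val (ppow q) q" by (simp add: has_val_def)
lemma has_val_minus: "has_val x q \<Longrightarrow> has_val (- x) q" by (simp add: has_val_def units_minus)
lemma has_val_power: "has_val x q \<Longrightarrow> has_val (x ^ k) (real k * q)"
  by (induction k) (auto simp: has_val_unit algebra_simps intro: has_val_mult)
lemma has_val_prod: "(\<And>i. i \<in> I \<Longrightarrow> has_val (f i) (q i)) \<Longrightarrow> has_val (prod f I) (sum q I)"
  by (induction I rule: infinite_finite_induct) (auto simp: has_val_unit intro: has_val_mult)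

lemma has_val_pos: "has_val x q \<Longrightarrow> q > 0 \<Longrightarrow> x \<in> maxid"
  using maxid_mult[of "x / ppow q" "ppow q"] ppow_maxid by (auto simp: has_val_def dest: units_A)
lemma has_val_0: "has_val x 0 \<Longrightarrow> x \<in> units" by (simp add: has_val_def)
lemma has_val_nonneg: "has_val x q \<Longrightarrow> q \<ge> 0 \<Longrightarrow> x \<in> A"
  using has_val_pos[of x q] has_val_0[of x] units_A maxid_A by (cases "q = 0") auto

lemma has_val_neg: "has_val x q \<Longrightarrow> q < 0 \<Longrightarrow> x \<notin> A"
proof
  assume x: "has_val x q" "q < 0" "x \<in> A"
  have "has_val (1 / x) (0 - q)" using has_val_divide[OF has_val_unit[OF units_1] x(1)] .
  then have "1 / x \<in> maxid" using has_val_pos x(2) by auto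
  then have "x * (1 / x) \<in> maxid" using x(3) maxid_mult by blast
  then show False using one_not_maxid has_val_nonzero[OF x(1)] by simp
qed

lemma has_val_unique: "has_val x q \<Longrightarrow> has_val x r \<Longrightarrow> q = r"
proof -
  have "False" if x: "has_val x q" "has_val x r" "q < r" for q r
  proof -
    have "has_val 1 (r - q)" using has_val_divide[OF x(2,1)] has_val_nonzero[OF x(1)] by simp
    then show False using has_val_pos[of 1 "r - q"] x(3) one_not_maxid by simp
  qed
  then show "has_val x q \<Longrightarrow> has_val x r \<Longrightarrow> q = r" by (metis linorder_neqE_linordered_idom)
qed

lemma has_val_of_int:
  assumes "k \<noteq> 0"
  shows "has_val (of_int k) (real (multiplicity (int p) k))"
proof -
  have "\<not> is_unit (int p)" using p by (auto dest: prime_gt_1_nat)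
  then obtain y where y: "k = int p ^ multiplicity (int p) k * y" "\<not> int p dvd y"
    using multiplicity_decompose'[OF assms, of "int p"] by metis
  have "has_val (of_int (int p ^ multiplicity (int p) k)) (real (multiplicity (int p) k))"
    using has_val_ppow[of "real (multiplicity (int p) k)"] by (simp add: ppow_of_nat)
  then have "has_val (of_int (int p ^ multiplicity (int p) k) * of_int y) (real (multiplicity (int p) k) + 0)"
    by (rule has_val_mult) (rule has_val_unit[OF of_int_units[OF y(2)]])
  also have "of_int (int p ^ multiplicity (int p) k) * of_int y = (of_int k :: complex)"
    using arg_cong[OF y(1), of complex_of_int] unfolding of_int_mult by (rule sym)
  finally show ?thesis by simp
qed

lemma has_val_of_nat:
  assumes "k \<noteq> 0"
  shows "has_val (of_nat k) (real (multiplicity p k))"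
proof -
  have "\<not> is_unit p" using prime_gt_1_nat[OF p] by simp
  then obtain y where y: "k = p ^ multiplicity p k * y" "\<not> p dvd y"
    using multiplicity_decompose'[OF assms, of p] by metis
  have "of_int (int y) \<in> units" by (rule of_int_units) (use y(2) in simp)
  moreover have "has_val (of_nat (p ^ multiplicity p k)) (real (multiplicity p k))"
    using has_val_ppow[of "real (multiplicity p k)"] by (simp add: ppow_of_nat)
  ultimately have "has_val (of_nat (p ^ multiplicity p k) * of_nat y) (real (multiplicity p k) + 0)"
    by (intro has_val_mult has_val_unit) simp_all
  also have "of_nat (p ^ multiplicity p k) * of_nat y = (of_nat k :: complex)"
    using arg_cong[OF y(1), of complex_of_nat] unfolding of_nat_mult by (rule sym)
  finally show ?thesis by simp
qed

lemma has_val_Rats_Ints: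
  assumes "x \<in> \<rat>" "x \<noteq> 0"
  shows "\<exists>q\<in>\<int>. has_val x q"
proof -
  from assms(1) obtain a b :: int where "b > 0" "coprime a b" and x: "x = of_int a / of_int b" by (rule Rats_cases')
  then have ab: "b \<noteq> 0" "x = of_int a / of_int b" by auto
  then have "a \<noteq> 0" using assms(2) by auto
  then have "has_val x (real (multiplicity (int p) a) - real (multiplicity (int p) b))"
    using ab by (auto intro: has_val_divide has_val_of_int)
  then show ?thesis by (intro bexI) auto
qed

lemma has_val_Rats_Ints':
  assumes "x \<in> \<rat>" "has_val x q"
  shows "q \<in> \<int>"
  using has_val_Rats_Ints[OF assms(1) has_val_nonzero[OF assms(2)]] has_val_unique[OF assms(2)] by blast

subsection \<open>Newton polygons\<close>

text \<open>In a vanishing sum the least valuation is attained at least twice. That \<open>x\<close>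
  has a rational valuation is part of the conclusion: two terms whose quotient is a unit determine
  the valuation of a power of \<open>x\<close>, and \<open>power_units\<close> passes to
  \<open>x\<close>.\<close>

lemma root_slope:
  assumes c: "\<And>j. j \<le> n \<Longrightarrow> has_val (c j) (w j)"
    and root: "(\<Sum>j\<le>n. c j * x ^ j) = 0" and x: "x \<noteq> 0"
  obtains q i k where "has_val x q" "i < k" "k \<le> n" "w i + real i * q = w k + real k * q"
    "\<And>j. j \<le> n \<Longrightarrow> w k + real k * q \<le> w j + real j * q"
proof -
  define t where "t j = c j * x ^ j" for j
  have t0: "t j \<noteq> 0" if "j \<le> n" for j using has_val_nonzero[OF c[OF that]] x by (simp add: t_def)
  \<comment> \<open>Before \<open>x\<close> is known to have a valuation, a term of least valuation
    is found through divisibility in \<open>A\<close>.\<close>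
  have "\<exists>k\<in>I. \<forall>i\<in>I. t i / t k \<in> A" if "finite I" "I \<noteq> {}" "I \<subseteq> {..n}" for I
    using that
  proof (induction I rule: finite_ne_induct)
    case (singleton a) then show ?case using t0[of a] by simp
  next
    case (insert a I)
    then obtain k where k: "k \<in> I" "\<And>i. i \<in> I \<Longrightarrow> t i / t k \<in> A" by auto
    have nz: "t a \<noteq> 0" "t k \<noteq> 0" using insert k t0 by auto
    show ?case
    proof (cases "t a / t k \<in> A")
      case True
      then show ?thesis using k by auto
    next
      case False
      then have ka: "t k / t a \<in> A" using total[of "t a / t k"] by simp
      have "t i / t a \<in> A" if "i \<in> I" for i
        using A_mult[OF k(2)[OF that] ka] nz by simp
      then show ?thesis using nz by (intro bexI[of _ a]) auto
    qed
  qed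
  from this[of "{..n}"] obtain k where k: "k \<le> n" "\<And>i. i \<le> n \<Longrightarrow> t i / t k \<in> A" by auto
  \<comment> \<open>Otherwise dividing by term \<open>k\<close> would turn the sum into 1 plus an
    element of the maximal ideal.\<close>
  have "\<exists>i\<le>n. i \<noteq> k \<and> t i / t k \<in> units"
  proof (rule ccontr)
    assume neg: "\<not> ?thesis"
    have "(\<Sum>j\<le>n. t j / t k) = 0" using root by (simp add: t_def flip: sum_divide_distrib)
    also have "{..n} = insert k ({..n} - {k})" using k by auto
    finally have "1 + (\<Sum>j\<in>{..n} - {k}. t j / t k) = 0" using t0[OF k(1)] by (subst (asm) sum.insert) auto
    moreover have "(\<Sum>j\<in>{..n} - {k}. t j / t k) \<in> maxid" using neg k(2) A_cases by (intro maxid_sum) blast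
    ultimately show False using one_plus_maxid by (auto simp: units_def)
  qed
  then obtain l where l: "l \<le> n" "l \<noteq> k" "t l / t k \<in> units" by blast
  have ex: "\<exists>q. has_val x q" if ij: "i < j" "j \<le> n" "t j / t i \<in> units" for i j
  proof -
    define q where "q = (w i - w j) / real (j - i)"
    have q: "q \<in> \<rat>" using has_val_Rats[OF c] ij by (auto simp: q_def)
    have "t j / t i = c j / c i * x ^ (j - i)" using ij x by (simp add: t_def power_diff)
    then have "x ^ (j - i) = (t j / t i) / (c j / c i)"
      using has_val_nonzero[OF c] ij by simp
    then have hx: "has_val (x ^ (j - i)) (0 - (w j - w i))"
      using ij has_val_divide[OF has_val_unit[OF ij(3)] has_val_divide[OF c[of j] c[of i]]] by simp
    have "0 - (w j - w i) - real (j - i) * q = 0" using ij by (simp add: q_def)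
    then have "has_val (x ^ (j - i) / ppow q ^ (j - i)) 0"
      using has_val_divide[OF hx has_val_power[OF has_val_ppow[OF q], of "j - i"]] by simp
    then have "(x / ppow q) ^ (j - i) \<in> units" using has_val_0 by (simp add: power_divide)
    moreover have "j - i > 0" using ij by simp
    ultimately have "x / ppow q \<in> units" by (rule power_units)
    then show ?thesis using q has_val_def by blast
  qed
  have "\<exists>q. has_val x q"
  proof (cases "l < k")
    case True
    then show ?thesis using ex[of l k] k l units_inverse[OF l(3)] by simp
  next
    case False
    then show ?thesis using ex[of k l] k l by simp
  qed
  then obtain q where q: "has_val x q" by blast
  have tv: "has_val (t j) (w j + real j * q)" if "j \<le> n" for j
    unfolding t_def by (intro has_val_mult c that has_val_power q)
  have le: "w k + real k * q \<le> w j + real j * q" if "j \<le> n" for j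
    using has_val_neg[OF has_val_divide[OF tv[OF that] tv[OF k(1)]]] k(2)[OF that] by fastforce
  have eq: "w l + real l * q = w k + real k * q"
    using has_val_unique[OF has_val_divide[OF tv[OF l(1)] tv[OF k(1)]] has_val_unit[OF l(3)]] by simp
  show ?thesis
  proof (cases "l < k")
    case True
    then show ?thesis using that[OF q True k(1) eq le] by blast
  next
    case False
    then have "k < l" using l by simp
    then show ?thesis using that[OF q _ l(1), of k] eq le by simp
  qed
qed

lemma coeff_prod_small:
  assumes "finite I" "\<And>i. i \<in> I \<Longrightarrow> a i \<in> maxid"
  shows "coeff (\<Prod>i\<in>I. [:1, a i:]) 0 = 1" "j > 0 \<Longrightarrow> coeff (\<Prod>i\<in>I. [:1, a i:]) j \<in> maxid"
proof -
  show 0: "coeff (\<Prod>i\<in>I. [:1, a i:]) 0 = 1" for I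
    by (induction I rule: infinite_finite_induct) (auto simp: coeff_mult_0)
  show "j > 0 \<Longrightarrow> coeff (\<Prod>i\<in>I. [:1, a i:]) j \<in> maxid"
    using assms
  proof (induction I arbitrary: j rule: finite_induct)
    case empty then show ?case by simp
  next
    case (insert x F)
    obtain j' where j: "j = Suc j'" using insert by (cases j) auto
    have "coeff (\<Prod>i\<in>F. [:1, a i:]) j' \<in> A"
      using 0[of F] insert.IH[of j'] insert.prems maxid_A by (cases "j' = 0") auto
    then have "coeff (\<Prod>i\<in>F. [:1, a i:]) j' * a x \<in> maxid" using insert by (intro maxid_mult) auto
    then show ?case using insert j by (simp add: mult.commute maxid_add)
  qed
qed

lemma coeff_prod_integral:
  assumes "finite I" "\<And>i. i \<in> I \<Longrightarrow> b i \<in> A"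
  shows "coeff (\<Prod>i\<in>I. [:b i, 1:]) j \<in> A"
  using assms
proof (induction I arbitrary: j rule: finite_induct)
  case (insert x F)
  then show ?case by (cases j) (auto intro!: A_add A_mult)
qed (cases j; simp)

text \<open>Scale \<open>X\<close> by \<open>ppow \<mu>\<close>. A root of valuation below
  \<open>\<mu>\<close> then contributes its negative times a polynomial congruent to 1, and the
  other \<open>r\<close> roots contribute a monic integral polynomial of degree \<open>r\<close>, up
  to a power of \<open>ppow \<mu>\<close>. So coefficient \<open>r\<close> of the original product
  is a unit times the product of the negated roots below \<open>\<mu>\<close>; being rational, it
  has an integral valuation. The family \<open>a\<close> may repeat values, as the roots of a
  resolvent may.\<close>

lemma newton_sum_less:
  assumes fin: "finite I" and val: "\<And>i. i \<in> I \<Longrightarrow> has_val (a i) (q i)"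
    and rat: "\<And>j. coeff (\<Prod>i\<in>I. [:- a i, 1:]) j \<in> \<rat>" and \<mu>: "\<mu> \<in> \<rat>"
  shows "(\<Sum>i\<in>{i\<in>I. q i < \<mu>}. q i) \<in> \<int>"
proof -
  define I1 where "I1 = {i\<in>I. q i < \<mu>}"
  define I2 where "I2 = {i\<in>I. \<not> q i < \<mu>}"
  define r where "r = card I2"
  have fins: "finite I1" "finite I2" using fin by (auto simp: I1_def I2_def)
  define g where "g = (\<Prod>i\<in>I. [:- a i, 1:])"
  define h1 where "h1 = (\<Prod>i\<in>I1. [:1, - (ppow \<mu> / a i):])"
  define h2 where "h2 = (\<Prod>i\<in>I2. [:- (a i / ppow \<mu>), 1:])"
  have nz: "a i \<noteq> 0" if "i \<in> I" for i using has_val_nonzero[OF val[OF that]] .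
  have pc: "pcompose (prod f J) v = (\<Prod>i\<in>J. pcompose (f i) v)" for f :: "'b \<Rightarrow> complex poly" and J v
    by (induction J rule: infinite_finite_induct) (auto simp: pcompose_mult pcompose_1)
  have pconst: "(\<Prod>i\<in>J. [:f i:]) = [:\<Prod>i\<in>J. f i:]" for f :: "'b \<Rightarrow> complex" and J
    by (induction J rule: infinite_finite_induct) (auto simp: one_pCons)
  have "pcompose g [:0, ppow \<mu>:] = (\<Prod>i\<in>I. [:- a i, ppow \<mu>:])"
    unfolding g_def pc by (intro prod.cong) (auto simp: pcompose_pCons)
  also have "I = I1 \<union> I2" by (auto simp: I1_def I2_def)
  also have "(\<Prod>i\<in>I1 \<union> I2. [:- a i, ppow \<mu>:]) = (\<Prod>i\<in>I1. [:- a i, ppow \<mu>:]) * (\<Prod>i\<in>I2. [:- a i, ppow \<mu>:])"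
    using fins by (intro prod.union_disjoint) (auto simp: I1_def I2_def)
  also have "(\<Prod>i\<in>I1. [:- a i, ppow \<mu>:]) = (\<Prod>i\<in>I1. [:- a i:] * [:1, - (ppow \<mu> / a i):])"
    using nz by (intro prod.cong) (auto simp: I1_def)
  also have "\<dots> = [:\<Prod>i\<in>I1. - a i:] * h1"
    by (simp only: prod.distrib h1_def pconst)
  also have "(\<Prod>i\<in>I2. [:- a i, ppow \<mu>:]) = (\<Prod>i\<in>I2. [:ppow \<mu>:] * [:- (a i / ppow \<mu>), 1:])"
    by (intro prod.cong) auto
  also have "\<dots> = [:ppow \<mu> ^ r:] * h2"
    by (simp only: prod.distrib prod_constant h2_def r_def poly_const_pow)
  finally have "coeff (pcompose g [:0, ppow \<mu>:]) r = (\<Prod>i\<in>I1. - a i) * ppow \<mu> ^ r * coeff (h1 * h2) r"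
    by (simp add: algebra_simps)
  moreover have "coeff (pcompose g [:0, ppow \<mu>:]) r = coeff g r * ppow \<mu> ^ r"
    by (simp add: coeff_pcompose_linear)
  ultimately have c: "coeff g r = (\<Prod>i\<in>I1. - a i) * coeff (h1 * h2) r" by simp
  have "coeff (h1 * h2) r \<in> units"
  proof -
    have m: "- (ppow \<mu> / a i) \<in> maxid" if "i \<in> I1" for i
      using that by (intro maxid_minus has_val_pos[of _ "\<mu> - q i"] has_val_divide has_val_ppow \<mu> val) (auto simp: I1_def)
    have n: "- (a i / ppow \<mu>) \<in> A" if "i \<in> I2" for i
      using that by (intro A_minus has_val_nonneg[of _ "q i - \<mu>"] has_val_divide has_val_ppow \<mu> val) (auto simp: I2_def)
    have "degree h2 = r" "coeff h2 r = 1"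
    proof -
      have 1: "degree h2 = r" unfolding h2_def r_def by (subst degree_prod_eq_sum_degree) auto
      have "lead_coeff h2 = 1" unfolding h2_def by (simp add: lead_coeff_prod)
      then show "degree h2 = r" "coeff h2 r = 1" using 1 by auto
    qed
    have "coeff (h1 * h2) r = (\<Sum>j\<le>r. coeff h1 j * coeff h2 (r - j))" by (rule coeff_mult)
    also have "{..r} = insert 0 {1..r}" by auto
    also have "(\<Sum>j\<in>\<dots>. coeff h1 j * coeff h2 (r - j)) = 1 + (\<Sum>j\<in>{1..r}. coeff h1 j * coeff h2 (r - j))"
      using coeff_prod_small(1)[OF fins(1) m] \<open>coeff h2 r = 1\<close> by (subst sum.insert) (auto simp: h1_def)
    also have "\<dots> \<in> units"
    proof (intro one_plus_maxid maxid_sum)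
      fix j assume "j \<in> {1..r}"
      then have "coeff h2 (r - j) * coeff h1 j \<in> maxid"
        unfolding h1_def h2_def
        by (intro maxid_mult coeff_prod_small(2) coeff_prod_integral fins m n) auto
      then show "coeff h1 j * coeff h2 (r - j) \<in> maxid" by (simp add: mult.commute)
    qed
    finally show ?thesis .
  qed
  then have "has_val (coeff g r) (sum q I1 + 0)" unfolding c
    by (intro has_val_mult has_val_prod has_val_minus val has_val_unit) (auto simp: I1_def)
  then have "sum q I1 \<in> \<int>" using has_val_Rats_Ints'[OF rat[folded g_def]] by simp
  then show ?thesis by (simp add: I1_def)
qed

text \<open>The difference of two sums from \<open>newton_sum_less\<close>, for \<open>\<mu>\<close>
  and for a threshold just above it.\<close>

lemma newton_count:
  assumes fin: "finite I" and val: "\<And>i. i \<in> I \<Longrightarrow> has_val (a i) (q i)"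
    and rat: "\<And>j. coeff (\<Prod>i\<in>I. [:- a i, 1:]) j \<in> \<rat>" and \<mu>: "\<mu> \<in> \<rat>"
  shows "real (card {i\<in>I. q i = \<mu>}) * \<mu> \<in> \<int>"
proof -
  \<comment> \<open>The next larger valuation that occurs; if there is none, any rational number
    above \<open>\<mu>\<close> would serve.\<close>
  define \<mu>' where "\<mu>' = (if {i\<in>I. q i > \<mu>} = {} then \<mu> + 1 else Min (q ` {i\<in>I. q i > \<mu>}))"
  have fin': "finite (q ` {i\<in>I. q i > \<mu>})" using fin by simp
  have *: "\<mu> < \<mu>' \<and> \<mu>' \<in> \<rat> \<and> (\<forall>i\<in>I. q i > \<mu> \<longrightarrow> \<mu>' \<le> q i)"
  proof (cases "{i\<in>I. q i > \<mu>} = {}")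
    case True
    then show ?thesis using \<mu> by (auto simp: \<mu>'_def)
  next
    case False
    then have "\<mu>' \<in> q ` {i\<in>I. q i > \<mu>}" unfolding \<mu>'_def using Min_in[OF fin'] by auto
    moreover have "\<forall>i\<in>I. q i > \<mu> \<longrightarrow> \<mu>' \<le> q i" unfolding \<mu>'_def using False Min_le[OF fin'] by auto
    ultimately show ?thesis using has_val_Rats[OF val] by auto
  qed
  have set: "{i\<in>I. q i < \<mu>'} = {i\<in>I. q i < \<mu>} \<union> {i\<in>I. q i = \<mu>}" using * by force
  have "(\<Sum>i\<in>{i\<in>I. q i < \<mu>'}. q i) = (\<Sum>i\<in>{i\<in>I. q i < \<mu>}. q i) + (\<Sum>i\<in>{i\<in>I. q i = \<mu>}. q i)"
    unfolding set using fin by (intro sum.union_disjoint) auto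
  also have "(\<Sum>i\<in>{i\<in>I. q i = \<mu>}. q i) = real (card {i\<in>I. q i = \<mu>}) * \<mu>" by simp
  finally have "real (card {i\<in>I. q i = \<mu>}) * \<mu> = (\<Sum>i\<in>{i\<in>I. q i < \<mu>'}. q i) - (\<Sum>i\<in>{i\<in>I. q i < \<mu>}. q i)"
    by simp
  also have "\<dots> \<in> \<int>"
  proof -
    have "\<mu>' \<in> \<rat>" using * by simp
    then show ?thesis by (intro Ints_diff newton_sum_less[OF fin val rat] \<mu>)
  qed
  finally show ?thesis .
qed

end

lemma ex_valuation_ring_locale: "prime p \<Longrightarrow> \<exists>A. valuation_ring p A"
  using ex_valuation_ring[of p] by (auto simp: valuation_ring_def)

subsection \<open>Evaluating rational polynomials at complex numbers\<close>

definition rpoly :: "rat poly \<Rightarrow> complex \<Rightarrow> complex" where "rpoly q z = poly (map_poly of_rat q) z"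

lemma map_poly_of_rat_eq_0_iff [simp]: "map_poly (of_rat :: rat \<Rightarrow> complex) q = 0 \<longleftrightarrow> q = 0"
  using map_poly_degree_eq[of "of_rat :: rat \<Rightarrow> complex" q] by (cases "q = 0") (auto simp: poly_eq_iff coeff_map_poly)
lemma degree_map_poly_of_rat [simp]: "degree (map_poly (of_rat :: rat \<Rightarrow> complex) q) = degree q"
  by (cases "q = 0") (auto intro: map_poly_degree_eq)

lemma rpoly_altdef: "degree q \<le> n \<Longrightarrow> rpoly q z = (\<Sum>i\<le>n. of_rat (coeff q i) * z ^ i)"
  unfolding rpoly_def poly_altdef
  by (rule sum.mono_neutral_cong_left) (auto simp: coeff_map_poly coeff_eq_0 intro: le_degree)

lemma complex_roots_altdef: "complex_roots f = {z. rpoly f z = 0}"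
  by (simp add: complex_roots_def rpoly_def)

lemma rpoly_pCons [simp]: "rpoly (pCons a q) z = of_rat a + z * rpoly q z"
  by (simp add: rpoly_def map_poly_pCons)
lemma rpoly_0 [simp]: "rpoly 0 z = 0" by (simp add: rpoly_def)
lemma rpoly_1 [simp]: "rpoly 1 z = 1" by (simp add: rpoly_def)
lemma rpoly_add [simp]: "rpoly (q + r) z = rpoly q z + rpoly r z"
  by (induction q r rule: poly_induct2) (auto simp: of_rat_add algebra_simps)
lemma rpoly_smult [simp]: "rpoly (Polynomial.smult c q) z = of_rat c * rpoly q z"
  by (induction q) (auto simp: of_rat_mult algebra_simps)
lemma rpoly_minus [simp]: "rpoly (- q) z = - rpoly q z"
  using rpoly_smult[of "- 1" q z] by simp
lemma rpoly_diff [simp]: "rpoly (q - r) z = rpoly q z - rpoly r z"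
  using rpoly_add[of q "- r" z] by simp
lemma rpoly_mult [simp]: "rpoly (q * r) z = rpoly q z * rpoly r z"
  by (induction q) (auto simp: algebra_simps)
lemma rpoly_pcompose [simp]: "rpoly (pcompose q r) z = rpoly q (rpoly r z)"
  by (induction q) (auto simp: pcompose_pCons algebra_simps)
lemma rpoly_sum [simp]: "rpoly (sum f I) z = (\<Sum>i\<in>I. rpoly (f i) z)"
  by (induction I rule: infinite_finite_induct) auto
lemma rpoly_dvd: "q dvd r \<Longrightarrow> rpoly q z = 0 \<Longrightarrow> rpoly r z = 0" by (auto elim!: dvdE)

lemma pderiv_map_poly_of_rat: "pderiv (map_poly (of_rat :: rat \<Rightarrow> complex) q) = map_poly of_rat (pderiv q)"
  by (rule poly_eqI) (simp add: coeff_pderiv coeff_map_poly of_rat_mult of_rat_add)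

lemma irreducible_bezout:
  fixes m q :: "rat poly"
  assumes "irreducible m" "\<not> m dvd q"
  obtains u v where "u * m + v * q = 1"
proof -
  have "prime_elem m" using assms(1) by (rule irreducible_imp_prime_elem_gcd)
  then have "coprime m q" using assms(2) by (rule prime_elem_imp_coprime)
  then have "fst (bezout_coefficients m q) * m + snd (bezout_coefficients m q) * q = 1"
    using bezout_coefficients_fst_snd[of m q] by simp
  then show ?thesis by (rule that)
qed

lemma irreducible_dvd_iff_root:
  fixes m :: "rat poly"
  assumes m: "irreducible m" and t: "rpoly m t = 0"
  shows "m dvd q \<longleftrightarrow> rpoly q t = 0"
proof
  assume q: "rpoly q t = 0"
  show "m dvd q"
  proof (rule ccontr)
    assume "\<not> m dvd q"
    then obtain u v where "u * m + v * q = 1" using m irreducible_bezout by blast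
    then have "rpoly (u * m + v * q) t = 1" by simp
    then show False using t q by simp
  qed
qed (use t rpoly_dvd in blast)

lemma ex_minimal_poly:
  assumes "q \<noteq> 0" "rpoly q t = 0"
  shows "\<exists>m. irreducible m \<and> rpoly m t = 0"
  using assms
proof (induction "degree q" arbitrary: q rule: less_induct)
  case less
  show ?case
  proof (cases "irreducible q")
    case False
    have nu: "\<not> is_unit q"
    proof
      assume "is_unit q"
      then obtain c where c: "q = [:c:]" by (auto simp: is_unit_poly_iff)
      then have "c \<noteq> 0" using less(2) by auto
      then show False using less(3) c by simp
    qed
    then obtain a b where ab: "q = a * b" "\<not> is_unit a" "\<not> is_unit b"
      using False less(2) unfolding irreducible_def by blast
    have nz: "a \<noteq> 0" "b \<noteq> 0" using ab less by auto
    have dp: "degree a > 0" "degree b > 0" using ab nz is_unit_iff_degree by auto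
    have "degree q = degree a + degree b" using ab nz by (simp add: degree_mult_eq)
    then have "degree a < degree q" "degree b < degree q" using dp by auto
    moreover have "rpoly a t = 0 \<or> rpoly b t = 0" using less(3) ab by simp
    ultimately show ?thesis using less(1) nz by blast
  qed (use less in blast)
qed

lemma irreducible_rsquarefree:
  assumes "irreducible (m :: rat poly)"
  shows "rsquarefree (map_poly (of_rat :: rat \<Rightarrow> complex) m)"
  unfolding rsquarefree_roots
proof (intro allI notI)
  fix a :: complex assume a: "poly (map_poly of_rat m) a = 0 \<and> poly (pderiv (map_poly of_rat m)) a = 0"
  then have "m dvd pderiv m"
    using irreducible_dvd_iff_root[OF assms, of a "pderiv m"] by (simp add: rpoly_def pderiv_map_poly_of_rat)
  moreover have deg: "degree m > 0"
    using assms is_unit_iff_degree[of m] by (auto simp: irreducible_def)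
  ultimately have "degree m \<le> degree (pderiv m)"
    by (intro dvd_imp_degree_le) (auto simp: pderiv_eq_0_iff)
  then show False using deg by (simp add: degree_pderiv)
qed

lemma irreducible_card_roots:
  assumes "irreducible (m :: rat poly)"
  shows "finite (complex_roots m)" and "card (complex_roots m) = degree m"
    and "map_poly of_rat m = Polynomial.smult (of_rat (lead_coeff m)) (\<Prod>z\<in>complex_roots m. [:- z, 1:])"
proof -
  let ?m = "map_poly of_rat m :: complex poly"
  have m0: "?m \<noteq> 0" using assms by auto
  show fin: "finite (complex_roots m)" using poly_roots_finite[OF m0] by (simp add: complex_roots_def)
  show eq: "?m = Polynomial.smult (of_rat (lead_coeff m)) (\<Prod>z\<in>complex_roots m. [:- z, 1:])"
    using complex_poly_decompose_rsquarefree[OF irreducible_rsquarefree[OF assms]]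
    by (simp add: complex_roots_def coeff_map_poly)
  have "degree m = degree ?m" by simp
  also have "\<dots> = card (complex_roots m)"
    by (subst eq) (use assms fin in \<open>auto simp: degree_prod_eq_sum_degree\<close>)
  finally show "card (complex_roots m) = degree m" by simp
qed

subsection \<open>Primitive elements\<close>

definition alg :: "complex \<Rightarrow> bool" where "alg x \<longleftrightarrow> (\<exists>q. q \<noteq> 0 \<and> rpoly q x = 0)"

text \<open>The ring generated by \<open>t\<close> over the rationals; for algebraic
  \<open>t\<close> it is a field, by \<open>Qadj_inverse\<close>.\<close>

definition Qadj :: "complex \<Rightarrow> complex set" where "Qadj t = range (\<lambda>q. rpoly q t)"

lemma Qadj_closed:
  shows "of_rat c \<in> Qadj t" "t \<in> Qadj t" "x \<in> Qadj t \<Longrightarrow> y \<in> Qadj t \<Longrightarrow> x + y \<in> Qadj t"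
    "x \<in> Qadj t \<Longrightarrow> y \<in> Qadj t \<Longrightarrow> x * y \<in> Qadj t" "x \<in> Qadj t \<Longrightarrow> - x \<in> Qadj t"
    "x \<in> Qadj t \<Longrightarrow> y \<in> Qadj t \<Longrightarrow> x - y \<in> Qadj t"
proof -
  show "of_rat c \<in> Qadj t" unfolding Qadj_def by (rule range_eqI[of _ _ "[:c:]"]) simp
  show "t \<in> Qadj t" unfolding Qadj_def by (rule range_eqI[of _ _ "[:0, 1:]"]) simp
  show "x + y \<in> Qadj t" "x * y \<in> Qadj t" "x - y \<in> Qadj t" if "x \<in> Qadj t" "y \<in> Qadj t"
    using that unfolding Qadj_def by (auto simp flip: rpoly_add rpoly_mult rpoly_diff)
  show "- x \<in> Qadj t" if "x \<in> Qadj t"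
    using that unfolding Qadj_def by (auto simp flip: rpoly_minus)
qed

lemma Qadj_0 [simp]: "0 \<in> Qadj t" and Qadj_1 [simp]: "1 \<in> Qadj t"
  using Qadj_closed(1)[of 0 t] Qadj_closed(1)[of 1 t] by simp_all

lemma Qadj_sum: "(\<And>i. i \<in> I \<Longrightarrow> f i \<in> Qadj t) \<Longrightarrow> sum f I \<in> Qadj t"
  by (induction I rule: infinite_finite_induct) (auto simp: Qadj_closed)
lemma Qadj_prod: "(\<And>i. i \<in> I \<Longrightarrow> f i \<in> Qadj t) \<Longrightarrow> prod f I \<in> Qadj t"
  by (induction I rule: infinite_finite_induct) (auto simp: Qadj_closed)

lemma Qadj_mono: "t \<in> Qadj s \<Longrightarrow> Qadj t \<subseteq> Qadj s"
  by (auto simp: Qadj_def simp flip: rpoly_pcompose)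

lemma Qadj_inverse:
  assumes t: "alg t" and x: "x \<in> Qadj t" "x \<noteq> 0"
  shows "inverse x \<in> Qadj t"
proof -
  obtain m where m: "irreducible m" "rpoly m t = 0" using t ex_minimal_poly by (auto simp: alg_def)
  obtain q where q: "x = rpoly q t" using x by (auto simp: Qadj_def)
  have "\<not> m dvd q" using irreducible_dvd_iff_root[OF m] q x(2) by auto
  then obtain u v where "u * m + v * q = 1" using m(1) irreducible_bezout by blast
  then have "rpoly (u * m + v * q) t = 1" by simp
  then have "rpoly v t * x = 1" using m q by simp
  then have "inverse x = rpoly v t" by (metis inverse_unique mult.commute)
  then show ?thesis by (simp add: Qadj_def)
qed

interpretation rat_vs: vector_space "\<lambda>(c::rat) (z::complex). of_rat c * z"
  by standard (auto simp: algebra_simps of_rat_add of_rat_mult)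

text \<open>More powers of \<open>t\<close> than the span allows are linearly dependent. Coinciding
  powers need a separate argument, since a set does not record repetitions; then \<open>t\<close> is
  a root of a difference of monomials.\<close>

lemma alg_if_powers_in_finite_span:
  assumes "finite B" "\<And>k. t ^ k \<in> rat_vs.span B"
  shows "alg t"
proof -
  define N where "N = card B"
  show ?thesis
  proof (cases "inj_on (\<lambda>k. t ^ k) {..N}")
    case False
    then obtain i j where ij: "i < j" "t ^ i = t ^ j" unfolding inj_on_def by (metis linorder_neqE_nat)
    have rm: "rpoly (monom 1 k) t = t ^ k" for k by (simp add: rpoly_def map_poly_monom poly_monom)
    have "rpoly (monom 1 i - monom 1 j) t = 0" using ij by (simp add: rm)
    moreover have "coeff (monom 1 i - monom (1::rat) j) i \<noteq> 0" using ij by simp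
    then have "monom 1 i - monom (1::rat) j \<noteq> 0" by (metis coeff_0)
    ultimately show ?thesis unfolding alg_def by blast
  next
    case True
    then have c: "card ((\<lambda>k. t ^ k) ` {..N}) = Suc N" by (simp add: card_image)
    then have "\<not> rat_vs.independent ((\<lambda>k. t ^ k) ` {..N})"
      using rat_vs.independent_span_bound[OF assms(1), of "(\<lambda>k. t ^ k) ` {..N}"] assms(2) by (auto simp: N_def)
    then obtain T u where T: "T \<subseteq> (\<lambda>k. t ^ k) ` {..N}" "(\<Sum>v\<in>T. of_rat (u v) * v) = 0" "\<exists>v\<in>T. u v \<noteq> (0::rat)"
      unfolding rat_vs.dependent_explicit by blast
    obtain J where J: "J \<subseteq> {..N}" "T = (\<lambda>k. t ^ k) ` J" using T(1) subset_imageE by metis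
    have injJ: "inj_on (\<lambda>k. t ^ k) J" using True J(1) inj_on_subset by blast
    have finJ: "finite J" using J(1) finite_subset by blast
    define q where "q = (\<Sum>k\<in>J. monom (u (t ^ k)) k)"
    have "rpoly q t = (\<Sum>k\<in>J. of_rat (u (t ^ k)) * t ^ k)"
      by (simp add: q_def) (simp add: rpoly_def map_poly_monom poly_monom)
    also have "\<dots> = 0" using T(2) injJ by (simp add: J(2) sum.reindex)
    finally have "rpoly q t = 0" .
    moreover have "q \<noteq> 0"
    proof
      assume q0: "q = 0"
      obtain k where k: "k \<in> J" "u (t ^ k) \<noteq> 0" using T(3) J(2) by auto
      have "coeff q k = (\<Sum>j\<in>J. if j = k then u (t ^ j) else 0)" by (simp add: q_def coeff_sum)
      also have "\<dots> = u (t ^ k)" using k finJ by simp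
      finally show False using q0 k by simp
    qed
    ultimately show ?thesis by (auto simp: alg_def)
  qed
qed

text \<open>Reduction modulo the minimal polynomials bounds the exponents, so all
  \<open>a ^ i * b ^ j\<close> lie in the span of finitely many of them.\<close>

lemma alg_add_mult:
  assumes a: "alg a" and b: "alg b"
  shows "alg (a + of_nat c * b)"
proof -
  obtain m where m: "irreducible m" "rpoly m a = 0" using a ex_minimal_poly by (auto simp: alg_def)
  obtain g where g: "irreducible g" "rpoly g b = 0" using b ex_minimal_poly by (auto simp: alg_def)
  define B where "B = (\<lambda>(i, j). a ^ i * b ^ j) ` ({..degree m} \<times> {..degree g})"
  have pow: "\<exists>r. degree r \<le> degree m \<and> rpoly r x = x ^ k" if "irreducible m" "rpoly m x = 0" for m :: "rat poly" and x k
  proof -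
    define r where "r = monom 1 k mod m"
    have "rpoly (monom 1 k) x = rpoly (monom 1 k div m * m + r) x" by (simp only: r_def div_mult_mod_eq)
    also have "\<dots> = rpoly r x" using that(2) by (simp only: rpoly_add rpoly_mult) simp
    finally have "rpoly r x = x ^ k" by (simp add: rpoly_def map_poly_monom poly_monom)
    moreover have "degree r \<le> degree m"
      using degree_mod_less[of m "monom 1 k"] that(1) by (auto simp: r_def irreducible_def)
    ultimately show ?thesis by blast
  qed
  have mono: "a ^ i * b ^ j \<in> rat_vs.span B" for i j
  proof -
    obtain r where r: "degree r \<le> degree m" "rpoly r a = a ^ i" using pow[OF m] by blast
    obtain s where s: "degree s \<le> degree g" "rpoly s b = b ^ j" using pow[OF g] by blast
    have "a ^ i * b ^ j = (\<Sum>k\<le>degree m. of_rat (coeff r k) * a ^ k) * (\<Sum>l\<le>degree g. of_rat (coeff s l) * b ^ l)"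
      using rpoly_altdef[OF r(1), of a] rpoly_altdef[OF s(1), of b] r(2) s(2) by simp
    also have "\<dots> = (\<Sum>k\<le>degree m. \<Sum>l\<le>degree g. of_rat (coeff r k * coeff s l) * (a ^ k * b ^ l))"
      by (simp add: sum_product of_rat_mult mult_ac)
    also have "\<dots> \<in> rat_vs.span B"
      by (intro rat_vs.span_sum rat_vs.span_scale rat_vs.span_base) (auto simp: B_def)
    finally show ?thesis .
  qed
  show ?thesis
  proof (rule alg_if_powers_in_finite_span)
    show "finite B" by (simp add: B_def)
    fix k
    have "(a + of_nat c * b) ^ k = (\<Sum>i\<le>k. of_rat (of_nat (k choose i) * of_nat c ^ (k - i)) * (a ^ i * b ^ (k - i)))"
      by (simp add: binomial_ring power_mult_distrib of_rat_mult of_rat_power mult_ac)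
    also have "\<dots> \<in> rat_vs.span B" by (intro rat_vs.span_sum rat_vs.span_scale mono)
    finally show "(a + of_nat c * b) ^ k \<in> rat_vs.span B" .
  qed
qed

text \<open>In the application \<open>F\<close> is a field given as a subset of the complex numbers
  and not as a type, so long division is carried out with membership in \<open>F\<close>; a monic
  divisor keeps all coefficients there.\<close>

lemma division_with_coeffs_in:
  fixes M P :: "complex poly"
  assumes F: "subring_set F" and M: "lead_coeff M = 1" "\<forall>i. coeff M i \<in> F" and P: "\<forall>i. coeff P i \<in> F"
  shows "\<exists>Q R. P = Q * M + R \<and> (\<forall>i. coeff R i \<in> F) \<and> (R = 0 \<or> degree R < degree M)"
  using P
proof (induction "degree P" arbitrary: P rule: less_induct)
  case less
  have F0: "0 \<in> F" using F unfolding subring_set_def by (metis diff_self)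
  show ?case
  proof (cases "P = 0 \<or> degree P < degree M")
    case True
    then show ?thesis using less(2) by (intro exI[of _ 0] exI[of _ P]) auto
  next
    case False
    define N where "N = monom (lead_coeff P) (degree P - degree M)"
    define P' where "P' = P - N * M"
    have coeffNM: "coeff (N * M) i = (if i < degree P - degree M then 0 else lead_coeff P * coeff M (i - (degree P - degree M)))" for i
      by (simp add: N_def coeff_monom_mult)
    have "\<forall>i. coeff P' i \<in> F"
      using less(2) M(2) F F0 unfolding P'_def coeff_diff coeffNM by (auto simp: subring_set_def)
    moreover have "P' = 0 \<or> degree P' < degree P"
    proof (cases "degree P = 0")
      case True
      then have "degree M = 0" using False by simp
      then have "coeff P' i = 0" for i
        using True M(1) unfolding P'_def coeff_diff coeffNM by (cases i) (auto simp: coeff_eq_0)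
      then show ?thesis by (simp add: poly_eq_iff)
    next
      case dP: False
      have "coeff P' i = 0" if "i \<ge> degree P" for i
      proof (cases "i = degree P")
        case True
        then show ?thesis using False M(1) unfolding P'_def coeff_diff coeffNM by simp
      next
        case nd: False
        then have "coeff P i = 0" "coeff M (i - (degree P - degree M)) = 0"
          using that False by (auto intro!: coeff_eq_0)
        then show ?thesis unfolding P'_def coeff_diff coeffNM by simp
      qed
      then have "degree P' < degree P" using dP by (intro degree_lessI) auto
      then show ?thesis by blast
    qed
    ultimately have "\<exists>Q R. P' = Q * M + R \<and> (\<forall>i. coeff R i \<in> F) \<and> (R = 0 \<or> degree R < degree M)"
      using less(1)[of P'] F0 by (cases "P' = 0") (auto intro!: exI[of _ 0])
    then obtain Q R where QR: "P' = Q * M + R" "\<forall>i. coeff R i \<in> F" "R = 0 \<or> degree R < degree M" by blast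
    have "P = (Q + N) * M + R" using QR(1) by (simp add: P'_def algebra_simps)
    then show ?thesis using QR(2,3) by blast
  qed
qed

lemma subring_set_Qadj: "subring_set (Qadj t)"
  by (simp add: subring_set_def Qadj_closed)

text \<open>
  For all but finitely many \<open>c\<close> the minimal polynomial of \<open>b\<close> over \<open>\<rat>(a + c b)\<close> is linear: it divides the
  minimal polynomial \<open>g\<close> of \<open>b\<close> as well as \<open>m (a + c b - c X)\<close>, and these have only the root \<open>b\<close> in common.
\<close>

lemma primitive_element_two:
  assumes a: "alg a" and b: "alg b"
  shows "\<exists>c::nat. alg (a + of_nat c * b) \<and> a \<in> Qadj (a + of_nat c * b) \<and> b \<in> Qadj (a + of_nat c * b)"
proof -
  obtain m where m: "irreducible m" "rpoly m a = 0" using a ex_minimal_poly by (auto simp: alg_def)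
  obtain g where g: "irreducible g" "rpoly g b = 0" using b ex_minimal_poly by (auto simp: alg_def)
  \<comment> \<open>The values \<open>c\<close> for which \<open>a + c b\<close> equals
    \<open>a' + c b'\<close> for another pair of conjugates; pairs with \<open>b' = b\<close>
    contribute only 0, because division by zero gives 0.\<close>
  define bad where "bad = (\<lambda>(a', b'). (a' - a) / (b - b')) ` (complex_roots m \<times> complex_roots g)"
  have "finite bad" unfolding bad_def
    using irreducible_card_roots(1)[OF m(1)] irreducible_card_roots(1)[OF g(1)] by simp
  then have "finite (of_nat -` bad :: nat set)" by (rule finite_vimageI) (simp add: inj_def)
  then obtain c :: nat where "c \<notin> of_nat -` bad" using infinite_UNIV_nat ex_new_if_finite by blast
  then have c: "of_nat c \<notin> bad" by simp
  define t where "t = a + of_nat c * b"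
  have sep: "b' = b" if "rpoly g b' = 0" "rpoly m (t - of_nat c * b') = 0" for b'
  proof (rule ccontr)
    assume "b' \<noteq> b"
    then have "of_nat c = ((t - of_nat c * b') - a) / (b - b')" by (simp add: t_def field_simps)
    then have "of_nat c \<in> bad" using that unfolding bad_def complex_roots_altdef by force
    then show False using c by blast
  qed
  define F where "F = Qadj t"
  have algt: "alg t" unfolding t_def by (rule alg_add_mult[OF a b])
  have sF: "subring_set F" unfolding F_def by (rule subring_set_Qadj)
  have ratF: "of_rat x \<in> F" for x by (simp add: F_def Qadj_closed)
  have natF: "of_nat k \<in> F" for k using ratF[of "of_nat k"] by simp
  define G where "G = map_poly (of_rat :: rat \<Rightarrow> complex) g"
  define H where "H = pcompose (map_poly of_rat m) [:t, - of_nat c:]"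
  have GF: "\<forall>i. coeff G i \<in> F" by (simp add: G_def coeff_map_poly ratF)
  have mulF: "\<forall>i. coeff (P * Q) i \<in> F" if "\<forall>i. coeff P i \<in> F" "\<forall>i. coeff Q i \<in> F" for P Q
    using that by (auto simp: coeff_mult F_def intro!: Qadj_sum Qadj_closed)
  have HF: "\<forall>i. coeff H i \<in> F"
    unfolding H_def
  proof (induction m)
    case 0 then show ?case by (simp add: F_def)
  next
    case (pCons x m)
    have "\<forall>i. coeff [:t, - of_nat c:] i \<in> F"
      using natF by (auto simp: coeff_pCons F_def Qadj_closed split: nat.splits)
    then have "\<forall>i. coeff ([:t, - of_nat c:] * pcompose (map_poly of_rat m) [:t, - of_nat c:]) i \<in> F"
      by (rule mulF) (rule pCons)
    moreover have "coeff [:of_rat x:] i \<in> F" for i using ratF by (cases i) (auto simp: F_def)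
    ultimately show ?case using pCons(1,2) sF
      by (auto simp: map_poly_pCons pcompose_pCons subring_set_def simp del: mult_pCons_left)
  qed
  define S where "S P \<longleftrightarrow> P \<noteq> 0 \<and> (\<forall>i. coeff P i \<in> F) \<and> poly P b = 0" for P
  have "S G" using GF g by (auto simp: S_def G_def rpoly_def)
  then obtain M0 where M0: "S M0" "\<And>P. S P \<Longrightarrow> degree M0 \<le> degree P"
    using ex_has_least_nat[of S G degree] by blast
  \<comment> \<open>\<open>M\<close> is the minimal polynomial of \<open>b\<close> over
    \<open>F\<close>.\<close>
  define M where "M = Polynomial.smult (inverse (lead_coeff M0)) M0"
  have M0nz: "M0 \<noteq> 0" using M0 by (simp add: S_def)
  have Mprop: "lead_coeff M = 1" "\<forall>i. coeff M i \<in> F" "poly M b = 0" "degree M = degree M0"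
    using M0 Qadj_inverse[OF algt, of "lead_coeff M0"]
    by (auto simp: M_def S_def F_def Qadj_closed)
  have dvd: "M dvd P" if P: "\<forall>i. coeff P i \<in> F" "poly P b = 0" for P
  proof -
    obtain Q R where QR: "P = Q * M + R" "\<forall>i. coeff R i \<in> F" "R = 0 \<or> degree R < degree M"
      using division_with_coeffs_in[OF sF Mprop(1,2) P(1)] by blast
    have "poly R b = 0" using QR(1) P(2) Mprop(3) by simp
    have "R = 0"
    proof (rule ccontr)
      assume "R \<noteq> 0"
      then have "S R" using QR(2) \<open>poly R b = 0\<close> by (simp add: S_def)
      then show False using M0(2)[of R] QR(3) \<open>R \<noteq> 0\<close> Mprop(4) by simp
    qed
    then show ?thesis using QR(1) by simp
  qed
  have "M dvd G" using dvd GF g(2) by (simp add: G_def rpoly_def)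
  moreover have "M dvd H"
  proof (rule dvd[OF HF])
    have "t - of_nat c * b = a" by (simp add: t_def)
    then show "poly H b = 0" using m(2) by (simp add: H_def poly_pcompose rpoly_def algebra_simps)
  qed
  ultimately have rootM: "z = b" if "poly M z = 0" for z
  proof (intro sep)
    show "rpoly g z = 0" using \<open>M dvd G\<close> that by (auto simp: G_def rpoly_def elim!: dvdE)
    have "poly H z = 0" using \<open>M dvd H\<close> that by (auto elim!: dvdE)
    then show "rpoly m (t - of_nat c * z) = 0" by (simp add: H_def poly_pcompose rpoly_def algebra_simps)
  qed
  \<comment> \<open>A squarefree monic polynomial whose only root is \<open>b\<close> is
    \<open>X - b\<close>, and its constant coefficient lies in \<open>F\<close>.\<close>
  have "rsquarefree M"
  proof -
    have "rsquarefree G" unfolding G_def by (rule irreducible_rsquarefree[OF g(1)])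
    moreover obtain K where "G = M * K" using \<open>M dvd G\<close> by (auto elim: dvdE)
    ultimately show ?thesis unfolding rsquarefree_roots by (auto simp: pderiv_mult)
  qed
  then have "M = (\<Prod>z\<in>{z. poly M z = 0}. [:- z, 1:])"
    using complex_poly_decompose_rsquarefree[of M] Mprop(1) by simp
  also have "{z. poly M z = 0} = {b}" using rootM Mprop(3) by blast
  finally have "M = [:- b, 1:]" by simp
  then have "- b \<in> F" using Mprop(2)[rule_format, of 0] by simp
  then have bF: "b \<in> F" using Qadj_closed(5)[of "- b" t] by (simp add: F_def)
  have "t - of_nat c * b \<in> F" using bF natF unfolding F_def by (intro Qadj_closed)
  then have "a \<in> F" by (simp add: t_def)
  then show ?thesis using bF algt unfolding F_def t_def by blast
qed

text \<open>The formula for \<open>t\<close> is recorded because it shows that \<open>t\<close> lies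
  in the field generated by \<open>S\<close>, and where an automorphism sends
  \<open>t\<close>.\<close>

lemma primitive_element:
  assumes "finite S" "\<And>s. s \<in> S \<Longrightarrow> alg s"
  shows "\<exists>t c. alg t \<and> S \<subseteq> Qadj t \<and> t = (\<Sum>s\<in>S. of_nat (c s) * s)"
  using assms
proof (induction S rule: finite_induct)
  case empty
  have "alg 0" unfolding alg_def by (rule exI[of _ "[:0, 1:]"]) simp
  then show ?case by auto
next
  case (insert b S)
  then obtain t c where t: "alg t" "S \<subseteq> Qadj t" "t = (\<Sum>s\<in>S. of_nat (c s) * s)" by auto
  obtain d :: nat where d: "alg (t + of_nat d * b)" "t \<in> Qadj (t + of_nat d * b)" "b \<in> Qadj (t + of_nat d * b)"
    using primitive_element_two[OF t(1), of b] insert by blast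
  have "(\<Sum>s\<in>insert b S. of_nat ((c(b := d)) s) * s) = of_nat d * b + (\<Sum>s\<in>S. of_nat ((c(b := d)) s) * s)"
    using insert by simp
  also have "(\<Sum>s\<in>S. of_nat ((c(b := d)) s) * s) = t" unfolding t(3) using insert by (intro sum.cong) auto
  finally have "t + of_nat d * b = (\<Sum>s\<in>insert b S. of_nat ((c(b := d)) s) * s)" by simp
  then show ?case using d t(2) Qadj_mono[OF d(2)] by blast
qed

subsection \<open>The Galois group of an irreducible polynomial\<close>

lemma field_complex_ring: "field complex_ring" by (rule field_from_type_algebra)

lemma complex_ring_simps [simp]:
  "carrier complex_ring = UNIV" "x \<otimes>\<^bsub>complex_ring\<^esub> y = x * y" "x \<oplus>\<^bsub>complex_ring\<^esub> y = x + y"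
  "\<one>\<^bsub>complex_ring\<^esub> = 1" "\<zero>\<^bsub>complex_ring\<^esub> = 0"
  by (simp_all add: ring_of_type_algebra_def)

lemma complex_ring_uminus [simp]: "\<ominus>\<^bsub>complex_ring\<^esub> x = - x"
proof -
  interpret field complex_ring by (rule field_complex_ring)
  show ?thesis by (rule minus_equality) simp_all
qed

lemma complex_ring_inverse: "x \<noteq> 0 \<Longrightarrow> m_inv complex_ring x = inverse x"
proof -
  interpret field complex_ring by (rule field_complex_ring)
  assume "x \<noteq> 0"
  then show ?thesis by (intro comm_inv_char) simp_all
qed

locale primitive_root_field =
  fixes f :: "rat poly" and t :: complex and c :: "complex \<Rightarrow> nat"
  assumes irr: "irreducible f" and alg_t: "alg t" and roots_sub: "complex_roots f \<subseteq> Qadj t"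
    and t_sum: "t = (\<Sum>s\<in>complex_roots f. of_nat (c s) * s)"
begin

abbreviation "K \<equiv> Qadj t"
abbreviation "R \<equiv> complex_roots f"

lemma finR: "finite R" using irreducible_card_roots(1)[OF irr] .

text \<open>\<open>K\<close> is a field containing the roots; conversely the formula for
  \<open>t\<close> puts \<open>t\<close>, hence all of \<open>K\<close>, into the field generated by
  the roots.\<close>

lemma splitting_field_carrier: "carrier (splitting_field f) = K"
proof -
  have "x \<in> K" if "x \<in> generate_field complex_ring (\<rat> \<union> R)" for x
    using that
  proof (induction rule: generate_field.induct)
    case (incl h)
    then show ?case using roots_sub by (auto simp: Qadj_closed elim!: Rats_cases)
  next
    case (m_inv h)
    then show ?case using Qadj_inverse[OF alg_t] complex_ring_inverse[of h] by simp
  qed (auto simp: Qadj_closed)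
  moreover have "x \<in> generate_field complex_ring (\<rat> \<union> R)" if x: "x \<in> K" for x
  proof -
    let ?L = "generate_field complex_ring (\<rat> \<union> R)"
    have add: "x + y \<in> ?L" if "x \<in> ?L" "y \<in> ?L" for x y
      using generate_field.eng_add[OF that] by simp
    have mult: "x * y \<in> ?L" if "x \<in> ?L" "y \<in> ?L" for x y
      using generate_field.eng_mult[OF that] by simp
    have rat: "of_rat q \<in> ?L" for q by (rule generate_field.incl) simp
    have "(\<Sum>s\<in>I. of_nat (c s) * s) \<in> ?L" if "I \<subseteq> R" for I
      using finite_subset[OF that finR] that
    proof (induction I rule: finite_induct)
      case empty
      then show ?case using rat[of 0] by simp
    next
      case (insert s I)
      have "of_nat (c s) * s \<in> ?L" using insert rat[of "of_nat (c s)"]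
        by (intro mult generate_field.incl) auto
      then show ?case using insert by (simp add: add)
    qed
    then have t: "t \<in> ?L" using t_sum by simp
    obtain q where "x = rpoly q t" using x by (auto simp: Qadj_def)
    moreover have "rpoly q t \<in> ?L"
    proof (induction q)
      case 0 then show ?case using rat[of 0] by simp
    next
      case (pCons a q) then show ?case by (simp add: add mult rat t)
    qed
    ultimately show ?thesis by simp
  qed
  ultimately show ?thesis unfolding splitting_field_def by auto
qed

lemma field_automorphisms_iff:
  "\<sigma> \<in> field_automorphisms f \<longleftrightarrow> bij_betw \<sigma> K K \<and> (\<forall>x\<in>K. \<forall>y\<in>K. \<sigma> (x + y) = \<sigma> x + \<sigma> y)
     \<and> (\<forall>x\<in>K. \<forall>y\<in>K. \<sigma> (x * y) = \<sigma> x * \<sigma> y) \<and> (\<forall>q. \<sigma> (of_rat q) = of_rat q)"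
proof -
  have ops: "x \<otimes>\<^bsub>splitting_field f\<^esub> y = x * y" "x \<oplus>\<^bsub>splitting_field f\<^esub> y = x + y" "\<one>\<^bsub>splitting_field f\<^esub> = 1" for x y
    by (simp_all add: splitting_field_def)
  have one: "\<sigma> 1 = 1" if "\<forall>q. \<sigma> (of_rat q) = of_rat q"
    using that[rule_format, of 1] by simp
  show ?thesis
    unfolding field_automorphisms_def ring_iso_def ring_hom_def mem_Collect_eq splitting_field_carrier ops
    by (auto simp: Pi_iff bij_betw_def Rats_def intro: one)
qed

lemma automorphism_0_1:
  assumes "\<sigma> \<in> field_automorphisms f"
  shows "\<sigma> 0 = 0" "\<sigma> 1 = 1"
proof -
  have "\<forall>q. \<sigma> (of_rat q) = of_rat q" using assms field_automorphisms_iff by blast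
  from this[rule_format, of 0] this[rule_format, of 1] show "\<sigma> 0 = 0" "\<sigma> 1 = 1" by simp_all
qed

lemma automorphism_rpoly:
  assumes \<sigma>: "\<sigma> \<in> field_automorphisms f" and x: "x \<in> K"
  shows "\<sigma> (rpoly q x) = rpoly q (\<sigma> x)"
proof (induction q)
  case 0
  then show ?case using automorphism_0_1[OF \<sigma>] by simp
next
  case (pCons a q)
  have "rpoly q x \<in> K" using Qadj_mono[OF x] by (auto simp: Qadj_def)
  then have "\<sigma> (of_rat a + x * rpoly q x) = \<sigma> (of_rat a) + \<sigma> x * \<sigma> (rpoly q x)"
    using \<sigma> x Qadj_closed unfolding field_automorphisms_iff by auto
  then show ?case using \<sigma> pCons by (simp add: field_automorphisms_iff)
qed

lemma automorphism_root: "\<sigma> \<in> field_automorphisms f \<Longrightarrow> z \<in> R \<Longrightarrow> \<sigma> z \<in> R"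
  using automorphism_rpoly[of \<sigma> z f] roots_sub automorphism_0_1(1)[of \<sigma>]
  unfolding complex_roots_altdef by auto

lemma automorphism_in: "\<sigma> \<in> field_automorphisms f \<Longrightarrow> x \<in> K \<Longrightarrow> \<sigma> x \<in> K"
  by (auto simp: field_automorphisms_iff bij_betw_def)

definition restr :: "(complex \<Rightarrow> complex) \<Rightarrow> complex \<Rightarrow> complex" where
  "restr \<sigma> = (\<lambda>z. if z \<in> R then \<sigma> z else z)"

lemma galois_perms_altdef: "galois_perms f = restr ` field_automorphisms f"
  by (auto simp: galois_perms_def restr_def)

lemma restr_permutes: "\<sigma> \<in> field_automorphisms f \<Longrightarrow> restr \<sigma> permutes R"
proof (rule bij_imp_permutes)
  assume \<sigma>: "\<sigma> \<in> field_automorphisms f"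
  have "inj_on \<sigma> R" using \<sigma> roots_sub unfolding field_automorphisms_iff bij_betw_def by (metis inj_on_subset)
  then have inj: "inj_on (restr \<sigma>) R" by (simp add: restr_def inj_on_def)
  moreover have "restr \<sigma> ` R \<subseteq> R" using automorphism_root[OF \<sigma>] by (auto simp: restr_def)
  ultimately show "bij_betw (restr \<sigma>) R R" unfolding bij_betw_def by (simp add: endo_inj_surj finR)
qed (simp add: restr_def)

lemma galois_perm_group: "perm_group R (galois_perms f)"
proof
  show "finite R" by (rule finR)
  show perm: "g permutes R" if "g \<in> galois_perms f" for g
    using that restr_permutes by (auto simp: galois_perms_altdef)
  have "(\<lambda>x. x) \<in> field_automorphisms f" by (simp add: field_automorphisms_iff bij_betw_def)
  moreover have "restr (\<lambda>x. x) = id" by (auto simp: restr_def)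
  ultimately show id: "id \<in> galois_perms f" unfolding galois_perms_altdef by (metis imageI)
  show comp: "g \<circ> h \<in> galois_perms f" if gh: "g \<in> galois_perms f" "h \<in> galois_perms f" for g h
  proof -
    obtain \<sigma> \<tau> where s: "\<sigma> \<in> field_automorphisms f" "\<tau> \<in> field_automorphisms f" "g = restr \<sigma>" "h = restr \<tau>"
      using gh by (auto simp: galois_perms_altdef)
    have "bij_betw (\<sigma> \<circ> \<tau>) K K" using s by (intro bij_betw_trans[of _ _ K]) (auto simp: field_automorphisms_iff)
    then have "\<sigma> \<circ> \<tau> \<in> field_automorphisms f"
      using s(1,2) automorphism_in[OF s(2)] by (simp add: field_automorphisms_iff)
    moreover have "g \<circ> h = restr (\<sigma> \<circ> \<tau>)"
      using s automorphism_root[OF s(2)] by (auto simp: restr_def fun_eq_iff)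
    ultimately show ?thesis by (auto simp: galois_perms_altdef)
  qed
  show "inv g \<in> galois_perms f" if g: "g \<in> galois_perms f" for g
  proof -
    \<comment> \<open>A permutation of a finite set has a power as its inverse, so closure under
      composition suffices.\<close>
    have "permutation g" using perm[OF g] finR permutation_permutes by blast
    then obtain n where n: "g ^^ n = id" "n > 0" by (rule permutation_is_nilpotent)
    have pow: "g ^^ k \<in> galois_perms f" for k by (induction k) (simp_all only: funpow.simps id comp g)
    have "g \<circ> g ^^ (n - 1) = id" using n by (cases n) auto
    then have "inv g = g ^^ (n - 1)"
      using permutes_inv_o[OF perm[OF g]] by (metis comp_assoc comp_id id_comp)
    then show ?thesis using pow by simp
  qed
qed

lemma obtain_minpoly: obtains m where "irreducible m" "rpoly m t = 0"
  using ex_minimal_poly alg_t by (auto simp: alg_def)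

text \<open>Sending \<open>rpoly q t\<close> to \<open>rpoly q s\<close> is well defined and
  injective because \<open>t\<close> and \<open>s\<close> have the same minimal polynomial.
  Surjectivity onto \<open>K\<close> uses that the map permutes the roots: \<open>s\<close> is the
  same combination of the permuted roots as \<open>t\<close> is of the roots, so \<open>s\<close>
  lies in \<open>K\<close>; and the roots, hence \<open>t\<close>, lie in
  \<open>Qadj s\<close>.\<close>

lemma ex_automorphism:
  assumes m: "irreducible m" "rpoly m t = 0" and s: "rpoly m s = 0"
  shows "\<exists>\<sigma>\<in>field_automorphisms f. \<sigma> t = s"
proof -
  define rep where "rep x = (SOME q. rpoly q t = x)" for x
  define \<sigma> where "\<sigma> x = rpoly (rep x) s" for x
  have rep: "rpoly (rep x) t = x" if "x \<in> K" for x
    using that unfolding rep_def Qadj_def by (metis (mono_tags) imageE someI)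
  have wd: "rpoly q s = rpoly q' s" if "rpoly q t = rpoly q' t" for q q'
  proof -
    have "rpoly (q - q') t = 0" using that by simp
    then have "m dvd q - q'" using irreducible_dvd_iff_root[OF m] by blast
    then have "rpoly (q - q') s = 0" using s rpoly_dvd by blast
    then show ?thesis by simp
  qed
  have \<sigma>p: "\<sigma> (rpoly q t) = rpoly q s" for q
    unfolding \<sigma>_def by (rule wd) (rule rep, simp add: Qadj_def)
  have add: "\<sigma> (x + y) = \<sigma> x + \<sigma> y" and mult: "\<sigma> (x * y) = \<sigma> x * \<sigma> y" if "x \<in> K" "y \<in> K" for x y
    using that \<sigma>p by (auto simp: Qadj_def simp flip: rpoly_add rpoly_mult)
  have rat: "\<sigma> (of_rat q) = of_rat q" for q using \<sigma>p[of "[:q:]"] by simp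
  have \<sigma>t: "\<sigma> t = s" using \<sigma>p[of "[:0, 1:]"] by simp
  have inj: "inj_on \<sigma> K"
  proof (rule inj_onI)
    fix x y assume xy: "x \<in> K" "y \<in> K" "\<sigma> x = \<sigma> y"
    then obtain q q' where q: "x = rpoly q t" "y = rpoly q' t" by (auto simp: Qadj_def)
    have "rpoly (q - q') s = 0" using xy q \<sigma>p by simp
    then have "m dvd q - q'" using irreducible_dvd_iff_root[OF m(1) s] by blast
    then have "rpoly (q - q') t = 0" using m(2) rpoly_dvd by blast
    then show "x = y" using q by simp
  qed
  have root: "\<sigma> z \<in> R" if z: "z \<in> R" for z
  proof -
    obtain q where q: "z = rpoly q t" using z roots_sub by (auto simp: Qadj_def)
    have "rpoly (pcompose f q) t = 0" using z q by (simp add: complex_roots_altdef)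
    then have "rpoly (pcompose f q) s = 0" using wd[of "pcompose f q" 0] by simp
    then show ?thesis using q \<sigma>p by (simp add: complex_roots_altdef)
  qed
  have im: "\<sigma> ` R = R"
    using inj_on_subset[OF inj roots_sub] root by (intro endo_inj_surj finR) auto
  have sum: "\<sigma> (\<Sum>z\<in>I. of_nat (c z) * z) = (\<Sum>z\<in>I. of_nat (c z) * \<sigma> z)" if "I \<subseteq> R" for I
    using finite_subset[OF that finR] that
  proof (induction I rule: finite_induct)
    case empty
    then show ?case using rat[of 0] by simp
  next
    case (insert z I)
    have z: "z \<in> K" using insert roots_sub by auto
    have nK: "of_nat (c z) \<in> K" using Qadj_closed(1)[of "of_nat (c z)" t] by simp
    have "(\<Sum>z\<in>I. of_nat (c z) * z) \<in> K"
      using Qadj_closed(1)[of "of_nat (c _)" t] insert roots_sub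
      by (intro Qadj_sum Qadj_closed) auto
    moreover have "of_nat (c z) * z \<in> K" using nK z by (rule Qadj_closed)
    moreover have "\<sigma> (of_nat (c z) * z) = of_nat (c z) * \<sigma> z"
      using mult[OF nK z] rat[of "of_nat (c z)"] by simp
    ultimately show ?case using insert add by simp
  qed
  have "s \<in> K"
  proof -
    have "s = (\<Sum>z\<in>R. of_nat (c z) * \<sigma> z)" using sum[of R] \<sigma>t t_sum by simp
    also have "\<dots> \<in> K"
    proof (intro Qadj_sum Qadj_closed)
      fix z assume "z \<in> R"
      then show "\<sigma> z \<in> K" using root roots_sub by blast
      show "of_nat (c z) \<in> K" using Qadj_closed(1)[of "of_nat (c z)" t] by simp
    qed
    finally show ?thesis .
  qed
  moreover have Qs: "Qadj s = \<sigma> ` K" unfolding Qadj_def image_image \<sigma>p ..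
  ultimately have into: "\<sigma> ` K \<subseteq> K" using Qadj_mono by blast
  have "R \<subseteq> Qadj s"
  proof
    fix z assume "z \<in> R"
    then obtain y where y: "y \<in> R" "z = \<sigma> y" using im by blast
    then show "z \<in> Qadj s" using roots_sub \<sigma>p by (auto simp: Qadj_def)
  qed
  then have "t \<in> Qadj s" unfolding t_sum
    using Qadj_closed(1)[of "of_nat (c _)" s] by (intro Qadj_sum Qadj_closed) auto
  then have "K \<subseteq> Qadj s" by (rule Qadj_mono)
  then have "bij_betw \<sigma> K K" using inj into Qs by (simp add: bij_betw_def)
  then have "\<sigma> \<in> field_automorphisms f" unfolding field_automorphisms_iff using add mult rat by blast
  then show ?thesis using \<sigma>t by blast
qed

text \<open>Write \<open>x\<close> as a polynomial \<open>r\<close> in \<open>t\<close> of degree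
  below that of the minimal polynomial. Then \<open>r - x\<close> vanishes at all conjugates of
  \<open>t\<close>, more than its degree allows, so \<open>r\<close> is constant.\<close>

lemma invariant_rational:
  assumes x: "x \<in> K" and inv: "\<And>\<sigma>. \<sigma> \<in> field_automorphisms f \<Longrightarrow> \<sigma> x = x"
  shows "x \<in> \<rat>"
proof -
  obtain m where m: "irreducible m" "rpoly m t = 0" by (rule obtain_minpoly)
  obtain q where q: "x = rpoly q t" using x by (auto simp: Qadj_def)
  define r where "r = q mod m"
  have xr: "x = rpoly r t"
  proof -
    have "rpoly q t = rpoly (q div m * m + r) t" by (simp only: r_def div_mult_mod_eq)
    also have "\<dots> = rpoly r t" using m(2) by (simp only: rpoly_add rpoly_mult) simp
    finally show ?thesis using q by simp
  qed
  have dm: "degree m > 0" using m(1) is_unit_iff_degree[of m] by (auto simp: irreducible_def)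
  have dr: "degree r < degree m"
    using degree_mod_less[of m q] m(1) dm by (auto simp: r_def irreducible_def)
  define P where "P = map_poly of_rat r - [:x:]"
  have "complex_roots m \<subseteq> {z. poly P z = 0}"
  proof
    fix s assume "s \<in> complex_roots m"
    then obtain \<sigma> where \<sigma>: "\<sigma> \<in> field_automorphisms f" "\<sigma> t = s"
      using ex_automorphism[OF m] by (auto simp: complex_roots_altdef)
    have "x = rpoly r s" using automorphism_rpoly[OF \<sigma>(1), of t r] \<sigma>(2) inv[OF \<sigma>(1)] xr Qadj_closed(2) by simp
    then show "s \<in> {z. poly P z = 0}" by (simp add: P_def rpoly_def)
  qed
  have "P = 0"
  proof (rule ccontr)
    assume P0: "P \<noteq> 0"
    have "degree m \<le> card {z. poly P z = 0}"
      using card_mono[OF poly_roots_finite[OF P0] \<open>complex_roots m \<subseteq> _\<close>] irreducible_card_roots(2)[OF m(1)] by simp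
    also have "\<dots> \<le> degree P" using P0 by (rule card_poly_roots_bound)
    also have "\<dots> \<le> degree r" unfolding P_def by (rule degree_diff_le) auto
    finally show False using dr by simp
  qed
  then have "coeff P 0 = 0" by simp
  then have "x = of_rat (coeff r 0)" by (simp add: P_def coeff_map_poly)
  then show ?thesis by simp
qed

text \<open>An automorphism is arbitrary outside \<open>K\<close>, so the induction carries
  membership of the coefficients in \<open>K\<close> along with the formula for their
  images.\<close>

lemma invariant_product_rational:
  fixes b :: "'i \<Rightarrow> complex"
  assumes fin: "finite I" and bK: "\<And>i. i \<in> I \<Longrightarrow> b i \<in> K"
    and perm: "\<And>\<sigma>. \<sigma> \<in> field_automorphisms f \<Longrightarrow> (\<Prod>i\<in>I. [:- \<sigma> (b i), 1:]) = (\<Prod>i\<in>I. [:- b i, 1:])"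
  shows "coeff (\<Prod>i\<in>I. [:- b i, 1:]) j \<in> \<rat>"
proof (rule invariant_rational)
  have *: "coeff (\<Prod>i\<in>I. [:- b i, 1:]) j \<in> K \<and>
      (\<forall>\<sigma>\<in>field_automorphisms f. \<sigma> (coeff (\<Prod>i\<in>I. [:- b i, 1:]) j) = coeff (\<Prod>i\<in>I. [:- \<sigma> (b i), 1:]) j)" for j
    using fin bK
  proof (induction I arbitrary: j rule: finite_induct)
    case empty
    then show ?case using automorphism_0_1 by (cases j) auto
  next
    case (insert x F)
    let ?P = "\<Prod>i\<in>F. [:- b i, 1:]"
    have b: "b x \<in> K" using insert by auto
    have IH: "coeff ?P j \<in> K" "\<And>\<sigma>. \<sigma> \<in> field_automorphisms f \<Longrightarrow> \<sigma> (coeff ?P j) = coeff (\<Prod>i\<in>F. [:- \<sigma> (b i), 1:]) j" for j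
      using insert.IH[of j] insert.prems by auto
    have neg: "\<sigma> (- y) = - \<sigma> y" if "\<sigma> \<in> field_automorphisms f" "y \<in> K" for \<sigma> y
    proof -
      have "\<sigma> (y + - y) = \<sigma> y + \<sigma> (- y)" using that Qadj_closed(5) unfolding field_automorphisms_iff by blast
      moreover have "\<sigma> 0 = 0" using that automorphism_0_1 by blast
      ultimately show ?thesis by (simp add: add_eq_0_iff)
    qed
    have mult: "\<sigma> (y * z) = \<sigma> y * \<sigma> z" "\<sigma> (y + z) = \<sigma> y + \<sigma> z" if "\<sigma> \<in> field_automorphisms f" "y \<in> K" "z \<in> K" for \<sigma> y z
      using that unfolding field_automorphisms_iff by blast+
    show ?case
    proof (cases j)
      case 0
      have b0: "b x * coeff ?P 0 \<in> K" using b IH(1) by (rule Qadj_closed)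
      have "\<sigma> (- (b x * coeff ?P 0)) = - (\<sigma> (b x) * \<sigma> (coeff ?P 0))" if \<sigma>: "\<sigma> \<in> field_automorphisms f" for \<sigma>
        using neg[OF \<sigma> b0] mult(1)[OF \<sigma> b IH(1)[of 0]] by simp
      then show ?thesis using insert 0 b0 IH by (auto simp: Qadj_closed)
    next
      case (Suc k)
      have bk: "b x * coeff ?P (Suc k) \<in> K" using b IH(1) by (rule Qadj_closed)
      have "\<sigma> (coeff ?P k + - (b x * coeff ?P (Suc k))) = \<sigma> (coeff ?P k) + - (\<sigma> (b x) * \<sigma> (coeff ?P (Suc k)))"
        if \<sigma>: "\<sigma> \<in> field_automorphisms f" for \<sigma>
        using mult(2)[OF \<sigma> IH(1)[of k] Qadj_closed(5)[OF bk]] neg[OF \<sigma> bk] mult(1)[OF \<sigma> b IH(1)[of "Suc k"]] by simp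
      then show ?thesis using insert Suc bk IH by (auto simp: Qadj_closed)
    qed
  qed
  show "coeff (\<Prod>i\<in>I. [:- b i, 1:]) j \<in> K" using * by blast
  fix \<sigma> assume "\<sigma> \<in> field_automorphisms f"
  then show "\<sigma> (coeff (\<Prod>i\<in>I. [:- b i, 1:]) j) = coeff (\<Prod>i\<in>I. [:- b i, 1:]) j" using * perm by metis
qed

text \<open>The factors are indexed by group elements instead of distinct conjugates, so that the
  degree is the group order; left multiplication by the restriction of an automorphism permutes the
  indices.\<close>

lemma galois_resolvent_rational:
  assumes T: "T \<subseteq> R"
  shows "coeff (\<Prod>\<pi>\<in>galois_perms f. [:- (\<Prod>z\<in>T. \<pi> z), 1:]) j \<in> \<rat>"
proof (rule invariant_product_rational)
  interpret G: perm_group R "galois_perms f" by (rule galois_perm_group)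
  show "finite (galois_perms f)" by (rule G.finG)
  have imK: "\<pi> z \<in> K" if "\<pi> \<in> galois_perms f" "z \<in> T" for \<pi> z
    using permutes_in_image[OF G.perm[OF that(1)], of z] T that(2) roots_sub by blast
  show "(\<Prod>z\<in>T. \<pi> z) \<in> K" if "\<pi> \<in> galois_perms f" for \<pi>
    using imK[OF that] by (rule Qadj_prod)
  fix \<sigma> assume \<sigma>: "\<sigma> \<in> field_automorphisms f"
  have rho: "restr \<sigma> \<in> galois_perms f" using \<sigma> by (auto simp: galois_perms_altdef)
  have sp: "\<sigma> (\<Prod>z\<in>I. \<pi> z) = (\<Prod>z\<in>I. (restr \<sigma> \<circ> \<pi>) z)" if \<pi>: "\<pi> \<in> galois_perms f" and "I \<subseteq> T" for \<pi> I
    using finite_subset[OF subset_trans[OF that(2) T] finR] that(2)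
  proof (induction I rule: finite_induct)
    case empty
    then show ?case using automorphism_0_1[OF \<sigma>] by simp
  next
    case (insert x F)
    have 1: "\<pi> x \<in> K" using imK[OF \<pi>] insert by auto
    have 2: "(\<Prod>z\<in>F. \<pi> z) \<in> K" using imK[OF \<pi>] insert by (intro Qadj_prod) auto
    have "\<sigma> (\<pi> x * (\<Prod>z\<in>F. \<pi> z)) = \<sigma> (\<pi> x) * \<sigma> (\<Prod>z\<in>F. \<pi> z)"
      using \<sigma> 1 2 unfolding field_automorphisms_iff by blast
    moreover have "\<pi> x \<in> R" using permutes_in_image[OF G.perm[OF \<pi>], of x] T insert by auto
    ultimately show ?case using insert by (simp add: restr_def)
  qed
  have "(\<Prod>\<pi>\<in>galois_perms f. [:- \<sigma> (\<Prod>z\<in>T. \<pi> z), 1:]) = (\<Prod>\<pi>\<in>galois_perms f. [:- (\<Prod>z\<in>T. (restr \<sigma> \<circ> \<pi>) z), 1:])"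
    using sp by (intro prod.cong) auto
  also have "\<dots> = (\<Prod>\<pi>\<in>galois_perms f. [:- (\<Prod>z\<in>T. \<pi> z), 1:])"
    by (rule prod.reindex_bij_witness[where i = "\<lambda>\<pi>. inv (restr \<sigma>) \<circ> \<pi>" and j = "\<lambda>\<pi>. restr \<sigma> \<circ> \<pi>"])
      (use rho G.comp G.inv G.inv_left[OF rho] G.inv_right[OF rho] in \<open>auto simp: fun_eq_iff\<close>)
  finally show "(\<Prod>\<pi>\<in>galois_perms f. [:- \<sigma> (\<Prod>z\<in>T. \<pi> z), 1:]) = (\<Prod>\<pi>\<in>galois_perms f. [:- (\<Prod>z\<in>T. \<pi> z), 1:])" .
qed

text \<open>The product of \<open>X - z\<close> over the orbit of \<open>a\<close> is rational and
  shares the root \<open>a\<close> with the irreducible \<open>f\<close>, so \<open>f\<close>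
  divides it and every root lies in the orbit.\<close>

lemma galois_transitive: "perm_group.transitive_on (galois_perms f) R"
proof -
  interpret G: perm_group R "galois_perms f" by (rule galois_perm_group)
  have "\<exists>g\<in>galois_perms f. g a = b" if ab: "a \<in> R" "b \<in> R" for a b
  proof -
    define Ob where "Ob = (\<lambda>g. g a) ` galois_perms f"
    have ObR: "Ob \<subseteq> R" using G.perm ab(1) by (auto simp: Ob_def permutes_in_image)
    have finOb: "finite Ob" using G.finG by (simp add: Ob_def)
    have rat: "coeff (\<Prod>z\<in>Ob. [:- z, 1:]) j \<in> \<rat>" for j
    proof (rule invariant_product_rational)
      fix \<sigma> assume \<sigma>: "\<sigma> \<in> field_automorphisms f"
      have rho: "restr \<sigma> \<in> galois_perms f" using \<sigma> by (auto simp: galois_perms_altdef)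
      have "\<sigma> z = restr \<sigma> z" if "z \<in> Ob" for z using that ObR by (auto simp: restr_def)
      then have "(\<Prod>z\<in>Ob. [:- \<sigma> z, 1:]) = (\<Prod>z\<in>Ob. [:- restr \<sigma> z, 1:])" by (intro prod.cong) auto
      also have "\<dots> = (\<Prod>z\<in>restr \<sigma> ` Ob. [:- z, 1:])"
        by (subst prod.reindex) (use inj_on_subset[OF G.injG[OF rho]] in auto)
      also have "restr \<sigma> ` Ob = Ob"
      proof (rule endo_inj_surj[OF finOb])
        show "restr \<sigma> ` Ob \<subseteq> Ob" using G.comp[OF rho] by (auto simp: Ob_def image_iff) (metis comp_apply)
        show "inj_on (restr \<sigma>) Ob" using inj_on_subset[OF G.injG[OF rho]] by auto
      qed
      finally show "(\<Prod>z\<in>Ob. [:- \<sigma> z, 1:]) = (\<Prod>z\<in>Ob. [:- z, 1:])" .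
    qed (use finOb ObR roots_sub in auto)
    define P where "P = (\<Prod>z\<in>Ob. [:- z, 1:])"
    have "\<exists>q. map_poly of_rat q = P"
    proof -
      define ir where "ir x = (SOME q. of_rat q = x)" for x :: complex
      have ir: "of_rat (ir x) = x" if "x \<in> \<rat>" for x
        using that unfolding ir_def by (metis (mono_tags) Rats_cases someI)
      have ir0: "ir 0 = 0" using ir[of 0] by simp
      have "map_poly of_rat (map_poly ir P) = P"
        by (rule poly_eqI) (simp add: coeff_map_poly ir0 ir rat P_def)
      then show ?thesis by blast
    qed
    then obtain q where q: "map_poly of_rat q = P" by blast
    have rq: "rpoly q z = 0 \<longleftrightarrow> z \<in> Ob" for z
      using finOb by (auto simp: rpoly_def q P_def poly_prod)
    have "a \<in> Ob" using G.one by (auto simp: Ob_def intro!: image_eqI[of _ _ id])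
    then have "f dvd q" using irreducible_dvd_iff_root[OF irr, of a q] rq ab(1) by (simp add: complex_roots_altdef)
    then have "rpoly q b = 0" using rpoly_dvd ab(2) by (auto simp: complex_roots_altdef)
    then show ?thesis using rq by (auto simp: Ob_def)
  qed
  then show ?thesis using G.perm unfolding G.transitive_on_def by blast
qed

end

lemma ex_primitive_root_field:
  assumes "irreducible (f :: rat poly)"
  shows "\<exists>t c. primitive_root_field f t c"
proof -
  have "alg s" if "s \<in> complex_roots f" for s
    using that assms unfolding alg_def complex_roots_altdef irreducible_def by blast
  then obtain t c where "alg t" "complex_roots f \<subseteq> Qadj t" "t = (\<Sum>s\<in>complex_roots f. of_nat (c s) * s)"
    using primitive_element[OF irreducible_card_roots(1)[OF assms]] by blast
  then show ?thesis using assms by (auto simp: primitive_root_field_def)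
qed

subsection \<open>Valuations of factorials\<close>

text \<open>In Legendre's sum the first term is \<open>u\<close> and the others form the sum for
  \<open>u\<close>; the last digit \<open>c\<close> is lost.\<close>

lemma multiplicity_fact_mult_add:
  assumes p: "prime (p :: nat)" and c: "c < p"
  shows "multiplicity p (fact (p * u + c) :: nat) = u + multiplicity p (fact u :: nat)"
proof -
  have p1: "p > 1" using prime_gt_1_nat[OF p] .
  define N where "N = u"
  have "u < p ^ N" unfolding N_def using p1 by (intro power_gt_expt) simp
  also have "\<dots> \<le> p ^ Suc N" using p1 by (intro power_increasing) auto
  finally have u: "u < p ^ Suc N" .
  have "p * u + c < p * Suc u" using c by simp
  also have "\<dots> \<le> p * p ^ Suc N" using u by (intro mult_le_mono2) simp
  finally have n: "p * u + c < p ^ Suc (Suc N)" by simp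
  have dv: "(p * u + c) div p ^ Suc i = u div p ^ i" for i
    using c by (simp add: div_mult2_eq)
  have "multiplicity p (fact (p * u + c) :: nat) = (\<Sum>i=1..Suc N. (p * u + c) div p ^ i)"
    by (rule multiplicity_fact_legendre[OF p n])
  also have "\<dots> = (\<Sum>i=0..N. u div p ^ i)"
    using sum.shift_bounds_cl_Suc_ivl[of "\<lambda>i. (p * u + c) div p ^ i" 0 N] by (simp only: dv One_nat_def)
  also have "\<dots> = u + (\<Sum>i=1..N. u div p ^ i)"
    by (simp add: sum.atLeast_Suc_atMost)
  also have "(\<Sum>i=1..N. u div p ^ i) = multiplicity p (fact u :: nat)"
    using multiplicity_fact_legendre[OF p u] by simp
  finally show ?thesis .
qed

text \<open>The sum of the base \<open>p\<close> digits of \<open>j\<close>, by Legendre's formula.\<close>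

definition digit_sum :: "nat \<Rightarrow> nat \<Rightarrow> real" where
  "digit_sum p j = real j - (real p - 1) * real (multiplicity p (fact j :: nat))"

lemma digit_sum_mult_add:
  assumes "prime p" "c < p"
  shows "digit_sum p (p * u + c) = digit_sum p u + real c"
  using multiplicity_fact_mult_add[OF assms, of u] by (simp add: digit_sum_def algebra_simps)

lemma multiplicity_fact_Suc:
  assumes p: "prime (p :: nat)"
  shows "multiplicity p (fact (Suc j) :: nat) = multiplicity p (Suc j) + multiplicity p (fact j :: nat)"
  using p by (simp only: fact_Suc of_nat_id) (rule prime_elem_multiplicity_mult_distrib; simp)

lemma multiplicity_fact_mono:
  assumes p: "prime (p :: nat)" and "i \<le> j"
  shows "multiplicity p (fact i :: nat) \<le> multiplicity p (fact j :: nat)"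
  using assms(2) by (induction j rule: dec_induct) (auto simp: multiplicity_fact_Suc[OF p] simp del: fact_Suc)

lemma digit_sum_decreasing:
  assumes p: "prime p" and E: "E > 1" and "i < j"
  shows "digit_sum p j - E * real j < digit_sum p i - E * real i"
proof -
  have "(real p - 1) * real (multiplicity p (fact i :: nat)) \<le> (real p - 1) * real (multiplicity p (fact j :: nat))"
    using multiplicity_fact_mono[OF p] assms(3) prime_gt_1_nat[OF p] by (intro mult_left_mono) auto
  moreover have "(E - 1) * real i < (E - 1) * real j" using assms by (intro mult_strict_left_mono) auto
  ultimately show ?thesis by (simp add: digit_sum_def algebra_simps)
qed

lemma digit_sum_pos:
  assumes p: "prime p"
  shows "j > 0 \<Longrightarrow> digit_sum p j > 0"
proof (induction j rule: less_induct)
  case (less j)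
  define u where "u = j div p"
  define c where "c = j mod p"
  have j: "j = p * u + c" "c < p" using prime_gt_0_nat[OF p] by (auto simp: u_def c_def)
  have eq: "digit_sum p j = digit_sum p u + real c" using digit_sum_mult_add[OF p j(2)] j(1) by simp
  show ?case
  proof (cases "u = 0")
    case True
    then show ?thesis using eq less(2) j by (simp add: digit_sum_def)
  next
    case False
    have "u < j" unfolding u_def using prime_gt_1_nat[OF p] less(2) by (intro div_less_dividend) auto
    then show ?thesis using less(1)[of u] False eq by simp
  qed
qed

text \<open>Up to the factor \<open>p - 1\<close>, the compared quantity is the valuation of term
  \<open>j\<close> of the exponential series at a number of valuation
  \<open>(1 - E) / (p - 1)\<close>. The induction removes the last digit: for
  \<open>0 < E < 1\<close> a positive last digit only increases the value, and what remains is the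
  claim for \<open>n div p\<close>, \<open>a - 1\<close> and \<open>E * p\<close>. For other
  \<open>E\<close> the minimum is at 0 or at \<open>n\<close>.\<close>

lemma digit_sum_unique_min:
  assumes p: "prime p" and "p ^ a dvd n" and "\<And>i. i \<ge> a \<Longrightarrow> E \<noteq> 1 / real p ^ i"
  shows "\<exists>k\<le>n. p ^ a dvd k \<and> (\<forall>j\<le>n. j \<noteq> k \<longrightarrow> digit_sum p k - E * real k < digit_sum p j - E * real j)"
  using assms(2,3)
proof (induction n arbitrary: a E rule: less_induct)
  case (less n)
  have p1: "p > 1" using prime_gt_1_nat[OF p] .
  consider "E \<le> 0 \<or> n = 0" | "E > 1" "n > 0" | "E = 1" "n > 0" | "0 < E" "E < 1" "n > 0" by linarith
  then show ?case
  proof cases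
    case 1
    have "digit_sum p 0 - E * real 0 < digit_sum p j - E * real j" if "j \<le> n" "j \<noteq> 0" for j
    proof -
      have "E \<le> 0" using 1 that by auto
      then have "E * real j \<le> 0" by (simp add: mult_nonpos_nonneg)
      then show ?thesis using digit_sum_pos[OF p, of j] that by (simp add: digit_sum_def)
    qed
    then show ?thesis by (intro exI[of _ 0]) auto
  next
    case 2
    then show ?thesis using digit_sum_decreasing[OF p 2(1)] less(2) by (intro exI[of _ n]) auto
  next
    case 3
    \<comment> \<open>\<open>E = 1\<close> is allowed only for \<open>a > 0\<close>, so
      \<open>p\<close> divides \<open>n\<close>; the factorial gains a factor \<open>p\<close> at
      \<open>n\<close>, which makes the minimum strict.\<close>
    have "a \<noteq> 0" using less(3)[of 0] 3 by auto
    then have pn: "p dvd n" using less(2) by (metis dvd_power dvd_trans gr0I)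
    have "digit_sum p n - E * real n < digit_sum p j - E * real j" if j: "j \<le> n" "j \<noteq> n" for j
    proof -
      have "multiplicity p (fact j :: nat) \<le> multiplicity p (fact (n - 1) :: nat)"
        using j by (intro multiplicity_fact_mono[OF p]) auto
      also have "\<dots> < multiplicity p (fact n :: nat)"
      proof -
        have "multiplicity p n > 0" using pn 3 p1 by (simp add: multiplicity_gt_zero_iff)
        then show ?thesis using multiplicity_fact_Suc[OF p, of "n - 1"] 3 by simp
      qed
      finally have "(real p - 1) * real (multiplicity p (fact j :: nat)) < (real p - 1) * real (multiplicity p (fact n :: nat))"
        using p1 by (intro mult_strict_left_mono) auto
      then show ?thesis using 3 by (simp add: digit_sum_def)
    qed
    then show ?thesis using less(2) by (intro exI[of _ n]) auto
  next
    case 4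
    define n' where "n' = n div p"
    have n': "n' < n" using 4 p1 by (simp add: n'_def)
    have dvd': "p ^ (a - 1) dvd n'"
    proof (cases a)
      case (Suc b)
      then have "p * p ^ b dvd n" using less(2) by simp
      then show ?thesis using Suc p1 by (auto simp: n'_def elim!: dvdE)
    qed simp
    have ne: "E * real p \<noteq> 1 / real p ^ i" if "i \<ge> a - 1" for i
    proof
      assume "E * real p = 1 / real p ^ i"
      then have "E = 1 / real p ^ Suc i" using p1 by (simp add: field_simps)
      moreover have "Suc i \<ge> a" using that by linarith
      ultimately show False using less(3) by blast
    qed
    obtain u0 where u0: "u0 \<le> n'" "p ^ (a - 1) dvd u0"
      "\<And>u. u \<le> n' \<Longrightarrow> u \<noteq> u0 \<Longrightarrow> digit_sum p u0 - E * real p * real u0 < digit_sum p u - E * real p * real u"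
      using less(1)[OF n' dvd' ne] by blast
    have split: "digit_sum p (p * u + c) - E * real (p * u + c) = (digit_sum p u - E * real p * real u) + real c * (1 - E)"
      if "c < p" for u c
      by (simp only: digit_sum_mult_add[OF p that] of_nat_add of_nat_mult) (simp add: algebra_simps)
    have "digit_sum p (p * u0) - E * real (p * u0) < digit_sum p j - E * real j" if j: "j \<le> n" "j \<noteq> p * u0" for j
    proof -
      define u where "u = j div p"
      define c where "c = j mod p"
      have jc: "j = p * u + c" "c < p" using p1 by (auto simp: u_def c_def)
      have un: "u \<le> n'" using j(1) by (simp add: u_def n'_def div_le_mono)
      have e1: "digit_sum p (p * u0) - E * real (p * u0) = digit_sum p u0 - E * real p * real u0"
        using split[of 0 u0] p1 by simp
      have e2: "digit_sum p j - E * real j = (digit_sum p u - E * real p * real u) + real c * (1 - E)"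
        unfolding jc(1) by (rule split[OF jc(2)])
      have c0: "real c * (1 - E) \<ge> 0" using 4 by simp
      show ?thesis
      proof (cases "u = u0")
        case True
        then have "c > 0" using j(2) jc(1) by auto
        then have "real c * (1 - E) > 0" using 4 by simp
        then show ?thesis unfolding e1 e2 unfolding True by linarith
      next
        case False
        then show ?thesis using u0(3)[OF un False] e1 e2 c0 by linarith
      qed
    qed
    moreover have "p ^ a dvd p * u0" using u0(2) by (cases a) auto
    moreover have "p * u0 \<le> n" using u0(1) p1 unfolding n'_def
      by (meson le_trans mult_le_mono2 times_div_less_eq_dividend)
    ultimately show ?thesis by (intro exI[of _ "p * u0"]) auto
  qed
qed

text \<open>Adding \<open>r\<close> to a multiple of \<open>p ^ a\<close> only fills the lower
  digits, so no carry occurs.\<close>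

lemma multiplicity_binomial_add_power:
  assumes p: "prime (p :: nat)" and N: "p ^ a dvd N" and r: "r < p ^ a"
  shows "multiplicity p (N + r choose r) = 0"
proof -
  have p1: "p > 1" using prime_gt_1_nat[OF p] .
  define M where "M = N + r"
  have "N + r < p ^ M" unfolding M_def using p1 by (intro power_gt_expt) simp
  also have "\<dots> \<le> p ^ Suc M" using p1 by (intro power_increasing) auto
  finally have M: "N + r < p ^ Suc M" .
  have "\<not> (N + r) mod p ^ i < r mod p ^ i" for i
  proof (cases "i \<le> a")
    case True
    then have "p ^ i dvd N" using N by (meson dvd_trans le_imp_power_dvd)
    then have "(N + r) mod p ^ i = r mod p ^ i" by (auto elim!: dvdE)
    then show ?thesis by simp
  next
    case False
    then have ai: "p ^ a dvd p ^ i" by (simp add: le_imp_power_dvd)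
    have "p ^ a \<le> p ^ i" using False p1 by (intro power_increasing) auto
    then have rm: "r mod p ^ i = r" using r by simp
    have "p ^ a dvd N mod p ^ i" using N ai by (simp add: dvd_mod)
    moreover have "N mod p ^ i < p ^ i" using p1 by simp
    ultimately have "N mod p ^ i + p ^ a \<le> p ^ i"
    proof -
      obtain x y where xy: "N mod p ^ i = p ^ a * x" "p ^ i = p ^ a * y"
        using \<open>p ^ a dvd N mod p ^ i\<close> ai by (auto elim!: dvdE)
      then have "x < y" using \<open>N mod p ^ i < p ^ i\<close> by simp
      then have "p ^ a * Suc x \<le> p ^ a * y" by (intro mult_le_mono2) simp
      then show ?thesis using xy by simp
    qed
    then have "(N + r) mod p ^ i = N mod p ^ i + r"
      using r mod_less[of "N mod p ^ i + r" "p ^ i"] by (simp add: mod_add_left_eq)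
    then show ?thesis using rm by simp
  qed
  then have "(N + r) div p ^ i - r div p ^ i - (N + r - r) div p ^ i = 0" for i
    using div_carry[of r "N + r" "p ^ i"] p1 by simp
  then show ?thesis unfolding multiplicity_binomial[OF p M le_add2] by (simp only: sum.neutral_const)
qed

subsection \<open>Roots of rational polynomials and their valuations\<close>

lemma dvd_card_by_fibres:
  assumes "finite I" "\<And>\<mu>. \<mu> \<in> q ` I \<Longrightarrow> D dvd card {i\<in>I. q i = \<mu>}"
  shows "D dvd card (I :: 'i set)"
proof -
  have "card I = (\<Sum>\<mu>\<in>q ` I. card {i\<in>I. q i = \<mu>})"
    using sum.image_gen[OF assms(1), of "\<lambda>_. 1 :: nat" q] by simp
  then show ?thesis using assms(2) by (simp add: dvd_sum)
qed

lemma dvd_of_Ints_fraction: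
  assumes "coprime N k" "N > 0" "real c * (real k / real N) \<in> \<int>"
  shows "N dvd c"
proof -
  obtain z where z: "real c * (real k / real N) = of_int z" using assms(3) by (auto elim: Ints_cases)
  then have "real_of_int (int (c * k)) = real_of_int (z * int N)" using assms(2) by (simp add: field_simps)
  then have "int (c * k) = z * int N" by (simp only: of_int_eq_iff)
  then have "int N dvd int (c * k)" by simp
  then have "N dvd c * k" by (simp only: int_dvd_int_iff)
  then show ?thesis using assms(1) by (simp add: coprime_dvd_mult_left_iff)
qed

lemma laguerre_nonzero [simp]: "laguerre r n \<noteq> 0"
proof
  assume "laguerre r n = 0"
  then have "coeff (laguerre r n) n = 0" by simp
  then show False by (simp add: coeff_laguerre)
qed

context valuation_ring
begin

text \<open>Roots are listed with multiplicity, since \<open>g\<close> may have multiple roots; the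
  last part is the valuation of the product of the negated roots.\<close>

lemma newton_rat_poly:
  fixes g :: "rat poly"
  assumes g0: "g \<noteq> 0" and val: "\<And>x. rpoly g x = 0 \<Longrightarrow> \<exists>q. has_val x q"
  shows "\<exists>q. (\<forall>i<degree g. \<exists>x. rpoly g x = 0 \<and> has_val x (q i)) \<and>
    (\<forall>\<mu>\<in>\<rat>. real (card {i\<in>{..<degree g}. q i = \<mu>}) * \<mu> \<in> \<int>) \<and>
    has_val (of_rat (coeff g 0) / of_rat (lead_coeff g)) (\<Sum>i<degree g. q i)"
proof -
  let ?g = "map_poly of_rat g :: complex poly"
  obtain a where a: "Polynomial.smult (lead_coeff ?g) (\<Prod>i<degree ?g. [:- a i, 1:]) = ?g"
    by (rule complex_poly_decompose')
  define l where "l = (of_rat (lead_coeff g) :: complex)"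
  have l0: "l \<noteq> 0" using g0 by (simp add: l_def)
  have eq: "?g = Polynomial.smult l (\<Prod>i<degree g. [:- a i, 1:])" using a by (simp add: l_def coeff_map_poly)
  have root: "rpoly g (a i) = 0" if "i < degree g" for i
    unfolding rpoly_def eq using that by (auto simp: poly_prod intro!: prod_zero)
  define q where "q i = (SOME q. has_val (a i) q)" for i
  have q: "has_val (a i) (q i)" if "i < degree g" for i
    unfolding q_def using someI_ex[OF val[OF root[OF that]]] .
  have cf: "coeff (\<Prod>i<degree g. [:- a i, 1:]) j = of_rat (coeff g j) / l" for j
  proof -
    have "of_rat (coeff g j) = coeff ?g j" by (simp add: coeff_map_poly)
    also have "\<dots> = l * coeff (\<Prod>i<degree g. [:- a i, 1:]) j" by (subst eq) simp
    finally show ?thesis using l0 by simp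
  qed
  show ?thesis
  proof (intro exI[of _ q] conjI allI ballI impI)
    show "\<exists>x. rpoly g x = 0 \<and> has_val x (q i)" if "i < degree g" for i using root q that by blast
    show "real (card {i\<in>{..<degree g}. q i = \<mu>}) * \<mu> \<in> \<int>" if "\<mu> \<in> \<rat>" for \<mu>
      by (rule newton_count[OF _ q _ that]) (auto simp: cf l_def)
    have "has_val (\<Prod>i<degree g. - a i) (\<Sum>i<degree g. q i)"
      by (intro has_val_prod has_val_minus q) simp
    moreover have "(\<Prod>i<degree g. - a i) = of_rat (coeff g 0) / l"
    proof -
      have "coeff (\<Prod>i\<in>I. [:- a i, 1:]) 0 = (\<Prod>i\<in>I. - a i)" for I
        by (induction I rule: infinite_finite_induct) auto
      then show ?thesis using cf[of 0] by simp
    qed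
    ultimately show "has_val (of_rat (coeff g 0) / of_rat (lead_coeff g)) (\<Sum>i<degree g. q i)" by (simp add: l_def)
  qed
qed

subsection \<open>Slopes of the generalised Laguerre polynomials\<close>

text \<open>The valuation of coefficient \<open>j\<close>, see
  \<open>has_val_laguerre_coeff\<close>; symmetry replaces the lower index \<open>n - j\<close> of
  the binomial coefficient by the constant \<open>r\<close>.\<close>

definition lval :: "nat \<Rightarrow> nat \<Rightarrow> nat \<Rightarrow> real" where
  "lval r n j = real (multiplicity p (n - j + r choose r)) - real (multiplicity p (fact j :: nat))"

lemma has_val_laguerre_coeff:
  assumes "j \<le> n"
  shows "has_val (of_rat (coeff (laguerre r n) j)) (lval r n j)"
proof -
  have "n - j + r choose (n - j) = (n - j + r choose r)"
    by (subst binomial_symmetric) auto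
  then have "of_rat (coeff (laguerre r n) j) = of_nat (n - j + r choose r) / (of_nat (fact j) :: complex)"
    using assms of_rat_of_nat_eq[of "fact j", where ?'a = complex] by (simp add: coeff_laguerre of_rat_divide)
  moreover have "has_val (of_nat (n - j + r choose r)) (real (multiplicity p (n - j + r choose r)))"
    by (rule has_val_of_nat) simp
  moreover have "has_val (of_nat (fact j)) (real (multiplicity p (fact j :: nat)))"
    by (rule has_val_of_nat) simp
  ultimately show ?thesis unfolding lval_def by (simp only: has_val_divide)
qed

lemma laguerre_root_nonzero: "rpoly (laguerre r n) x = 0 \<Longrightarrow> x \<noteq> 0"
proof
  assume "rpoly (laguerre r n) x = 0" "x = 0"
  then have "coeff (laguerre r n) 0 = 0"
    using rpoly_altdef[of "laguerre r n" n x] by (simp add: power_0_left if_distrib cong: if_cong)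
  then show False by (simp add: coeff_laguerre)
qed

text \<open>\<open>root_slope\<close> in the form used for contradictions: no index is a strict
  minimum.\<close>

lemma laguerre_root_slope:
  assumes "rpoly (laguerre r n) x = 0"
  obtains q where "has_val x q" "\<And>k. k \<le> n \<Longrightarrow> \<exists>j\<le>n. j \<noteq> k \<and> lval r n j + real j * q \<le> lval r n k + real k * q"
proof -
  have "(\<Sum>j\<le>n. of_rat (coeff (laguerre r n) j) * x ^ j) = 0"
    using rpoly_altdef[of "laguerre r n" n x] assms by simp
  note slope = root_slope[where c = "\<lambda>j. of_rat (coeff (laguerre r n) j)" and w = "lval r n" and n = n,
      OF has_val_laguerre_coeff this laguerre_root_nonzero[OF assms]]
  show ?thesis
  proof (rule slope)
    fix q i k assume q: "has_val x q" "i < k" "k \<le> n"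
      "lval r n i + real i * q = lval r n k + real k * q"
      "\<And>j. j \<le> n \<Longrightarrow> lval r n k + real k * q \<le> lval r n j + real j * q"
    have "\<exists>j\<le>n. j \<noteq> k' \<and> lval r n j + real j * q \<le> lval r n k' + real k' * q" if k': "k' \<le> n" for k'
    proof (cases "k = k'")
      case True
      then show ?thesis using q by (intro exI[of _ i]) auto
    next
      case False
      then show ?thesis using q(3) q(5)[OF k'] by (intro exI[of _ k]) auto
    qed
    then show thesis by (rule that[OF q(1)])
  qed
qed

text \<open>With \<open>E = 1 - (p - 1) q\<close>, the terms of the exponential series are governed
  by \<open>digit_sum_unique_min\<close>. Its minimum is at a multiple of \<open>p ^ a\<close>,
  where the binomial factor is a unit; at other indices this factor can only raise the valuation, so
  the minimum stays strict.\<close>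

lemma laguerre_slope_prime_power:
  assumes a: "p ^ a dvd n" "r < p ^ a" and root: "rpoly (laguerre r n) x = 0"
  shows "\<exists>i\<ge>a. has_val x ((1 - 1 / real p ^ i) / (real p - 1))"
proof -
  have p1: "real p > 1" using prime_gt_1_nat[OF p] by simp
  obtain q where q: "has_val x q"
    "\<And>k. k \<le> n \<Longrightarrow> \<exists>j\<le>n. j \<noteq> k \<and> lval r n j + real j * q \<le> lval r n k + real k * q"
    using laguerre_root_slope[OF root] by blast
  define E where "E = 1 - (real p - 1) * q"
  have "\<exists>i\<ge>a. E = 1 / real p ^ i"
  proof (rule ccontr)
    assume "\<not> ?thesis"
    then obtain k where k: "k \<le> n" "p ^ a dvd k"
      "\<And>j. j \<le> n \<Longrightarrow> j \<noteq> k \<Longrightarrow> digit_sum p k - E * real k < digit_sum p j - E * real j"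
      using digit_sum_unique_min[OF p a(1), of E] by blast
    have ds: "digit_sum p j - E * real j = (real p - 1) * (- real (multiplicity p (fact j :: nat)) + real j * q)" for j
      by (simp add: digit_sum_def E_def algebra_simps)
    have "multiplicity p (n - k + r choose r) = 0"
      using k a by (intro multiplicity_binomial_add_power[OF p]) auto
    then have lk: "lval r n k = - real (multiplicity p (fact k :: nat))" by (simp add: lval_def)
    obtain j where j: "j \<le> n" "j \<noteq> k" "lval r n j + real j * q \<le> lval r n k + real k * q" using q(2)[OF k(1)] by blast
    have "- real (multiplicity p (fact j :: nat)) + real j * q \<le> - real (multiplicity p (fact k :: nat)) + real k * q"
      using j(3) lk by (simp add: lval_def)
    then have "digit_sum p j - E * real j \<le> digit_sum p k - E * real k"
      unfolding ds using p1 by (intro mult_left_mono) auto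
    then show False using k(3)[OF j(1,2)] by simp
  qed
  then obtain i where i: "i \<ge> a" "E = 1 / real p ^ i" by blast
  have "q = (1 - 1 / real p ^ i) / (real p - 1)" using i(2) p1 by (simp add: E_def field_simps)
  then show ?thesis using q(1) i(1) by blast
qed

text \<open>A slope times \<open>p - 1\<close> is \<open>(p ^ i - 1) / p ^ i\<close>, in lowest
  terms, so \<open>p ^ i\<close> divides the number of roots with that slope.\<close>

lemma prime_power_dvd_factor_degree:
  assumes a: "p ^ a dvd n" "r < p ^ a" and g: "g dvd laguerre r n" "g \<noteq> 0"
  shows "p ^ a dvd degree g"
proof -
  have p1: "p > 1" using prime_gt_1_nat[OF p] .
  have slope: "\<exists>i\<ge>a. has_val x ((1 - 1 / real p ^ i) / (real p - 1))" if "rpoly g x = 0" for x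
    using laguerre_slope_prime_power[OF a] rpoly_dvd[OF g(1) that] by blast
  obtain q where q: "\<And>i. i < degree g \<Longrightarrow> \<exists>x. rpoly g x = 0 \<and> has_val x (q i)"
    "\<And>\<mu>. \<mu> \<in> \<rat> \<Longrightarrow> real (card {i\<in>{..<degree g}. q i = \<mu>}) * \<mu> \<in> \<int>"
    using newton_rat_poly[OF g(2)] slope by blast
  have "p ^ a dvd card {..<degree g}"
  proof (rule dvd_card_by_fibres)
    fix \<mu> assume "\<mu> \<in> q ` {..<degree g}"
    then obtain x where x: "rpoly g x = 0" "has_val x \<mu>" using q(1) by auto
    obtain i where i: "i \<ge> a" "\<mu> = (1 - 1 / real p ^ i) / (real p - 1)"
      using slope[OF x(1)] has_val_unique[OF x(2)] by blast
    define c where "c = card {i\<in>{..<degree g}. q i = \<mu>}"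
    have "real c * \<mu> * (real p - 1) \<in> \<int>"
      unfolding c_def by (rule Ints_mult[OF q(2)[OF has_val_Rats[OF x(2)]]]) simp
    also have "real c * \<mu> * (real p - 1) = real c * (real (p ^ i - 1) / real (p ^ i))"
    proof -
      have "real p - 1 \<noteq> 0" using p1 by simp
      then have "\<mu> * (real p - 1) = 1 - 1 / real p ^ i" using i(2) by (metis nonzero_divide_eq_eq)
      also have "\<dots> = real (p ^ i - 1) / real (p ^ i)" using p1 by (simp add: of_nat_diff diff_divide_distrib)
      finally have "\<mu> * (real p - 1) = real (p ^ i - 1) / real (p ^ i)" .
      then show ?thesis by (simp only: mult.assoc)
    qed
    finally have frac: "real c * (real (p ^ i - 1) / real (p ^ i)) \<in> \<int>" .
    have pos: "p ^ i > 0" using p1 by simp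
    have "p ^ i dvd c" by (rule dvd_of_Ints_fraction[OF coprime_diff_one_right_nat[OF pos] pos frac])
    then show "p ^ a dvd c" using i(1) by (meson dvd_trans le_imp_power_dvd)
  qed simp
  then show ?thesis by simp
qed

text \<open>The condition \<open>small\<close> says that \<open>p\<close> divides none of
  \<open>n + 1\<close>, ..., \<open>n + r\<close>. The polygon has its vertices at 0,
  \<open>p * m\<close> and \<open>n\<close>, with heights 0, \<open>- m\<close> and
  \<open>- m\<close>, and coefficient \<open>j\<close> has height at least
  \<open>- (j div p)\<close>; for a valuation other than 0 and \<open>1 / p\<close> one of these
  indices would be a strict minimum.\<close>

lemma laguerre_slope_large_prime:
  assumes big: "n + r < p ^ 2" and small: "n mod p + r < p" and root: "rpoly (laguerre r n) x = 0"
  shows "has_val x 0 \<or> has_val x (1 / real p)"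
proof -
  have p1: "p > 1" using prime_gt_1_nat[OF p] .
  define m where "m = n div p"
  have n: "n = p * m + n mod p" by (simp add: m_def)
  have vf: "multiplicity p (fact j :: nat) = j div p" if "j \<le> n" for j
    using multiplicity_fact_legendre[OF p, of j 1] that big by (simp add: power2_eq_square)
  have vb: "multiplicity p (N + r choose r) = 0" if "N \<le> n" "N mod p + r < p" for N
  proof -
    have "(N + r) mod p = N mod p + r" using that(2) by (metis mod_less mod_add_left_eq)
    moreover have "r mod p = r" using that(2) by simp
    ultimately show ?thesis using multiplicity_binomial_large_prime[OF p, of r "N + r"] that big by simp
  qed
  have lval_ge: "lval r n j \<ge> - real (j div p)" if "j \<le> n" for j using vf[OF that] by (simp add: lval_def)
  have l0: "lval r n 0 = 0" using vb[of n] small by (simp add: lval_def)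
  have ln: "lval r n n = - real m" using vb[of 0] vf[of n] small by (simp add: lval_def m_def)
  have lm: "lval r n (p * m) = - real m"
  proof -
    have "n - p * m = n mod p" using n by simp
    then have "multiplicity p (n - p * m + r choose r) = 0" using vb[of "n mod p"] small by simp
    moreover have "p * m \<le> n" using n by simp
    ultimately show ?thesis using vf[of "p * m"] p1 by (simp add: lval_def)
  qed
  obtain q where q: "has_val x q"
    "\<And>k. k \<le> n \<Longrightarrow> \<exists>j\<le>n. j \<noteq> k \<and> lval r n j + real j * q \<le> lval r n k + real k * q"
    using laguerre_root_slope[OF root] by blast
  have divle: "real (j div p) \<le> real j / real p" for j by (rule of_nat_div_le_of_nat)
  consider "q = 0" | "q = 1 / real p" | "q < 0" | "0 < q" "q < 1 / real p" | "q > 1 / real p" by linarith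
  then show ?thesis
  proof cases
    case 3
    obtain j where j: "j \<le> n" "j \<noteq> n" "lval r n j + real j * q \<le> lval r n n + real n * q" using q(2)[of n] by blast
    have "real (j div p) \<le> real m" using j by (simp add: m_def div_le_mono)
    moreover have "real n * q < real j * q" using j 3 by (intro mult_strict_right_mono_neg) auto
    ultimately show ?thesis using j(3) ln lval_ge[OF j(1)] by linarith
  next
    case 4
    have "p * m \<le> n" using n by simp
    then obtain j where j: "j \<le> n" "j \<noteq> p * m" "lval r n j + real j * q \<le> lval r n (p * m) + real (p * m) * q"
      using q(2)[of "p * m"] by blast
    have le: "- real (j div p) + real j * q \<le> - real m + real (p * m) * q" using j(3) lm lval_ge[OF j(1)] by linarith
    show ?thesis
    proof (cases "j < p * m")
      case True
      have "real j < real (p * m)" using True by (simp only: of_nat_less_iff)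
      then have "(1 / real p - q) * real j < (1 / real p - q) * real (p * m)"
        using 4 by (intro mult_strict_left_mono) auto
      then have "real j / real p - q * real j < real m - q * real (p * m)" using p1 by (simp add: algebra_simps)
      then show ?thesis using le divle[of j] by (simp add: algebra_simps)
    next
      case False
      then have "real (p * m) < real j" using j(2) by (simp only: of_nat_less_iff)
      then have "real (p * m) * q < real j * q" using 4(1) by (rule mult_strict_right_mono)
      moreover have "real (j div p) \<le> real m" using j by (simp add: m_def div_le_mono)
      ultimately show ?thesis using le by linarith
    qed
  next
    case 5
    obtain j where j: "j \<le> n" "j \<noteq> 0" "lval r n j + real j * q \<le> lval r n 0 + real 0 * q" using q(2)[of 0] by blast
    have "real j * (1 / real p) < real j * q" using j 5 by (intro mult_strict_left_mono) auto
    then show ?thesis using j(3) l0 lval_ge[OF j(1)] divle[of j] by simp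
  qed (use q(1) in auto)
qed

lemma laguerre_constant_term_val:
  assumes big: "n + r < p ^ 2" and small: "n mod p + r < p"
  shows "has_val (of_rat (coeff (laguerre r n) 0) / of_rat (lead_coeff (laguerre r n))) (real (n div p))"
proof -
  have p1: "p > 1" using prime_gt_1_nat[OF p] .
  have "(n + r) mod p = n mod p + r" using small by (metis mod_less mod_add_left_eq)
  moreover have "r mod p = r" using small by simp
  ultimately have "multiplicity p (n + r choose r) = 0"
    using multiplicity_binomial_large_prime[OF p, of r "n + r"] big by simp
  moreover have "multiplicity p (fact n :: nat) = n div p"
    using multiplicity_fact_legendre[OF p, of n 1] big by (simp add: power2_eq_square)
  ultimately have "lval r n 0 - lval r n n = real (n div p)" by (simp add: lval_def)
  then show ?thesis
    using has_val_divide[OF has_val_laguerre_coeff[of 0 n r] has_val_laguerre_coeff[of n n r]] by simp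
qed

text \<open>By integrality the number of roots of valuation \<open>1 / p\<close> is a multiple
  \<open>p * a\<close>, and they alone contribute to the valuation of the constant
  coefficient.\<close>

lemma card_slope_large_prime:
  assumes big: "n + r < p ^ 2" and small: "n mod p + r < p" and g: "g dvd laguerre r n" "g \<noteq> 0"
  obtains a where "p * a \<le> degree g" "has_val (of_rat (coeff g 0) / of_rat (lead_coeff g)) (real a)"
proof -
  have p1: "p > 1" using prime_gt_1_nat[OF p] .
  have slope: "has_val x 0 \<or> has_val x (1 / real p)" if "rpoly g x = 0" for x
    using laguerre_slope_large_prime[OF big small] rpoly_dvd[OF g(1) that] by blast
  obtain q where q: "\<And>i. i < degree g \<Longrightarrow> \<exists>x. rpoly g x = 0 \<and> has_val x (q i)"
    "\<And>\<mu>. \<mu> \<in> \<rat> \<Longrightarrow> real (card {i\<in>{..<degree g}. q i = \<mu>}) * \<mu> \<in> \<int>"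
    "has_val (of_rat (coeff g 0) / of_rat (lead_coeff g)) (\<Sum>i<degree g. q i)"
    using newton_rat_poly[OF g(2)] slope by blast
  define N where "N = {i\<in>{..<degree g}. q i = 1 / real p}"
  have "q i = 0 \<or> q i = 1 / real p" if i: "i < degree g" for i
  proof -
    obtain x where "rpoly g x = 0" "has_val x (q i)" using q(1)[OF i] by blast
    then show ?thesis using slope[of x] has_val_unique by blast
  qed
  then have "(\<Sum>i<degree g. q i) = (\<Sum>i<degree g. if q i = 1 / real p then 1 / real p else 0)"
    by (intro sum.cong) auto
  also have "\<dots> = real (card N) / real p" by (simp add: sum.If_cases N_def Int_def)
  finally have sum: "(\<Sum>i<degree g. q i) = real (card N) / real p" .
  have "p dvd card N"
    using q(2)[of "1 / real p"] p1 by (intro dvd_of_Ints_fraction[of p 1]) (auto simp: N_def)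
  then obtain a where a: "card N = p * a" by blast
  have "card N \<le> degree g" using card_mono[of "{..<degree g}" N] by (auto simp: N_def)
  then show ?thesis using that[of a] a q(3) sum p1 by simp
qed

text \<open>Let \<open>p * a\<close> and \<open>p * b\<close> count the roots of \<open>g\<close>
  and \<open>h\<close> of valuation \<open>1 / p\<close>. Comparing constant coefficients gives
  \<open>a + b = n div p\<close>, so the remaining degrees add up to \<open>n mod p\<close>: the
  degrees add without a carry modulo \<open>p\<close>.\<close>

lemma large_prime_not_dvd_binomial:
  assumes big: "n + r < p ^ 2" and small: "n mod p + r < p" and gh: "laguerre r n = g * h"
  shows "\<not> p dvd (n choose degree g)"
proof -
  have p1: "p > 1" using prime_gt_1_nat[OF p] .
  have nz: "g \<noteq> 0" "h \<noteq> 0" using gh laguerre_nonzero[of r n] by auto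
  have n: "n = degree g + degree h" using gh nz degree_laguerre[of r n] by (simp add: degree_mult_eq)
  obtain a where a: "p * a \<le> degree g" "has_val (of_rat (coeff g 0) / of_rat (lead_coeff g)) (real a)"
    using card_slope_large_prime[OF big small _ nz(1)] gh by auto
  obtain b where b: "p * b \<le> degree h" "has_val (of_rat (coeff h 0) / of_rat (lead_coeff h)) (real b)"
    using card_slope_large_prime[OF big small _ nz(2)] gh by auto
  have "has_val (of_rat (coeff (laguerre r n) 0) / of_rat (lead_coeff (laguerre r n))) (real a + real b)"
    using has_val_mult[OF a(2) b(2)] unfolding gh lead_coeff_mult by (simp add: coeff_mult_0 of_rat_mult)
  then have "real a + real b = real (n div p)"
    using has_val_unique laguerre_constant_term_val[OF big small] by blast
  then have ab: "a + b = n div p" by (simp flip: of_nat_add)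
  define d' where "d' = degree g - p * a"
  define e' where "e' = degree h - p * b"
  have "p * (a + b) + n mod p = n" unfolding ab by simp
  then have "d' + e' = n mod p" using n a(1) b(1) by (simp add: d'_def e'_def algebra_simps)
  moreover have "n mod p < p" using p1 by simp
  ultimately have d': "d' \<le> n mod p" "d' < p" by auto
  have "degree g mod p = d'" using a(1) d'(2) unfolding d'_def
    by (metis le_add_diff_inverse mod_less mod_mult_self4)
  then have "\<not> n mod p < degree g mod p" using d' by simp
  then have "multiplicity p (n choose degree g) = 0"
    using multiplicity_binomial_large_prime[OF p, of "degree g" n] n big by simp
  moreover have "n choose degree g \<noteq> 0" using n by simp
  ultimately show ?thesis using p1 by (simp add: multiplicity_eq_zero_iff)
qed

end

subsection \<open>Irreducibility\<close>

text \<open>The full power of a prime in \<open>n\<close> is either at most \<open>r\<close>, and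
  then divides \<open>fact r\<close>, or exceeds \<open>r\<close>, and then divides the
  degree.\<close>

lemma dvd_factor_degree_mult_fact:
  assumes "n > 0" and g: "g dvd laguerre r n" "degree g > 0"
  shows "n dvd degree g * fact r"
proof (rule multiplicity_le_imp_dvd)
  show "n \<noteq> 0" using assms by simp
  fix p :: nat assume p: "prime p"
  obtain A where "valuation_ring p A" using ex_valuation_ring_locale[OF p] by blast
  then interpret valuation_ring p A .
  have g0: "g \<noteq> 0" using g(2) by auto
  define v where "v = multiplicity p n"
  have pv: "p ^ v dvd n" unfolding v_def by (rule multiplicity_dvd)
  have "p ^ v dvd degree g * fact r"
  proof (cases "p ^ v \<le> r")
    case True
    then have "p ^ v dvd fact r" using prime_gt_0_nat[OF p] by (intro dvd_fact) auto
    then show ?thesis by simp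
  next
    case False
    then have "p ^ v dvd degree g" using prime_power_dvd_factor_degree[OF pv _ g(1) g0] by simp
    then show ?thesis by simp
  qed
  then show "multiplicity p n \<le> multiplicity p (degree g * fact r)"
    unfolding v_def[symmetric] using g(2) prime_gt_1_nat[OF p] by (intro multiplicity_geI) auto
qed

text \<open>A prime above \<open>s\<close> that divides the binomial coefficient also divides one of
  \<open>n + 1\<close>, ..., \<open>n + r\<close>, so the product of these primes is at most
  \<open>(n + r) ^ r\<close>.\<close>

lemma binomial_factor_degree_le:
  assumes gh: "laguerre r n = g * h" and n: "n > 0" and s: "n + r < (Suc s) ^ 2"
  shows "n choose degree g \<le> (n + r) ^ (s + r)"
proof -
  have nz: "g \<noteq> 0" "h \<noteq> 0" using gh laguerre_nonzero[of r n] by auto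
  have dn: "n = degree g + degree h" using gh nz degree_laguerre[of r n] by (simp add: degree_mult_eq)
  define P where "P = {p. prime p \<and> s < p \<and> p dvd (n choose degree g)}"
  have "P \<subseteq> {..n choose degree g}" using dn by (auto simp: P_def dest: dvd_imp_le)
  then have finP: "finite P" using finite_subset by blast
  have "\<Prod>P dvd (\<Prod>i=1..r. n + i)"
  proof (rule prod_primes_dvd[OF finP])
    fix p assume "p \<in> P"
    then have pp: "prime p" "s < p" "p dvd (n choose degree g)" by (auto simp: P_def)
    obtain A where "valuation_ring p A" using ex_valuation_ring_locale[OF pp(1)] by blast
    then interpret valuation_ring p A .
    have "(Suc s) ^ 2 \<le> p ^ 2" using pp(2) by (intro power_mono) auto
    then have big: "n + r < p ^ 2" using s by linarith
    then have "\<not> n mod p + r < p" using large_prime_not_dvd_binomial[OF _ _ gh] pp(3) by blast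
    moreover have mp: "n mod p < p" using prime_gt_0_nat[OF pp(1)] by simp
    ultimately have i: "p - n mod p \<in> {1..r}" by auto
    have "p dvd n + (p - n mod p)"
    proof -
      have "n + (p - n mod p) = p * (n div p) + p" using mp mult_div_mod_eq[of p n] by linarith
      then show ?thesis by simp
    qed
    then show "p dvd (\<Prod>i=1..r. n + i)" using i by (meson dvd_prodI dvd_trans finite_atLeastAtMost)
  qed (simp add: P_def)
  then have "\<Prod>P \<le> (\<Prod>i=1..r. n + i)" using n by (intro dvd_imp_le) (auto intro!: prod_pos)
  also have "\<dots> \<le> (\<Prod>i=1..r. n + r)" by (rule prod_mono) auto
  also have "\<dots> = (n + r) ^ r" by simp
  finally have P: "\<Prod>P \<le> (n + r) ^ r" .
  have "n choose degree g \<le> n ^ s * \<Prod>P"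
    unfolding P_def using dn n s by (intro binomial_le_prod_large_primes) auto
  also have "\<dots> \<le> (n + r) ^ s * (n + r) ^ r" using P by (intro mult_mono power_mono) auto
  finally show ?thesis by (simp add: power_add)
qed

lemma laguerre_eventually_irreducible:
  "eventually (\<lambda>n. irreducible (laguerre r n)) at_top"
proof -
  define F where "F = real (fact r)"
  have F: "F > 0" by (simp add: F_def)
  have "eventually (\<lambda>n::nat. (real n + real r) powr (sqrt (real n + real r) + real r) < 2 powr (real n / F)) at_top"
    using F by real_asymp
  then show ?thesis using eventually_gt_at_top[of 0]
  proof eventually_elim
    case (elim n)
    define s where "s = nat \<lfloor>sqrt (real n + real r)\<rfloor>"
    have s: "real s \<le> sqrt (real n + real r)" "sqrt (real n + real r) < real (Suc s)"
      unfolding s_def by (auto simp: of_nat_nat) linarith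
    have s2: "n + r < (Suc s) ^ 2"
    proof -
      have "(sqrt (real n + real r)) ^ 2 < (real (Suc s)) ^ 2" using s(2) by (intro power_strict_mono) auto
      then have "real (n + r) < real ((Suc s) ^ 2)" by simp
      then show ?thesis by (simp only: of_nat_less_iff)
    qed
    show "irreducible (laguerre r n)"
    proof (rule ccontr)
      assume "\<not> irreducible (laguerre r n)"
      moreover have "\<not> is_unit (laguerre r n)" using is_unit_iff_degree[of "laguerre r n"] elim(2) by simp
      ultimately obtain g h where gh: "laguerre r n = g * h" "\<not> is_unit g" "\<not> is_unit h"
        unfolding irreducible_def by auto
      have nz: "g \<noteq> 0" "h \<noteq> 0" using gh(1) laguerre_nonzero[of r n] by auto
      have dg: "degree g > 0" "degree h > 0" using gh nz is_unit_iff_degree by auto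
      have dn: "n = degree g + degree h" using gh nz degree_laguerre[of r n] by (simp add: degree_mult_eq)
      have "n \<le> degree g * fact r" "n \<le> degree h * fact r"
        using dvd_factor_degree_mult_fact[OF elim(2) _ dg(1)] dvd_factor_degree_mult_fact[OF elim(2) _ dg(2)] gh(1) dg
        by (auto intro!: dvd_imp_le)
      \<comment> \<open>The smaller degree satisfies \<open>n / fact r \<le> k\<close> and
        \<open>2 * k \<le> n\<close>, which gives
        \<open>n choose k \<ge> (n / k) ^ k \<ge> 2 powr (n / fact r)\<close>.\<close>
      moreover define k where "k = min (degree g) (degree h)"
      ultimately have nk: "n \<le> k * fact r" by (simp add: min_def)
      have k: "2 * k \<le> n" "k > 0" "k \<le> n" using dn dg by (auto simp: k_def)
      have choose: "n choose k = (n choose degree g)"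
        using dn binomial_symmetric[of "degree g" n] by (simp add: k_def min_def)
      have "real n \<le> real k * F"
      proof -
        have "real n \<le> real (k * fact r)" using nk by (simp only: of_nat_le_iff)
        then show ?thesis by (simp add: F_def)
      qed
      then have "real n / F \<le> real k" using F by (simp add: field_simps)
      then have "2 powr (real n / F) \<le> 2 powr (real k)" by (intro powr_mono) auto
      also have "\<dots> = 2 ^ k" by (simp add: powr_realpow)
      also have "\<dots> \<le> (real n / real k) ^ k"
        using k by (intro power_mono) (auto simp: field_simps)
      also have "\<dots> \<le> real (n choose k)" by (rule binomial_ge_n_over_k_pow_k[OF k(3)])
      also have "\<dots> \<le> real ((n + r) ^ (s + r))"
        unfolding choose using binomial_factor_degree_le[OF gh(1) elim(2) s2] by (simp only: of_nat_le_iff)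
      also have "\<dots> = (real n + real r) powr (real s + real r)"
        using elim(2) by (simp add: powr_realpow flip: of_nat_add)
      also have "\<dots> \<le> (real n + real r) powr (sqrt (real n + real r) + real r)"
        using s(1) elim(2) by (intro powr_mono) auto
      also have "\<dots> < 2 powr (real n / F)" by (rule elim(1))
      finally show False by simp
    qed
  qed
qed

subsection \<open>The Galois group\<close>

lemma prime_dvd_card_galois:
  assumes irr: "irreducible (laguerre r n)" and pp: "prime p" "n + r + 3 \<le> 2 * p" "p \<le> n"
  shows "p dvd card (galois_perms (laguerre r n))"
proof -
  let ?f = "laguerre r n"
  let ?R = "complex_roots ?f"
  let ?G = "galois_perms ?f"
  obtain A where "valuation_ring p A" using ex_valuation_ring_locale[OF pp(1)] by blast
  then interpret valuation_ring p A .
  obtain t c where "primitive_root_field ?f t c" using ex_primitive_root_field[OF irr] by blast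
  then interpret gal: primitive_root_field "?f" t c .
  interpret G: perm_group "?R" "?G" by (rule gal.galois_perm_group)
  have p2: "p \<ge> 2" using prime_ge_2_nat[OF pp(1)] .
  have "2 * p \<le> p ^ 2" using p2 by (simp add: power2_eq_square)
  then have big: "n + r < p ^ 2" using pp(2) by linarith
  have np: "n div p = 1" "n mod p = n - p"
  proof -
    show "n div p = 1" using pp(2,3) by (intro div_nat_eqI) auto
    then show "n mod p = n - p" by (simp add: modulo_nat_def)
  qed
  have small: "n mod p + r < p" using np pp by linarith
  note cr = irreducible_card_roots[OF irr]
  have cardR: "card ?R = n" using cr(2) by simp
  define q where "q z = (if has_val z 0 then 0 else 1 / real p)" for z
  have q: "has_val z (q z)" if "z \<in> ?R" for z
    using laguerre_slope_large_prime[OF big small, of z] that by (auto simp: q_def complex_roots_altdef)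
  define P where "P = {z\<in>?R. q z \<noteq> 0}"
  have finP: "finite P" using cr(1) by (simp add: P_def)
  have qsum: "(\<Sum>z\<in>Z. q z) = real (card (Z \<inter> P)) / real p" if "Z \<subseteq> ?R" for Z
  proof -
    have finZ: "finite Z" using that cr(1) finite_subset by blast
    have "(\<Sum>z\<in>Z. q z) = (\<Sum>z\<in>Z \<inter> P. q z)"
      using that by (intro sum.mono_neutral_right finZ) (auto simp: P_def)
    also have "\<dots> = (\<Sum>z\<in>Z \<inter> P. 1 / real p)" by (intro sum.cong) (auto simp: P_def q_def)
    finally show ?thesis by simp
  qed
  \<comment> \<open>The product of the roots has valuation \<open>n div p = 1\<close>, and this
    counts the roots in \<open>P\<close>.\<close>
  have "has_val (\<Prod>z\<in>?R. - z) (\<Sum>z\<in>?R. q z)" by (intro has_val_prod has_val_minus q)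
  moreover have "(\<Prod>z\<in>?R. - z) = of_rat (coeff ?f 0) / of_rat (lead_coeff ?f)"
  proof -
    have "of_rat (coeff ?f 0) = coeff (map_poly of_rat ?f :: complex poly) 0" by (simp add: coeff_map_poly)
    also have "\<dots> = of_rat (lead_coeff ?f) * (\<Prod>z\<in>?R. - z)"
      by (subst cr(3)) (simp add: poly_0_coeff_0[symmetric] poly_prod)
    moreover have "coeff ?f n \<noteq> 0" by (simp add: coeff_laguerre)
    ultimately show ?thesis by simp
  qed
  ultimately have "(\<Sum>z\<in>?R. q z) = real (n div p)"
    using laguerre_constant_term_val[OF big small] has_val_unique by metis
  then have "real (card (?R \<inter> P)) / real p = 1" using qsum[of ?R] np by simp
  then have "real (card (?R \<inter> P)) = real p" using p2 by (simp add: field_simps)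
  moreover have "?R \<inter> P = P" by (auto simp: P_def)
  ultimately have cardP: "card P = p" by (simp only: of_nat_eq_iff)
  \<comment> \<open>This size exceeds the number of roots outside \<open>P\<close> and stays below
    \<open>p\<close>; the same holds for every image of \<open>T\<close> under the group.\<close>
  have "n - p + 1 \<le> card ?R" using cardR pp p2 by linarith
  then obtain T where T: "T \<subseteq> ?R" "card T = n - p + 1"
    using obtain_subset_with_card_n by metis
  define b where "b \<pi> = (\<Prod>z\<in>T. \<pi> z)" for \<pi> :: "complex \<Rightarrow> complex"
  define k where "k \<pi> = card (\<pi> ` T \<inter> P)" for \<pi> :: "complex \<Rightarrow> complex"
  have val: "has_val (b \<pi>) (real (k \<pi>) / real p)" and k: "0 < k \<pi>" "k \<pi> < p" if \<pi>: "\<pi> \<in> ?G" for \<pi>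
  proof -
    have inj: "inj_on \<pi> T" using G.injG[OF \<pi>] inj_on_subset by blast
    have im: "\<pi> ` T \<subseteq> ?R" using T(1) permutes_image[OF G.perm[OF \<pi>]] by blast
    have card_im: "card (\<pi> ` T) = n - p + 1" using card_image[OF inj] T(2) by simp
    have fin_im: "finite (\<pi> ` T)" using im cr(1) finite_subset by blast
    have "b \<pi> = (\<Prod>z\<in>\<pi> ` T. z)" by (simp add: b_def prod.reindex[OF inj])
    moreover have "has_val (\<Prod>z\<in>\<pi> ` T. z) (\<Sum>z\<in>\<pi> ` T. q z)" by (intro has_val_prod q) (use im in auto)
    ultimately show "has_val (b \<pi>) (real (k \<pi>) / real p)" using qsum[OF im] by (simp add: k_def)
    have "card (\<pi> ` T \<union> P) \<le> n" using card_mono[OF cr(1), of "\<pi> ` T \<union> P"] im cardR by (auto simp: P_def)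
    then show "0 < k \<pi>"
      using card_Un_Int[OF fin_im finP] card_im cardP pp(3) by (simp add: k_def)
    have "k \<pi> \<le> card (\<pi> ` T)" unfolding k_def by (intro card_mono fin_im) auto
    then show "k \<pi> < p" using card_im pp by linarith
  qed
  \<comment> \<open>The group elements are sorted by the valuation of their resolvent root;
    \<open>p\<close> divides the size of each class because \<open>k \<pi>\<close> is prime to
    \<open>p\<close>.\<close>
  have "p dvd card ?G"
  proof (rule dvd_card_by_fibres)
    show "finite ?G" by (rule G.finG)
    fix \<mu> assume "\<mu> \<in> (\<lambda>\<pi>. real (k \<pi>) / real p) ` ?G"
    then obtain \<pi>0 where \<pi>0: "\<pi>0 \<in> ?G" "\<mu> = real (k \<pi>0) / real p" by blast
    have "real (card {\<pi>\<in>?G. real (k \<pi>) / real p = \<mu>}) * \<mu> \<in> \<int>"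
    proof (rule newton_count[OF G.finG val])
      show "coeff (\<Prod>\<pi>\<in>?G. [:- b \<pi>, 1:]) j \<in> \<rat>" for j
        unfolding b_def by (rule gal.galois_resolvent_rational[OF T(1)])
      show "\<mu> \<in> \<rat>" unfolding \<pi>0 by simp
    qed
    then have "real (card {\<pi>\<in>?G. real (k \<pi>) / real p = \<mu>}) * (real (k \<pi>0) / real p) \<in> \<int>"
      unfolding \<pi>0(2) .
    moreover have "coprime p (k \<pi>0)"
      using k[OF \<pi>0(1)] pp(1) by (intro prime_imp_coprime) (auto dest: dvd_imp_le)
    ultimately show "p dvd card {\<pi>\<in>?G. real (k \<pi>) / real p = \<mu>}"
      using p2 by (intro dvd_of_Ints_fraction[of p "k \<pi>0"]) auto
  qed
  then show ?thesis .
qed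

theorem theorem1p3:
  fixes r :: nat
  shows "finite {n. \<not> (Factorial_Ring.irreducible (laguerre r n) \<and>
                       alternating_perms (complex_roots (laguerre r n)) \<subseteq> galois_perms (laguerre r n))}"
proof -
  have "eventually (\<lambda>n. irreducible (laguerre r n) \<and>
      alternating_perms (complex_roots (laguerre r n)) \<subseteq> galois_perms (laguerre r n)) at_top"
    using laguerre_eventually_irreducible[of r] ex_prime_upper_half[of r]
  proof eventually_elim
    case (elim n)
    let ?f = "laguerre r n"
    obtain p where p: "prime p" "n + r + 3 \<le> 2 * p" "p + 3 \<le> n" using elim(2) by blast
    obtain t c where "primitive_root_field ?f t c" using ex_primitive_root_field[OF elim(1)] by blast
    then interpret gal: primitive_root_field "?f" t c .
    interpret G: perm_group "complex_roots ?f" "galois_perms ?f" by (rule gal.galois_perm_group)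
    have card: "card (complex_roots ?f) = n" using irreducible_card_roots(2)[OF elim(1)] by simp
    have "p dvd card (galois_perms ?f)"
      by (rule prime_dvd_card_galois[OF elim(1) p(1,2)]) (use p(3) in simp)
    then have "alternating_perms (complex_roots ?f) \<subseteq> galois_perms ?f"
      using G.jordan_prime_cycle[OF gal.galois_transitive p(1)] card p by simp
    then show ?case using elim(1) by blast
  qed
  then show ?thesis
    unfolding cofinite_eq_sequentially[symmetric] eventually_cofinite .
qed

end
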